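(* In the setting of the context (multilevel systems $(\Psi^i,\Phi^i)$, $(\breve\Psi^i,\breve\Phi^i)$ and local linear operators $A_i$, $i\in\{0,1\}$), let $\boldsymbol{\breve\Lambda}\subset\breve\vee^0\times\breve\vee^1$ and $\boldsymbol\Lambda\subset\vee^0\times\vee^1$ be finite double-trees. Then $R_{\boldsymbol{\breve\Lambda}}(\mathbf A_0\otimes\mathbf A_1)I_{\boldsymbol\Lambda}$ can be applied (to an arbitrary vector in $\ell_2(\boldsymbol\Lambda)$) in $\mathcal O(\#\boldsymbol{\breve\Lambda}+\#\boldsymbol\Lambda)$ operations.
   Context: Multilevel system on a domain $Q$. It consists of a collection of functions $\Psi=\{\psi_\lambda:\lambda\in\vee\}$ on $Q$ with level $|\lambda|\in\mathbb N_0$, and collections $\Phi_\ell=\{\phi_\lambda:\lambda\in\Delta_\ell\}$, $\ell\in\mathbb N_0$ ("scaling functions"), with mutually disjoint index sets $\Delta_\ell$, $\Phi=\bigcup_\ell\Phi_\ell$. Put $\vee_\ell=\{\lambda\in\vee:|\lambda|=\ell\}$, $\Psi_\ell=\{\psi_\lambda:\lambda\in\vee_\ell\}$. Assumed are: - $\sup_{\lambda\in\vee}2^{|\lambda|}\operatorname{diam}\operatorname{supp}\psi_\lambda<\infty$ and $\sup_{\ell}\sup_{x\in Q}\#\{\lambda\in\vee_\ell:\operatorname{supp}\psi_\lambda\cap B(x;2^{-\ell})\ne\emptyset\}<\infty$; - $\operatorname{span}\Phi_{\ell+1}\supseteq\operatorname{span}\Phi_\ell\cup\Psi_{\ell+1}$,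 and $\Phi_0=\Psi_0$ ($\Delta_0=\vee_0$); - $\sup_\ell\sup_{\lambda\in\Delta_\ell}2^\ell\operatorname{diam}\operatorname{supp}\phi_\lambda<\infty$ and $\sup_\ell\sup_{x\in Q}\#\{\lambda\in\Delta_\ell:\operatorname{supp}\phi_\lambda\cap B(x;2^{-\ell})\neq\emptyset\}<\infty$; - for all open $\Sigma\subset Q$ and $\ell\in\mathbb N_0$, $\{\phi_\lambda|_\Sigma:\lambda\in\Delta_\ell,\ \phi_\lambda|_\Sigma\not\equiv0\}$ is linearly independent. Consequently there are matrices $\mathfrak p_\ell,\mathfrak q_\ell$ ($\ell\ge1$; "mask matrices"), with uniformly bounded numbers of non-zeros per row and column, such that $[\Phi_{\ell-1}^\top\ \Psi_\ell^\top]=\Phi_\ell^\top[\mathfrak p_\ell\ \mathfrak q_\ell]$ (collections are viewed as column vectors). Parents and trees. $|\cdot|$ of a subset of $Q$ is its measure. To each $\lambda\in\vee$ with $|\lambda|>0$ one or more parents $\mu\in\vee$ are associated, with $|\mu|=|\lambda|-1$ and $|\operatorname{supp}\psi_\lambda\cap\operatorname{supp}\psi_\mu|>0$. To each $\lambda\in\vee$ a neighbourhood $S(\lambda)$ of $\operatorname{supp}\psi_\lambda$ is associated, with diameter $\lesssim2^{-|\lambda|}$, such that $S(\lambda)\subset\bigcup_{\mu\in\mathrm{parent}(\lambda)}S(\mu)$ when $|\lambda|>0$. A finite $\Lambda\subset\vee$ is a tree if for every $\lambda\in\Lambda$ all its parents are in $\Lambda$. Tensor setting. For $i\in\{0,1\}$,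 $(\Psi^i,\Phi^i)$ and $(\breve\Psi^i,\breve\Phi^i)$ are two multilevel systems on a common domain $Q^i$, with index sets $\vee^i,\breve\vee^i$ and neighbourhoods $S^i,\breve S^i$. $A_i:\operatorname{span}\Phi^i\to(\operatorname{span}\breve\Phi^i)'$ is linear and local, i.e. $(A_iu)(v)=(A_iu|_{\operatorname{supp}v})(v)$: $(A_iu)(v)$ depends on $u$ only through its restriction to $\operatorname{supp}v$ (up to null sets; in particular it vanishes when $|\operatorname{supp}u\cap\operatorname{supp}v|=0$). Set $\mathbf A_i:=[(A_i\psi^i_\mu)(\breve\psi^i_\lambda)]_{\lambda\in\breve\vee^i,\mu\in\vee^i}$. Double-trees. $P_i(b_0,b_1):=b_i$ and $\neg i:=1-i$. A subset $\boldsymbol\Lambda$ of one of $\breve\vee^0\times\breve\vee^1$, $\vee^0\times\breve\vee^1$, $\breve\vee^0\times\vee^1$, $\vee^0\times\vee^1$ is a double-tree when for $i\in\{0,1\}$ and any $\mu\in P_{\neg i}\boldsymbol\Lambda$ the fiber $\boldsymbol\Lambda_{i,\mu}:=P_i(P_{\neg i}|_{\boldsymbol\Lambda})^{-1}\{\mu\}$ is a tree (in $\breve\vee^i$ or $\vee^i$). Extension and restriction. $I_{\boldsymbol\Lambda}$ is the extension by zero of vectors on $\boldsymbol\Lambda$ to vectors on $\vee^0\times\vee^1$, and $R_{\boldsymbol{\breve\Lambda}}$ is the restriction of vectors on $\breve\vee^0\times\breve\vee^1$ to $\boldsymbol{\breve\Lambda}$. So the matrix in question is $[(A_0\psi^0_{\mu_0})(\breve\psi^0_{\lambda_0})\,(A_1\psi^1_{\mu_1})(\breve\psi^1_{\lambda_1})]_{(\lambda_0,\lambda_1)\in\boldsymbol{\breve\Lambda},(\mu_0,\mu_1)\in\boldsymbol\Lambda}$.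 Cost convention: an operation is an arithmetic operation, the evaluation of one entry $(A_i\phi)(\breve\phi)$ for scaling functions $\phi\in\Phi^i$, $\breve\phi\in\breve\Phi^i$, the access of a non-zero of a mask matrix, or an elementary lookup (traversing a tree or fiber, or listing overlapping supports/neighbourhoods on the same or adjacent levels); the constant in $\mathcal O$ depends only on the multilevel systems, not on $\boldsymbol\Lambda,\boldsymbol{\breve\Lambda}$ or the vector. *)

theory Defs
  imports "HOL-Analysis.Analysis" "HOL-Library.Function_Algebras"
begin

section \<open>Multilevel systems\<close>

text \<open>A function on \<open>Q\<close> is represented by a total function that vanishes off \<open>Q\<close>.\<close>

definition fscale :: "real \<Rightarrow> ('a \<Rightarrow> real) \<Rightarrow> 'a \<Rightarrow> real"
  where "fscale c f = (\<lambda>x. c * f x)"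

global_interpretation fspace: vector_space "fscale :: real \<Rightarrow> ('a \<Rightarrow> real) \<Rightarrow> 'a \<Rightarrow> real"
  by unfold_locales (auto simp: fscale_def algebra_simps)

definition fun_restrict :: "'a set \<Rightarrow> ('a \<Rightarrow> real) \<Rightarrow> 'a \<Rightarrow> real"
  where "fun_restrict \<Sigma> f = (\<lambda>x. if x \<in> \<Sigma> then f x else 0)"

definition supp :: "'a::topological_space set \<Rightarrow> ('a \<Rightarrow> real) \<Rightarrow> 'a set"
  where "supp Q f = Q \<inter> closure (support_on Q f)"

text \<open>Since the \<open>\<Delta>\<^sub>\<ell>\<close> are disjoint, one map \<open>scl\<close> carries the scaling functions of all levels.
  \<open>lvl\<close>, \<open>parents\<close> and \<open>nbhd\<close> (the sets \<open>S(\<kappa>)\<close>) refer to wavelet indices.\<close>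

record ('a, 'i) multilevel =
  wvl_idx :: "'i set"
  wvl :: "'i \<Rightarrow> 'a \<Rightarrow> real"
  lvl :: "'i \<Rightarrow> nat"
  scl_idx :: "nat \<Rightarrow> 'i set"
  scl :: "'i \<Rightarrow> 'a \<Rightarrow> real"
  parents :: "'i \<Rightarrow> 'i set"
  nbhd :: "'i \<Rightarrow> 'a set"

definition wvl_lev :: "('a, 'i) multilevel \<Rightarrow> nat \<Rightarrow> 'i set"
  where "wvl_lev M l = {\<kappa> \<in> wvl_idx M. lvl M \<kappa> = l}"

definition scl_all :: "('a, 'i) multilevel \<Rightarrow> 'i set"
  where "scl_all M = (\<Union>l. scl_idx M l)"

definition scl_span :: "('a, 'i) multilevel \<Rightarrow> ('a \<Rightarrow> real) set"
  where "scl_span M = fspace.span (scl M ` scl_all M)"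

text \<open>\<open>diameter\<close> is only meaningful on bounded sets, hence the explicit boundedness.\<close>

definition diam_le :: "'a::metric_space set \<Rightarrow> real \<Rightarrow> bool"
  where "diam_le X d \<longleftrightarrow> bounded X \<and> diameter X \<le> d"

locale multilevel_system =
  fixes Q :: "'a::euclidean_space set" and M :: "('a, 'i) multilevel"
  assumes domain: "open Q" "connected Q" "Q \<noteq> {}"
    and wvl_on: "\<And>\<kappa> x. \<kappa> \<in> wvl_idx M \<Longrightarrow> x \<notin> Q \<Longrightarrow> wvl M \<kappa> x = 0"
    and scl_on: "\<And>\<kappa> x. \<kappa> \<in> scl_all M \<Longrightarrow> x \<notin> Q \<Longrightarrow> scl M \<kappa> x = 0"
    and scl_disjoint: "\<And>k l. k \<noteq> l \<Longrightarrow> scl_idx M k \<inter> scl_idx M l = {}"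
    and wvl_diam: "\<exists>C. \<forall>\<kappa>\<in>wvl_idx M. diam_le (supp Q (wvl M \<kappa>)) (C / 2 ^ lvl M \<kappa>)"
    and wvl_local: "\<exists>N. \<forall>l. \<forall>x\<in>Q.
          finite {\<kappa> \<in> wvl_lev M l. supp Q (wvl M \<kappa>) \<inter> ball x (1 / 2 ^ l) \<noteq> {}} \<and>
          card {\<kappa> \<in> wvl_lev M l. supp Q (wvl M \<kappa>) \<inter> ball x (1 / 2 ^ l) \<noteq> {}} \<le> N"
    and span_refine: "\<And>l. fspace.span (scl M ` scl_idx M l) \<union> wvl M ` wvl_lev M (Suc l)
          \<subseteq> fspace.span (scl M ` scl_idx M (Suc l))"
    and level_zero: "scl_idx M 0 = wvl_lev M 0"
        "\<And>\<kappa>. \<kappa> \<in> scl_idx M 0 \<Longrightarrow> scl M \<kappa> = wvl M \<kappa>"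
    and scl_diam: "\<exists>C. \<forall>l. \<forall>\<kappa>\<in>scl_idx M l. diam_le (supp Q (scl M \<kappa>)) (C / 2 ^ l)"
    and scl_local: "\<exists>N. \<forall>l. \<forall>x\<in>Q.
          finite {\<kappa> \<in> scl_idx M l. supp Q (scl M \<kappa>) \<inter> ball x (1 / 2 ^ l) \<noteq> {}} \<and>
          card {\<kappa> \<in> scl_idx M l. supp Q (scl M \<kappa>) \<inter> ball x (1 / 2 ^ l) \<noteq> {}} \<le> N"
    \<comment> \<open>linear independence as a family: no repetitions, and the set is independent\<close>
    and scl_indep: "\<And>l \<Sigma> J. open \<Sigma> \<Longrightarrow> \<Sigma> \<subseteq> Q \<Longrightarrow>
          J = {\<kappa> \<in> scl_idx M l. \<exists>x\<in>\<Sigma>. scl M \<kappa> x \<noteq> 0} \<Longrightarrow>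
          inj_on (\<lambda>\<kappa>. fun_restrict \<Sigma> (scl M \<kappa>)) J \<and>
          fspace.independent ((\<lambda>\<kappa>. fun_restrict \<Sigma> (scl M \<kappa>)) ` J)"
    and parents_zero: "\<And>\<kappa>. \<kappa> \<in> wvl_lev M 0 \<Longrightarrow> parents M \<kappa> = {}"
    and parents_Suc: "\<And>l \<kappa>. \<kappa> \<in> wvl_lev M (Suc l) \<Longrightarrow> parents M \<kappa> \<noteq> {} \<and>
          parents M \<kappa> \<subseteq> {\<mu> \<in> wvl_lev M l.
            emeasure lborel (supp Q (wvl M \<kappa>) \<inter> supp Q (wvl M \<mu>)) > 0}"
    and nbhd: "\<And>\<kappa>. \<kappa> \<in> wvl_idx M \<Longrightarrow> nbhd M \<kappa> \<subseteq> Q \<and>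
          (\<exists>U. open U \<and> supp Q (wvl M \<kappa>) \<subseteq> U \<and> U \<subseteq> nbhd M \<kappa>)"
    and nbhd_diam: "\<exists>C. \<forall>\<kappa>\<in>wvl_idx M. diam_le (nbhd M \<kappa>) (C / 2 ^ lvl M \<kappa>)"
    and nbhd_parents: "\<And>\<kappa>. \<kappa> \<in> wvl_idx M \<Longrightarrow> lvl M \<kappa> > 0 \<Longrightarrow>
          nbhd M \<kappa> \<subseteq> (\<Union>\<mu>\<in>parents M \<kappa>. nbhd M \<mu>)"

text \<open>The mask matrices are the unique ones: coefficients with respect to the non-zero members of
  \<open>\<Phi>\<^sub>\<ell>\<close>, which are linearly independent (take \<open>\<Sigma> = Q\<close>); a vanishing scaling function gets
  coefficient \<open>0\<close>.  The guards make \<open>mask_p M l\<close> a \<open>\<Delta>\<^sub>\<ell> \<times> \<Delta>\<^bsub>\<ell>-1\<^esub>\<close> matrix and \<open>mask_q M l\<close> a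
  \<open>\<Delta>\<^sub>\<ell> \<times> \<or>\<^sub>\<ell>\<close> matrix.\<close>

definition scl_coeff :: "('a, 'i) multilevel \<Rightarrow> nat \<Rightarrow> ('a \<Rightarrow> real) \<Rightarrow> 'i \<Rightarrow> real"
  where "scl_coeff M l f \<nu> = fspace.representation (scl M ` scl_idx M l - {0}) f (scl M \<nu>)"

definition mask_p :: "('a, 'i) multilevel \<Rightarrow> nat \<Rightarrow> 'i \<Rightarrow> 'i \<Rightarrow> real"
  where "mask_p M l \<nu> \<kappa> =
    (if l \<ge> 1 \<and> \<nu> \<in> scl_idx M l \<and> \<kappa> \<in> scl_idx M (l - 1) then scl_coeff M l (scl M \<kappa>) \<nu> else 0)"

definition mask_q :: "('a, 'i) multilevel \<Rightarrow> nat \<Rightarrow> 'i \<Rightarrow> 'i \<Rightarrow> real"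
  where "mask_q M l \<nu> \<kappa> =
    (if l \<ge> 1 \<and> \<nu> \<in> scl_idx M l \<and> \<kappa> \<in> wvl_lev M l then scl_coeff M l (wvl M \<kappa>) \<nu> else 0)"


section \<open>Local operators, trees, double-trees\<close>

text \<open>\<open>A u v\<close> stands for \<open>(A u)(v)\<close>.  Below, unprimed systems are the \<open>(\<Psi>, \<Phi>)\<close> and primed ones the
  systems with a breve.\<close>

definition local_operator ::
  "'a::euclidean_space set \<Rightarrow> ('a, 'i) multilevel \<Rightarrow> ('a, 'i) multilevel \<Rightarrow>
   (('a \<Rightarrow> real) \<Rightarrow> ('a \<Rightarrow> real) \<Rightarrow> real) \<Rightarrow> bool"
  where "local_operator Q M M' A \<longleftrightarrow>
    (\<forall>u\<in>scl_span M. \<forall>v\<in>scl_span M'. \<forall>w\<in>scl_span M'. A u (v + w) = A u v + A u w) \<and>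
    (\<forall>u\<in>scl_span M. \<forall>v\<in>scl_span M'. \<forall>c. A u (fscale c v) = c * A u v) \<and>
    (\<forall>u\<in>scl_span M. \<forall>w\<in>scl_span M. \<forall>v\<in>scl_span M'. A (u + w) v = A u v + A w v) \<and>
    (\<forall>u\<in>scl_span M. \<forall>v\<in>scl_span M'. \<forall>c. A (fscale c u) v = c * A u v) \<and>
    (\<forall>u\<in>scl_span M. \<forall>w\<in>scl_span M. \<forall>v\<in>scl_span M'.
       (AE x in lborel. x \<in> supp Q v \<longrightarrow> u x = w x) \<longrightarrow> A u v = A w v)"

definition op_matrix ::
  "('a, 'i) multilevel \<Rightarrow> ('a, 'i) multilevel \<Rightarrow> (('a \<Rightarrow> real) \<Rightarrow> ('a \<Rightarrow> real) \<Rightarrow> real) \<Rightarrow>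
   'i \<Rightarrow> 'i \<Rightarrow> real"
  where "op_matrix M M' A \<kappa> \<mu> = A (wvl M \<mu>) (wvl M' \<kappa>)"

definition tree :: "('a, 'i) multilevel \<Rightarrow> 'i set \<Rightarrow> bool"
  where "tree M T \<longleftrightarrow> finite T \<and> T \<subseteq> wvl_idx M \<and> (\<forall>\<kappa>\<in>T. parents M \<kappa> \<subseteq> T)"

datatype axis = Ax0 | Ax1

fun other :: "axis \<Rightarrow> axis" where
  "other Ax0 = Ax1"
| "other Ax1 = Ax0"

fun axis_proj :: "axis \<Rightarrow> 'i \<times> 'i \<Rightarrow> 'i" where
  "axis_proj Ax0 b = fst b"
| "axis_proj Ax1 b = snd b"

definition fibre :: "('i \<times> 'i) set \<Rightarrow> axis \<Rightarrow> 'i \<Rightarrow> 'i set"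
  where "fibre L i \<mu> = axis_proj i ` {b \<in> L. axis_proj (other i) b = \<mu>}"

definition double_tree ::
  "('a, 'i) multilevel \<Rightarrow> ('b, 'i) multilevel \<Rightarrow> ('i \<times> 'i) set \<Rightarrow> bool"
  where "double_tree M0 M1 L \<longleftrightarrow> L \<subseteq> wvl_idx M0 \<times> wvl_idx M1 \<and>
    (\<forall>\<mu> \<in> axis_proj Ax1 ` L. tree M0 (fibre L Ax0 \<mu>)) \<and>
    (\<forall>\<mu> \<in> axis_proj Ax0 ` L. tree M1 (fibre L Ax1 \<mu>))"


section \<open>Programs and their operation counts\<close>

text \<open>A program sees its data only through counted operations.  Real numbers stay in write-once
  registers: a program can compute with them but neither inspect them nor branch on them.
  Combinatorial data (indices and levels) is handed to the program by lookups; deciding what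
  to do next on the basis of the answers received so far is not an operation.\<close>

text \<open>\<open>Trial\<close> is the side of \<open>(\<Psi>, \<Phi>)\<close> and \<open>\<^bold>\<Lambda>\<close>, \<open>Test\<close> the side with a breve.\<close>

datatype side = Trial | Test

datatype family = Wavelets | Scalings

datatype region = Wavelet_Supp | Wavelet_Nbhd | Scaling_Supp

fun family_of :: "region \<Rightarrow> family" where
  "family_of Wavelet_Supp = Wavelets"
| "family_of Wavelet_Nbhd = Wavelets"
| "family_of Scaling_Supp = Scalings"

text \<open>Set-valued lookups, charged one operation plus one for each index listed.
  \<open>Overlapping i s r \<kappa> s' r'\<close> lists, on axis \<open>i\<close>, the indices on the same or an adjacent level
  whose region of type \<open>r'\<close> on side \<open>s'\<close> meets the region of type \<open>r\<close> of \<open>\<kappa>\<close> on side \<open>s\<close>.\<close>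

datatype 'i lookup =
    Projection side axis
  | Fibre side axis 'i
  | Parents axis side 'i
  | Overlapping axis side region 'i side region

text \<open>Real data that can be fetched into a register: an entry of the input vector, \<open>(A\<^sub>i \<phi>\<^sub>\<mu>)(\<phi>'\<^sub>\<kappa>)\<close>
  for scaling functions (\<open>Op_Entry i \<kappa> \<mu>\<close>), and entries of the mask matrices.\<close>

datatype 'i datum =
    Input 'i 'i
  | Op_Entry axis 'i 'i
  | Mask_P axis side nat 'i 'i
  | Mask_Q axis side nat 'i 'i

datatype arith = Zero | Add nat nat | Sub nat nat | Mul nat nat | Div nat nat

text \<open>\<open>Fetch\<close> and \<open>Arith\<close> append their value as a new register.  \<open>Return out\<close> ends the computation,
  with \<open>out \<kappa>\<close> the register that holds component \<open>\<kappa>\<close> of the result.\<close>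

datatype 'i prog =
    Return "'i \<times> 'i \<Rightarrow> nat"
  | Lookup "'i lookup" "'i set \<Rightarrow> 'i prog"
  | Level axis side family 'i "nat \<Rightarrow> 'i prog"
  | Fetch "'i datum" "'i prog"
  | Arith arith "'i prog"

fun operands :: "arith \<Rightarrow> nat set" where
  "operands Zero = {}"
| "operands (Add r s) = {r, s}"
| "operands (Sub r s) = {r, s}"
| "operands (Mul r s) = {r, s}"
| "operands (Div r s) = {r, s}"

fun arith_val :: "real list \<Rightarrow> arith \<Rightarrow> real" where
  "arith_val rs Zero = 0"
| "arith_val rs (Add r s) = rs ! r + rs ! s"
| "arith_val rs (Sub r s) = rs ! r - rs ! s"
| "arith_val rs (Mul r s) = rs ! r * rs ! s"
| "arith_val rs (Div r s) = rs ! r / rs ! s"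

record 'i environment =
  answer :: "'i lookup \<Rightarrow> 'i set"
  level_of :: "axis \<Rightarrow> side \<Rightarrow> family \<Rightarrow> 'i \<Rightarrow> nat"
  datum_val :: "'i datum \<Rightarrow> real"
  out_idx :: "('i \<times> 'i) set"

text \<open>\<open>exec E rs p y n\<close>: in environment \<open>E\<close>, started with registers \<open>rs\<close>, the program \<open>p\<close> ends with
  the output vector \<open>y\<close> after \<open>n\<close> operations.  A lookup with infinite answer has no execution.\<close>

inductive exec :: "'i environment \<Rightarrow> real list \<Rightarrow> 'i prog \<Rightarrow> ('i \<times> 'i \<Rightarrow> real) \<Rightarrow> nat \<Rightarrow> bool"
  for E :: "'i environment" where
  exec_Return: "\<forall>\<kappa>\<in>out_idx E. out \<kappa> < length rs \<Longrightarrow>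
    exec E rs (Return out) (\<lambda>\<kappa>. if \<kappa> \<in> out_idx E then rs ! out \<kappa> else 0) 0"
| exec_Lookup: "finite (answer E q) \<Longrightarrow> exec E rs (k (answer E q)) y n \<Longrightarrow>
    exec E rs (Lookup q k) y (n + 1 + card (answer E q))"
| exec_Level: "exec E rs (k (level_of E i s f \<kappa>)) y n \<Longrightarrow>
    exec E rs (Level i s f \<kappa> k) y (n + 1)"
| exec_Fetch: "exec E (rs @ [datum_val E d]) p y n \<Longrightarrow>
    exec E rs (Fetch d p) y (n + 1)"
| exec_Arith: "\<forall>r\<in>operands a. r < length rs \<Longrightarrow> exec E (rs @ [arith_val rs a]) p y n \<Longrightarrow>
    exec E rs (Arith a p) y (n + 1)"


section \<open>The environment given by a problem instance\<close>

fun family_idx :: "('a, 'i) multilevel \<Rightarrow> family \<Rightarrow> 'i set" where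
  "family_idx M Wavelets = wvl_idx M"
| "family_idx M Scalings = scl_all M"

fun family_level :: "('a, 'i) multilevel \<Rightarrow> family \<Rightarrow> 'i \<Rightarrow> nat" where
  "family_level M Wavelets \<kappa> = lvl M \<kappa>"
| "family_level M Scalings \<kappa> = (THE l. \<kappa> \<in> scl_idx M l)"

text \<open>The axioms do not exclude infinitely many vanishing wavelets of level \<open>0\<close>, whose neighbourhoods
  are unrelated to any support.  These neighbourhoods are not listed.\<close>

fun region_set :: "'a::topological_space set \<Rightarrow> ('a, 'i) multilevel \<Rightarrow> region \<Rightarrow> 'i \<Rightarrow> 'a set" where
  "region_set Q M Wavelet_Supp \<kappa> = supp Q (wvl M \<kappa>)"
| "region_set Q M Wavelet_Nbhd \<kappa> = (if supp Q (wvl M \<kappa>) = {} then {} else nbhd M \<kappa>)"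
| "region_set Q M Scaling_Supp \<kappa> = supp Q (scl M \<kappa>)"

definition overlapping ::
  "'a::topological_space set \<Rightarrow> ('a, 'i) multilevel \<Rightarrow> region \<Rightarrow> 'i \<Rightarrow>
   ('a, 'i) multilevel \<Rightarrow> region \<Rightarrow> 'i set"
  where "overlapping Q M r \<kappa> M' r' =
    {\<mu> \<in> family_idx M' (family_of r'). \<kappa> \<in> family_idx M (family_of r) \<and>
       \<bar>int (family_level M' (family_of r') \<mu>) - int (family_level M (family_of r) \<kappa>)\<bar> \<le> 1 \<and>
       region_set Q M r \<kappa> \<inter> region_set Q M' r' \<mu> \<noteq> {}}"

fun pick :: "'x \<Rightarrow> 'x \<Rightarrow> side \<Rightarrow> 'x" where
  "pick x x' Trial = x"
| "pick x x' Test = x'"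

fun problem_answer ::
  "'a::euclidean_space set \<Rightarrow> (side \<Rightarrow> ('a, 'i) multilevel) \<Rightarrow>
   'b::euclidean_space set \<Rightarrow> (side \<Rightarrow> ('b, 'i) multilevel) \<Rightarrow>
   (side \<Rightarrow> ('i \<times> 'i) set) \<Rightarrow> 'i lookup \<Rightarrow> 'i set" where
  "problem_answer Q0 N0 Q1 N1 L (Projection s i) = axis_proj i ` L s"
| "problem_answer Q0 N0 Q1 N1 L (Fibre s i \<mu>) = fibre (L s) i \<mu>"
| "problem_answer Q0 N0 Q1 N1 L (Parents Ax0 s \<kappa>) =
     (if \<kappa> \<in> wvl_idx (N0 s) then parents (N0 s) \<kappa> else {})"
| "problem_answer Q0 N0 Q1 N1 L (Parents Ax1 s \<kappa>) =
     (if \<kappa> \<in> wvl_idx (N1 s) then parents (N1 s) \<kappa> else {})"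
| "problem_answer Q0 N0 Q1 N1 L (Overlapping Ax0 s r \<kappa> s' r') = overlapping Q0 (N0 s) r \<kappa> (N0 s') r'"
| "problem_answer Q0 N0 Q1 N1 L (Overlapping Ax1 s r \<kappa> s' r') = overlapping Q1 (N1 s) r \<kappa> (N1 s') r'"

fun problem_level ::
  "(side \<Rightarrow> ('a, 'i) multilevel) \<Rightarrow> (side \<Rightarrow> ('b, 'i) multilevel) \<Rightarrow>
   axis \<Rightarrow> side \<Rightarrow> family \<Rightarrow> 'i \<Rightarrow> nat" where
  "problem_level N0 N1 Ax0 s f \<kappa> = family_level (N0 s) f \<kappa>"
| "problem_level N0 N1 Ax1 s f \<kappa> = family_level (N1 s) f \<kappa>"

definition scl_entry ::
  "(side \<Rightarrow> ('a, 'i) multilevel) \<Rightarrow> (('a \<Rightarrow> real) \<Rightarrow> ('a \<Rightarrow> real) \<Rightarrow> real) \<Rightarrow> 'i \<Rightarrow> 'i \<Rightarrow> real"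
  where "scl_entry N A \<kappa> \<mu> =
    (if \<mu> \<in> scl_all (N Trial) \<and> \<kappa> \<in> scl_all (N Test)
     then A (scl (N Trial) \<mu>) (scl (N Test) \<kappa>) else 0)"

fun problem_datum ::
  "(side \<Rightarrow> ('a, 'i) multilevel) \<Rightarrow> (('a \<Rightarrow> real) \<Rightarrow> ('a \<Rightarrow> real) \<Rightarrow> real) \<Rightarrow>
   (side \<Rightarrow> ('b, 'i) multilevel) \<Rightarrow> (('b \<Rightarrow> real) \<Rightarrow> ('b \<Rightarrow> real) \<Rightarrow> real) \<Rightarrow>
   ('i \<times> 'i) set \<Rightarrow> ('i \<times> 'i \<Rightarrow> real) \<Rightarrow> 'i datum \<Rightarrow> real" where
  "problem_datum N0 A0 N1 A1 L c (Input \<mu> \<nu>) = (if (\<mu>, \<nu>) \<in> L then c (\<mu>, \<nu>) else 0)"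
| "problem_datum N0 A0 N1 A1 L c (Op_Entry Ax0 \<kappa> \<mu>) = scl_entry N0 A0 \<kappa> \<mu>"
| "problem_datum N0 A0 N1 A1 L c (Op_Entry Ax1 \<kappa> \<mu>) = scl_entry N1 A1 \<kappa> \<mu>"
| "problem_datum N0 A0 N1 A1 L c (Mask_P Ax0 s l \<nu> \<kappa>) = mask_p (N0 s) l \<nu> \<kappa>"
| "problem_datum N0 A0 N1 A1 L c (Mask_P Ax1 s l \<nu> \<kappa>) = mask_p (N1 s) l \<nu> \<kappa>"
| "problem_datum N0 A0 N1 A1 L c (Mask_Q Ax0 s l \<nu> \<kappa>) = mask_q (N0 s) l \<nu> \<kappa>"
| "problem_datum N0 A0 N1 A1 L c (Mask_Q Ax1 s l \<nu> \<kappa>) = mask_q (N1 s) l \<nu> \<kappa>"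

definition problem_env ::
  "'a::euclidean_space set \<Rightarrow> ('a, 'i) multilevel \<Rightarrow> ('a, 'i) multilevel \<Rightarrow>
   (('a \<Rightarrow> real) \<Rightarrow> ('a \<Rightarrow> real) \<Rightarrow> real) \<Rightarrow>
   'b::euclidean_space set \<Rightarrow> ('b, 'i) multilevel \<Rightarrow> ('b, 'i) multilevel \<Rightarrow>
   (('b \<Rightarrow> real) \<Rightarrow> ('b \<Rightarrow> real) \<Rightarrow> real) \<Rightarrow>
   ('i \<times> 'i) set \<Rightarrow> ('i \<times> 'i) set \<Rightarrow> ('i \<times> 'i \<Rightarrow> real) \<Rightarrow> 'i environment"
  where "problem_env Q0 M0 M0' A0 Q1 M1 M1' A1 L L' c =
    \<lparr> answer = problem_answer Q0 (pick M0 M0') Q1 (pick M1 M1') (pick L L'),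
      level_of = problem_level (pick M0 M0') (pick M1 M1'),
      datum_val = problem_datum (pick M0 M0') A0 (pick M1 M1') A1 L c,
      out_idx = L' \<rparr>"

text \<open>The section of the tensor product matrix with rows \<open>L'\<close> and columns \<open>L\<close>, applied to \<open>c\<close>;
  outside \<open>L'\<close> the result is \<open>0\<close>.\<close>

definition tensor_apply ::
  "('a, 'i) multilevel \<Rightarrow> ('a, 'i) multilevel \<Rightarrow> (('a \<Rightarrow> real) \<Rightarrow> ('a \<Rightarrow> real) \<Rightarrow> real) \<Rightarrow>
   ('b, 'i) multilevel \<Rightarrow> ('b, 'i) multilevel \<Rightarrow> (('b \<Rightarrow> real) \<Rightarrow> ('b \<Rightarrow> real) \<Rightarrow> real) \<Rightarrow>
   ('i \<times> 'i) set \<Rightarrow> ('i \<times> 'i) set \<Rightarrow> ('i \<times> 'i \<Rightarrow> real) \<Rightarrow> 'i \<times> 'i \<Rightarrow> real"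
  where "tensor_apply M0 M0' A0 M1 M1' A1 L L' c = (\<lambda>(\<kappa>0, \<kappa>1).
    if (\<kappa>0, \<kappa>1) \<in> L'
    then \<Sum>(\<mu>0, \<mu>1)\<in>L. op_matrix M0 M0' A0 \<kappa>0 \<mu>0 * op_matrix M1 M1' A1 \<kappa>1 \<mu>1 * c (\<mu>0, \<mu>1)
    else 0)"

end

theory Submission
  imports Defs
begin

text \<open>
  Split each operator into its entries with \<open>|\<mu>| \<le> |\<kappa>|\<close> and those with \<open>|\<mu>| > |\<kappa>|\<close>.  The lower part is
  applied through the scaling coefficients of \<open>\<Sum>\<^bsub>|\<mu>| \<le> l\<^esub> x\<^sub>\<mu> \<psi>\<^sub>\<mu>\<close>, computed from coarse to fine; by
  locality only those near the test set are needed, and if this set is a tree, they are determined by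
  each other.  The upper part is applied through the values of \<open>A (\<Sum>\<^bsub>|\<mu>| \<ge> l\<^esub> x\<^sub>\<mu> \<psi>\<^sub>\<mu>)\<close> at scaling
  functions, computed from fine to coarse; here it is the trial set that has to be a tree.
  Local linear independence makes the mask matrices local: a non-zero coefficient of \<open>\<phi>\<^sub>\<nu>\<close> in the
  expansion of \<open>f\<close> forces \<open>supp \<phi>\<^sub>\<nu> \<subseteq> supp f\<close>.

  With \<open>A\<^sub>0 = L\<^sub>0 + U\<^sub>0\<close> this gives
  \<open>A\<^sub>0 \<otimes> A\<^sub>1 = (L\<^sub>0 \<otimes> Id)(Id \<otimes> A\<^sub>1) + (Id \<otimes> A\<^sub>1)(U\<^sub>0 \<otimes> Id)\<close>, where the intermediate vectors are only
  needed on index sets of size proportional to \<open>#L + #L'\<close>, whose fibres in the second direction are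
  unions of trees.  All one-dimensional applications then have linear cost in their fibres.
\<close>

section \<open>Straight-line programs for linear circuits\<close>

text \<open>Neither factor can simply be applied first: an intermediate index set that pairs each
  index with everything it interacts with, on all coarser and finer levels, need not be of size O(#L
  + #L'). Each half of the split needs intermediate data on one level per index only. To apply L0 on
  a test fibre, entries of level l are read only near test wavelets of level l, since all coarser
  information arrives through scaling coefficients: at most K entries per element of L'. The output
  of U0 vanishes except at \<kappa> near a trial wavelet exactly one level finer, because the tree
  contains an ancestor on that level: again at most K entries per element of L. Hence L0 comes last
  and U0 first. K bounds the number of functions on the same or adjacent levels that meet a set
  S(\<kappa>); the systems enter the operation count through K alone. As real values cannot be
  inspected, all lookups precede the arithmetic, which is one straight-line linear circuit. Its
  correctness reduces to checking that a prescribed family of values solves the equations of the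
  circuit.\<close>

definition enum :: "'x set \<Rightarrow> 'x list"
  where "enum X = (SOME xs. set xs = X \<and> distinct xs)"

lemma enum: "finite X \<Longrightarrow> set (enum X) = X" "finite X \<Longrightarrow> distinct (enum X)"
proof -
  assume "finite X"
  then have "\<exists>xs. set xs = X \<and> distinct xs" using finite_distinct_list by blast
  then have "set (enum X) = X \<and> distinct (enum X)" unfolding enum_def by (rule someI_ex)
  then show "set (enum X) = X" "distinct (enum X)" by auto
qed

lemma sum_list_enum: "finite X \<Longrightarrow> sum_list (map f (enum X)) = sum f X"
  using enum[of X] by (metis sum_list_distinct_conv_sum_set)

text \<open>The programs below keep track of the number \<open>n\<close> of registers in use, and pass it on to
  their continuations.\<close>

fun mul_chain :: "'i datum list \<Rightarrow> nat \<Rightarrow> nat \<Rightarrow> (nat \<Rightarrow> nat \<Rightarrow> 'i prog) \<Rightarrow> 'i prog" where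
  "mul_chain [] n r k = k n r"
| "mul_chain (d # ds) n r k = Fetch d (Arith (Mul r n) (mul_chain ds (n + 2) (n + 1) k))"

fun add_terms ::
  "('n \<Rightarrow> nat) \<Rightarrow> ('i datum list \<times> 'n) list \<Rightarrow> nat \<Rightarrow> nat \<Rightarrow> (nat \<Rightarrow> nat \<Rightarrow> 'i prog) \<Rightarrow> 'i prog" where
  "add_terms reg [] n r k = k n r"
| "add_terms reg ((ds, v) # ts) n r k =
     mul_chain ds n (reg v) (\<lambda>n r'. Arith (Add r r') (add_terms reg ts (n + 1) n k))"

fun eval_nodes ::
  "('n \<Rightarrow> ('i datum list \<times> 'n) set) \<Rightarrow> 'n list \<Rightarrow> nat \<Rightarrow> ('n \<Rightarrow> nat) \<Rightarrow> (('n \<Rightarrow> nat) \<Rightarrow> 'i prog) \<Rightarrow> 'i prog"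
where
  "eval_nodes T [] n reg k = k reg"
| "eval_nodes T (v # vs) n reg k = Arith Zero
     (add_terms reg (enum (T v)) (n + 1) n (\<lambda>n r. eval_nodes T vs n (reg(v := r)) k))"

fun load_nodes ::
  "('n \<Rightarrow> 'i datum) \<Rightarrow> 'n list \<Rightarrow> nat \<Rightarrow> ('n \<Rightarrow> nat) \<Rightarrow> (nat \<Rightarrow> ('n \<Rightarrow> nat) \<Rightarrow> 'i prog) \<Rightarrow> 'i prog" where
  "load_nodes ld [] n reg k = k n reg"
| "load_nodes ld (v # vs) n reg k = Fetch (ld v) (load_nodes ld vs (n + 1) (reg(v := n)) k)"

definition data_prod :: "'i environment \<Rightarrow> 'i datum list \<Rightarrow> real"
  where "data_prod E ds = prod_list (map (datum_val E) ds)"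

lemma data_prod_simps [simp]:
  "data_prod E [] = 1" "data_prod E (d # ds) = datum_val E d * data_prod E ds"
  by (simp_all add: data_prod_def)

text \<open>Registers are write-once, so values computed earlier survive in every extension
  \<open>rs @ rs'\<close>; the continuation is therefore assumed to succeed from all such
  extensions. Each factor costs one \<open>Fetch\<close> and one \<open>Mul\<close>.\<close>

lemma exec_mul_chain:
  assumes "r < length rs"
    and "\<And>rs' r'. r' < length (rs @ rs') \<Longrightarrow> (rs @ rs') ! r' = rs ! r * data_prod E ds \<Longrightarrow>
          exec E (rs @ rs') (k (length (rs @ rs')) r') y m"
  shows "exec E rs (mul_chain ds (length rs) r k) y (m + 2 * length ds)"
  using assms
proof (induction ds arbitrary: rs r)
  case Nil
  then show ?case using Nil(2)[of r "[]"] by simp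
next
  case (Cons d ds)
  let ?rs = "rs @ [datum_val E d, rs ! r * datum_val E d]"
  have "exec E ?rs (mul_chain ds (length ?rs) (length rs + 1) k) y (m + 2 * length ds)"
  proof (rule Cons.IH)
    show "length rs + 1 < length ?rs" by simp
    fix rs' r' assume *: "r' < length (?rs @ rs')"
      "(?rs @ rs') ! r' = ?rs ! (length rs + 1) * data_prod E ds"
    have "?rs ! (length rs + 1) = rs ! r * datum_val E d" by (simp add: nth_append)
    then show "exec E (?rs @ rs') (k (length (?rs @ rs')) r') y m"
      using Cons.prems(2)[of r' "[datum_val E d, rs ! r * datum_val E d] @ rs'"] *
      by (simp add: mult.assoc)
  qed
  then have "exec E (rs @ [datum_val E d]) (Arith (Mul r (length rs))
     (mul_chain ds (length rs + 2) (length rs + 1) k)) y (m + 2 * length ds + 1)"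
    using Cons.prems(1) by (intro exec_Arith) (auto simp: nth_append)
  from exec_Fetch[OF this] show ?case by simp
qed

definition terms_cost :: "('i datum list \<times> 'n) list \<Rightarrow> nat"
  where "terms_cost ts = (\<Sum>(ds, v)\<leftarrow>ts. 2 * length ds + 1)"

lemma exec_add_terms:
  assumes "r < length rs"
    and "\<And>ds v. (ds, v) \<in> set ts \<Longrightarrow> reg v < length rs \<and> rs ! reg v = val v"
    and "\<And>rs' r'. r' < length (rs @ rs') \<Longrightarrow>
          (rs @ rs') ! r' = rs ! r + (\<Sum>(ds, v)\<leftarrow>ts. data_prod E ds * val v) \<Longrightarrow>
          exec E (rs @ rs') (k (length (rs @ rs')) r') y m"
  shows "exec E rs (add_terms reg ts (length rs) r k) y (m + terms_cost ts)"
  using assms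
proof (induction ts arbitrary: rs r)
  case Nil
  then show ?case using Nil(3)[of r "[]"] by (simp add: terms_cost_def)
next
  case (Cons t ts)
  obtain ds v where t: "t = (ds, v)" by (cases t)
  have v: "reg v < length rs" "rs ! reg v = val v" using Cons.prems(2)[of ds v] t by auto
  have "exec E rs (mul_chain ds (length rs) (reg v)
      (\<lambda>n r'. Arith (Add r r') (add_terms reg ts (n + 1) n k))) y (m + terms_cost ts + 1 + 2 * length ds)"
  proof (rule exec_mul_chain[OF v(1)])
    fix rs' r' assume *: "r' < length (rs @ rs')" "(rs @ rs') ! r' = rs ! reg v * data_prod E ds"
    let ?x = "rs ! r + rs ! reg v * data_prod E ds"
    let ?rs = "rs @ (rs' @ [?x])"
    have "exec E ?rs (add_terms reg ts (length ?rs) (length (rs @ rs')) k) y (m + terms_cost ts)"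
    proof (rule Cons.IH)
      show "length (rs @ rs') < length ?rs" by simp
      show "reg v < length ?rs \<and> ?rs ! reg v = val v" if "(ds, v) \<in> set ts" for ds v
        using Cons.prems(2)[of ds v] that by (auto simp: nth_append)
      fix rs2 r2 assume **: "r2 < length (?rs @ rs2)"
        "(?rs @ rs2) ! r2 = ?rs ! length (rs @ rs') + (\<Sum>(ds, v)\<leftarrow>ts. data_prod E ds * val v)"
      have "?rs ! length (rs @ rs') = ?x" by (simp add: nth_append)
      then show "exec E (?rs @ rs2) (k (length (?rs @ rs2)) r2) y m"
        using Cons.prems(3)[of r2 "(rs' @ [?x]) @ rs2"] ** v(2) t
        by (simp add: algebra_simps)
    qed
    then show "exec E (rs @ rs') (Arith (Add r r')
        (add_terms reg ts (length (rs @ rs') + 1) (length (rs @ rs')) k)) y (m + terms_cost ts + 1)"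
      using Cons.prems(1) * by (intro exec_Arith) (auto simp: nth_append)
  qed
  then show ?case by (simp add: t terms_cost_def algebra_simps)
qed

fun topo :: "('n \<Rightarrow> ('i datum list \<times> 'n) set) \<Rightarrow> 'n set \<Rightarrow> 'n list \<Rightarrow> bool" where
  "topo T D [] \<longleftrightarrow> True"
| "topo T D (v # vs) \<longleftrightarrow> (\<forall>(ds, w)\<in>T v. w \<in> D) \<and> topo T (insert v D) vs"

lemma topo_append: "topo T D (xs @ ys) \<longleftrightarrow> topo T D xs \<and> topo T (D \<union> set xs) ys"
  by (induction xs arbitrary: D) auto

text \<open>Induction by increasing rank: a node of maximal rank can be put at the end, as its terms
  refer to \<open>D\<close> or to strictly smaller ranks.\<close>

lemma ex_topo:
  fixes rank :: "'n \<Rightarrow> nat"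
  assumes "finite V"
    and "\<And>v ds w. v \<in> V \<Longrightarrow> (ds, w) \<in> T v \<Longrightarrow> w \<in> D \<or> w \<in> V \<and> rank w < rank v"
  shows "\<exists>vs. set vs = V \<and> distinct vs \<and> topo T D vs"
  using assms
proof (induction V rule: finite_ranking_induct[where f = rank])
  case (insert x S)
  have "\<exists>vs. set vs = S - {x} \<and> distinct vs \<and> topo T D vs" if "x \<notin> S"
  proof -
    have "\<exists>vs. set vs = S \<and> distinct vs \<and> topo T D vs"
    proof (rule insert(3))
      \<comment> \<open>From rank w < rank v \<le> rank x it follows that the term does not refer to
        x, so the hypothesis restricts to S.\<close>
      show "w \<in> D \<or> w \<in> S \<and> rank w < rank v" if "v \<in> S" "(ds, w) \<in> T v" for v ds w
        using insert(4)[of v ds w] insert(2)[of v] that by auto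
    qed
    then show ?thesis using that by auto
  qed
  then show ?case
  proof (cases "x \<in> S")
    case True
    then show ?thesis using insert by (auto simp: insert_absorb)
  next
    case False
    then obtain vs where vs: "set vs = S" "distinct vs" "topo T D vs"
      using \<open>x \<notin> S \<Longrightarrow> _\<close> by auto
    have "topo T D (vs @ [x])" using vs insert(4)[of x] by (auto simp: topo_append)
    then show ?thesis using vs False by (intro exI[of _ "vs @ [x]"]) auto
  qed
qed auto

definition topo_list :: "('n \<Rightarrow> ('i datum list \<times> 'n) set) \<Rightarrow> 'n set \<Rightarrow> 'n set \<Rightarrow> 'n list"
  where "topo_list T D V = (SOME vs. set vs = V \<and> distinct vs \<and> topo T D vs)"

text \<open>The values \<open>val\<close> are prescribed, not read off the circuit. Solving the
  equations is enough, because along a topological order the registers are determined one after the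
  other. The extra operation per node is its initial \<open>Zero\<close>.\<close>

lemma exec_eval_nodes:
  assumes "topo T D vs" "\<And>v. v \<in> D \<Longrightarrow> reg v < length rs \<and> rs ! reg v = val v"
    and "\<And>v. v \<in> set vs \<Longrightarrow> finite (T v)"
    and "\<And>v. v \<in> set vs \<Longrightarrow> val v = (\<Sum>(ds, w)\<in>T v. data_prod E ds * val w)"
    and "\<And>rs' reg'. (\<And>v. v \<in> D \<union> set vs \<Longrightarrow> reg' v < length rs' \<and> rs' ! reg' v = val v) \<Longrightarrow>
          exec E rs' (k reg') y m"
  shows "exec E rs (eval_nodes T vs (length rs) reg k) y
          (m + (\<Sum>v\<leftarrow>vs. 1 + terms_cost (enum (T v))))"
  using assms
proof (induction vs arbitrary: D rs reg)
  case Nil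
  then show ?case by simp
next
  case (Cons v vs)
  have fin: "finite (T v)" using Cons.prems(3) by simp
  let ?m = "m + (\<Sum>v\<leftarrow>vs. 1 + terms_cost (enum (T v)))"
  have "exec E (rs @ [0]) (add_terms reg (enum (T v)) (length (rs @ [0])) (length rs)
      (\<lambda>n r. eval_nodes T vs n (reg(v := r)) k)) y (?m + terms_cost (enum (T v)))"
  proof (rule exec_add_terms[where val = val])
    show "reg w < length (rs @ [0]) \<and> (rs @ [0]) ! reg w = val w"
      if "(ds, w) \<in> set (enum (T v))" for ds w
    proof -
      have "w \<in> D" using Cons.prems(1) that enum(1)[OF fin] by auto
      then show ?thesis using Cons.prems(2)[of w] by (auto simp: nth_append)
    qed
    fix rs' r' assume *: "r' < length ((rs @ [0]) @ rs')" "((rs @ [0]) @ rs') ! r' =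
       (rs @ [0]) ! length rs + (\<Sum>(ds, v)\<leftarrow>enum (T v). data_prod E ds * val v)"
    then have val: "((rs @ [0]) @ rs') ! r' = val v"
      using Cons.prems(4)[of v] by (simp add: sum_list_enum[OF fin] nth_append)
    show "exec E ((rs @ [0]) @ rs')
       (eval_nodes T vs (length ((rs @ [0]) @ rs')) (reg(v := r')) k) y ?m"
    proof (rule Cons.IH)
      show "topo T (insert v D) vs" using Cons.prems(1) by simp
      show "(reg(v := r')) w < length ((rs @ [0]) @ rs') \<and>
          ((rs @ [0]) @ rs') ! (reg(v := r')) w = val w" if "w \<in> insert v D" for w
      proof (cases "w = v")
        case False
        then show ?thesis using Cons.prems(2)[of w] that by (auto simp: nth_append)
      qed (use * val in simp)
      show "finite (T w)" if "w \<in> set vs" for w using Cons.prems(3) that by simp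
      show "val w = (\<Sum>(ds, w)\<in>T w. data_prod E ds * val w)" if "w \<in> set vs" for w
        using Cons.prems(4) that by simp
      show "exec E rs' (k reg') y m"
        if "\<And>w. w \<in> insert v D \<union> set vs \<Longrightarrow> reg' w < length rs' \<and> rs' ! reg' w = val w" for rs' reg'
        using that by (intro Cons.prems(5)) auto
    qed
  qed simp
  then have "exec E rs (Arith Zero (add_terms reg (enum (T v)) (length (rs @ [0])) (length rs)
      (\<lambda>n r. eval_nodes T vs n (reg(v := r)) k))) y (?m + terms_cost (enum (T v)) + 1)"
    by (intro exec_Arith) auto
  then show ?case by (simp add: algebra_simps)
qed

lemma exec_load_nodes:
  assumes "\<And>v. v \<in> D \<Longrightarrow> reg v < length rs \<and> rs ! reg v = val v"
    and "\<And>v. v \<in> set vs \<Longrightarrow> val v = datum_val E (ld v)"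
    and "\<And>rs' reg'. (\<And>v. v \<in> D \<union> set vs \<Longrightarrow> reg' v < length rs' \<and> rs' ! reg' v = val v) \<Longrightarrow>
          exec E rs' (k (length rs') reg') y m"
  shows "exec E rs (load_nodes ld vs (length rs) reg k) y (m + length vs)"
  using assms
proof (induction vs arbitrary: D rs reg)
  case Nil
  then show ?case by simp
next
  case (Cons v vs)
  have "exec E (rs @ [datum_val E (ld v)])
     (load_nodes ld vs (length (rs @ [datum_val E (ld v)])) (reg(v := length rs)) k) y (m + length vs)"
  proof (rule Cons.IH[where D = "insert v D"])
    fix w assume "w \<in> insert v D"
    then show "(reg(v := length rs)) w < length (rs @ [datum_val E (ld v)]) \<and>
       (rs @ [datum_val E (ld v)]) ! (reg(v := length rs)) w = val w"
      using Cons.prems(1)[of w] Cons.prems(2)[of v] by (auto simp: nth_append)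
  next
    fix rs' reg' assume "\<And>w. w \<in> insert v D \<union> set vs \<Longrightarrow> reg' w < length rs' \<and> rs' ! reg' w = val w"
    then show "exec E rs' (k (length rs') reg') y m" by (intro Cons.prems(3)) auto
  qed (use Cons.prems(2) in auto)
  from exec_Fetch[OF this] show ?case by simp
qed

text \<open>The registers of the nodes in \<open>I\<close> are loaded from the data \<open>ld\<close>; a node in \<open>V\<close> is a linear
  combination of other nodes, whose terms are listed by \<open>T\<close>, and whose coefficients are
  products of data.\<close>

definition circuit ::
  "('n \<Rightarrow> 'i datum) \<Rightarrow> 'n set \<Rightarrow> ('n \<Rightarrow> ('i datum list \<times> 'n) set) \<Rightarrow> 'n set \<Rightarrow> ('i \<times> 'i \<Rightarrow> 'n) \<Rightarrow> 'i prog"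
  where "circuit ld I T V out =
    load_nodes ld (enum I) 0 (\<lambda>_. 0) (\<lambda>n reg. eval_nodes T (topo_list T I V) n reg
      (\<lambda>reg. Return (\<lambda>\<kappa>. reg (out \<kappa>))))"

text \<open>The count is one \<open>Fetch\<close> per input, one \<open>Zero\<close> per node, and
  per term at most three factors of two operations each and one \<open>Add\<close>, so 7 = 2 * 3 +
  1. The function \<open>rank\<close> certifies that there are no cycles.\<close>

lemma exec_circuit:
  fixes rank :: "'n \<Rightarrow> nat"
  assumes "finite I" "finite V" "\<And>v. v \<in> V \<Longrightarrow> finite (T v)"
    and rank: "\<And>v ds w. v \<in> V \<Longrightarrow> (ds, w) \<in> T v \<Longrightarrow> w \<in> I \<or> w \<in> V \<and> rank w < rank v"
    and "\<And>v. v \<in> I \<Longrightarrow> val v = datum_val E (ld v)"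
    and "\<And>v. v \<in> V \<Longrightarrow> val v = (\<Sum>(ds, w)\<in>T v. data_prod E ds * val w)"
    and len: "\<And>v ds w. v \<in> V \<Longrightarrow> (ds, w) \<in> T v \<Longrightarrow> length ds \<le> 3"
    and out: "\<And>\<kappa>. \<kappa> \<in> out_idx E \<Longrightarrow> out \<kappa> \<in> I \<union> V"
  shows "\<exists>n \<le> card I + card V + 7 * (\<Sum>v\<in>V. card (T v)).
    exec E [] (circuit ld I T V out) (\<lambda>\<kappa>. if \<kappa> \<in> out_idx E then val (out \<kappa>) else 0) n"
proof -
  let ?vs = "topo_list T I V"
  let ?y = "\<lambda>\<kappa>. if \<kappa> \<in> out_idx E then val (out \<kappa>) else 0"
  let ?n = "\<Sum>v\<leftarrow>?vs. 1 + terms_cost (enum (T v))"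
  have "\<exists>vs. set vs = V \<and> distinct vs \<and> topo T I vs" 
    by (rule ex_topo[OF \<open>finite V\<close>, of _ _ rank]) (rule rank)
  then have "set ?vs = V \<and> distinct ?vs \<and> topo T I ?vs" unfolding topo_list_def by (rule someI_ex)
  then have vs: "set ?vs = V" "distinct ?vs" "topo T I ?vs" by auto
  have "exec E [] (load_nodes ld (enum I) (length ([] :: real list)) (\<lambda>_. 0) (\<lambda>n reg. eval_nodes T ?vs n reg
      (\<lambda>reg. Return (\<lambda>\<kappa>. reg (out \<kappa>))))) ?y (0 + ?n + length (enum I))"
  proof (rule exec_load_nodes[where D = "{}" and val = val])
    fix rs' reg'
    assume *: "\<And>v. v \<in> {} \<union> set (enum I) \<Longrightarrow> reg' v < length rs' \<and> rs' ! reg' v = val v"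
    show "exec E rs' (eval_nodes T ?vs (length rs') reg' (\<lambda>reg. Return (\<lambda>\<kappa>. reg (out \<kappa>)))) ?y (0 + ?n)"
    proof (rule exec_eval_nodes[OF vs(3), where val = val])
      show "reg' v < length rs' \<and> rs' ! reg' v = val v" if "v \<in> I" for v
        using * that enum(1)[OF assms(1)] by simp
      fix rs2 reg2 assume **: "\<And>v. v \<in> I \<union> set ?vs \<Longrightarrow> reg2 v < length rs2 \<and> rs2 ! reg2 v = val v"
      have "?y = (\<lambda>\<kappa>. if \<kappa> \<in> out_idx E then rs2 ! (reg2 (out \<kappa>)) else 0)"
        using ** out vs(1) by auto
      then show "exec E rs2 (Return (\<lambda>\<kappa>. reg2 (out \<kappa>))) ?y 0"
        using exec_Return[of E "\<lambda>\<kappa>. reg2 (out \<kappa>)" rs2] ** out vs(1) by auto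
    qed (use assms vs in auto)
  qed (use assms(5) enum(1)[OF assms(1)] in auto)
  then have ex: "exec E [] (circuit ld I T V out) ?y (?n + length (enum I))"
    unfolding circuit_def by simp
  have tc: "terms_cost (enum (T v)) \<le> 7 * card (T v)" if "v \<in> V" for v
  proof -
    have fin: "finite (T v)" using assms that by auto
    have "terms_cost (enum (T v)) = (\<Sum>(ds, w)\<in>T v. 2 * length ds + 1)"
      unfolding terms_cost_def by (simp add: sum_list_enum[OF fin])
    also have "\<dots> \<le> (\<Sum>_\<in>T v. 7)" by (rule sum_mono) (use len[OF that] in force)
    finally show ?thesis by simp
  qed
  have "?n = (\<Sum>v\<in>V. 1 + terms_cost (enum (T v)))"
    using vs(1,2) by (metis sum_list_distinct_conv_sum_set)
  also have "\<dots> \<le> (\<Sum>v\<in>V. 1 + 7 * card (T v))" by (rule sum_mono) (use tc in simp)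
  also have "\<dots> = card V + 7 * (\<Sum>v\<in>V. card (T v))"
    by (simp only: sum.distrib sum_distrib_left card_eq_sum)
  finally have "?n \<le> card V + 7 * (\<Sum>v\<in>V. card (T v))" .
  moreover have "length (enum I) = card I" using enum[OF assms(1)] distinct_card by metis
  ultimately show ?thesis using ex by (intro exI[of _ "?n + length (enum I)"]) auto
qed

section \<open>Gathering combinatorial data\<close>

fun ask_list :: "'i lookup list \<Rightarrow> ('i lookup \<Rightarrow> 'i set) \<Rightarrow> (('i lookup \<Rightarrow> 'i set) \<Rightarrow> 'i prog) \<Rightarrow> 'i prog"
where
  "ask_list [] f k = k f"
| "ask_list (q # qs) f k = Lookup q (\<lambda>X. ask_list qs (f(q := X)) k)"

definition ask :: "'i lookup set \<Rightarrow> (('i lookup \<Rightarrow> 'i set) \<Rightarrow> 'i prog) \<Rightarrow> 'i prog"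
  where "ask qs k = ask_list (enum qs) (\<lambda>_. {}) k"

lemma exec_ask_list:
  assumes "\<And>q. q \<in> set qs \<Longrightarrow> finite (answer E q)"
    and "exec E rs (k (\<lambda>q. if q \<in> set qs then answer E q else f q)) y m"
  shows "exec E rs (ask_list qs f k) y (m + (\<Sum>q\<leftarrow>qs. 1 + card (answer E q)))"
  using assms
proof (induction qs arbitrary: f)
  case (Cons q qs)
  have "(\<lambda>p. if p \<in> set (q # qs) then answer E p else f p) =
      (\<lambda>p. if p \<in> set qs then answer E p else (f(q := answer E q)) p)" by (rule ext) auto
  then have "exec E rs (ask_list qs (f(q := answer E q)) k) y (m + (\<Sum>q\<leftarrow>qs. 1 + card (answer E q)))"
    using Cons.prems by (intro Cons.IH) auto
  then have "exec E rs (Lookup q (\<lambda>X. ask_list qs (f(q := X)) k)) y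
     (m + (\<Sum>q\<leftarrow>qs. 1 + card (answer E q)) + 1 + card (answer E q))"
    by (intro exec_Lookup) (use Cons.prems in auto)
  then show ?case by (simp add: algebra_simps)
qed simp

lemma exec_ask:
  assumes "finite qs" "\<And>q. q \<in> qs \<Longrightarrow> finite (answer E q)"
    and "exec E rs (k (\<lambda>q. if q \<in> qs then answer E q else {})) y m"
  shows "exec E rs (ask qs k) y (m + (\<Sum>q\<in>qs. 1 + card (answer E q)))"
  using exec_ask_list[of "enum qs" E rs k "\<lambda>_. {}" y m] assms enum[OF assms(1)]
  by (simp add: ask_def sum_list_enum)

fun ask_level_list ::
  "(axis \<times> side \<times> family \<times> 'i) list \<Rightarrow> (axis \<times> side \<times> family \<times> 'i \<Rightarrow> nat) \<Rightarrow>
   ((axis \<times> side \<times> family \<times> 'i \<Rightarrow> nat) \<Rightarrow> 'i prog) \<Rightarrow> 'i prog"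
where
  "ask_level_list [] f k = k f"
| "ask_level_list (q # qs) f k =
    (case q of (i, s, m, \<kappa>) \<Rightarrow> Level i s m \<kappa> (\<lambda>l. ask_level_list qs (f(q := l)) k))"

definition ask_level ::
  "(axis \<times> side \<times> family \<times> 'i) set \<Rightarrow> ((axis \<times> side \<times> family \<times> 'i \<Rightarrow> nat) \<Rightarrow> 'i prog) \<Rightarrow> 'i prog"
  where "ask_level qs k = ask_level_list (enum qs) (\<lambda>_. 0) k"

lemma exec_ask_level_list:
  assumes "exec E rs (k (\<lambda>q. if q \<in> set qs then (case q of (i, s, m, \<kappa>) \<Rightarrow> level_of E i s m \<kappa>)
     else f q)) y n"
  shows "exec E rs (ask_level_list qs f k) y (n + length qs)"
  using assms
proof (induction qs arbitrary: f)
  case (Cons q qs)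
  obtain i s m \<kappa> where q: "q = (i, s, m, \<kappa>)" by (cases q) auto
  let ?lv = "\<lambda>q. case q of (i, s, m, \<kappa>) \<Rightarrow> level_of E i s m \<kappa>"
  have "(\<lambda>p. if p \<in> set (q # qs) then ?lv p else f p) =
      (\<lambda>p. if p \<in> set qs then ?lv p else (f(q := level_of E i s m \<kappa>)) p)"
    by (rule ext) (auto simp: q)
  then have "exec E rs (ask_level_list qs (f(q := level_of E i s m \<kappa>)) k) y (n + length qs)"
    using Cons.prems by (intro Cons.IH) (simp only:)
  then have "exec E rs (Level i s m \<kappa> (\<lambda>l. ask_level_list qs (f(q := l)) k)) y (n + length qs + 1)"
    by (intro exec_Level)
  then show ?case by (simp add: q)
qed simp

lemma exec_ask_level:
  assumes "finite qs"
    and "exec E rs (k (\<lambda>(i, s, m, \<kappa>). if (i, s, m, \<kappa>) \<in> qs then level_of E i s m \<kappa> else 0)) y n"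
  shows "exec E rs (ask_level qs k) y (n + card qs)"
proof -
  have "(\<lambda>(i, s, m, \<kappa>). if (i, s, m, \<kappa>) \<in> qs then level_of E i s m \<kappa> else 0) =
    (\<lambda>q. if q \<in> set (enum qs) then (case q of (i, s, m, \<kappa>) \<Rightarrow> level_of E i s m \<kappa>) else 0)"
    using enum(1)[OF assms(1)] by auto
  then have "exec E rs (ask_level qs k) y (n + length (enum qs))"
    unfolding ask_level_def using assms(2) by (intro exec_ask_level_list) simp
  moreover have "length (enum qs) = card qs" using enum[OF assms(1)] distinct_card by metis
  ultimately show ?thesis by simp
qed

section \<open>Scaling function coefficients\<close>

lemma sum_fun_apply: "(\<Sum>i\<in>S. f i) x = (\<Sum>i\<in>S. f i x :: 'b::comm_monoid_add)"
  by (induction S rule: infinite_finite_induct) auto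

text \<open>Supports are closed relative to Q, so it suffices to test the points where f does not
  vanish.\<close>

lemma supp_mono:
  assumes "\<And>x. x \<in> Q \<Longrightarrow> f x \<noteq> 0 \<Longrightarrow> x \<in> supp Q g"
  shows "supp Q f \<subseteq> supp Q g"
proof -
  have "support_on Q f \<subseteq> closure (support_on Q g)"
    using assms by (auto simp: support_on_def supp_def)
  then have "closure (support_on Q f) \<subseteq> closure (support_on Q g)"
    by (meson closed_closure closure_minimal)
  then show ?thesis by (auto simp: supp_def)
qed

lemma in_supp: "x \<in> Q \<Longrightarrow> f x \<noteq> 0 \<Longrightarrow> x \<in> supp Q f"
  using closure_subset by (fastforce simp: supp_def support_on_def)

lemma supp_zero [simp]: "supp Q 0 = {}"
  by (simp add: supp_def support_on_def)

context multilevel_system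
begin

lemma scl_outside: "\<nu> \<in> scl_idx M l \<Longrightarrow> x \<notin> Q \<Longrightarrow> scl M \<nu> x = 0"
  using scl_on by (auto simp: scl_all_def)

lemma scl_indep_span:
  "inj_on (scl M) {\<nu> \<in> scl_idx M l. scl M \<nu> \<noteq> 0}"
  "fspace.independent (scl M ` scl_idx M l - {0})"
proof -
  let ?J = "{\<nu> \<in> scl_idx M l. \<exists>x\<in>Q. scl M \<nu> x \<noteq> 0}"
  have J: "?J = {\<nu> \<in> scl_idx M l. scl M \<nu> \<noteq> 0}"
    using scl_outside by (auto simp: fun_eq_iff)
  have res: "fun_restrict Q (scl M \<nu>) = scl M \<nu>" if "\<nu> \<in> scl_idx M l" for \<nu>
    using scl_outside[OF that] by (auto simp: fun_restrict_def)
  have *: "inj_on (\<lambda>\<nu>. fun_restrict Q (scl M \<nu>)) ?J"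
    "fspace.independent ((\<lambda>\<nu>. fun_restrict Q (scl M \<nu>)) ` ?J)"
    using scl_indep[of Q ?J l] domain(1) by auto
  show "inj_on (scl M) {\<nu> \<in> scl_idx M l. scl M \<nu> \<noteq> 0}"
    using *(1) unfolding J inj_on_def by (auto simp: res)
  have "(\<lambda>\<nu>. fun_restrict Q (scl M \<nu>)) ` ?J = scl M ` scl_idx M l - {0}"
    unfolding J by (auto simp: res image_iff)
  then show "fspace.independent (scl M ` scl_idx M l - {0})" using *(2) by simp
qed

lemma span_minus_zero: "fspace.span (scl M ` scl_idx M l - {0}) = fspace.span (scl M ` scl_idx M l)"
  by (rule fspace.span_delete_0)

lemma scl_coeff_nonzero: "scl_coeff M l f \<nu> \<noteq> 0 \<Longrightarrow> scl M \<nu> \<noteq> 0"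
  unfolding scl_coeff_def using fspace.representation_ne_zero by blast

text \<open>Representations are indexed by functions, mask matrices by indices. The two sums agree
  because \<open>scl M\<close> is injective on the indices of non-vanishing functions and a
  vanishing function has coefficient 0.\<close>

lemma scl_coeff_expansion:
  assumes "f \<in> fspace.span (scl M ` scl_idx M l)"
  shows "finite {\<nu> \<in> scl_idx M l. scl_coeff M l f \<nu> \<noteq> 0}"
    and "f = (\<Sum>\<nu> | \<nu> \<in> scl_idx M l \<and> scl_coeff M l f \<nu> \<noteq> 0. fscale (scl_coeff M l f \<nu>) (scl M \<nu>))"
proof -
  let ?B = "scl M ` scl_idx M l - {0}"
  let ?I = "{\<nu> \<in> scl_idx M l. scl_coeff M l f \<nu> \<noteq> 0}"
  have I: "{b. fspace.representation ?B f b \<noteq> 0} = scl M ` ?I"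
  proof (intro equalityI subsetI)
    fix b assume b: "b \<in> {b. fspace.representation ?B f b \<noteq> 0}"
    then have "b \<in> ?B" using fspace.representation_ne_zero[of ?B f b] by simp
    then obtain \<nu> where "\<nu> \<in> scl_idx M l" "b = scl M \<nu>" by auto
    then show "b \<in> scl M ` ?I" using b by (simp add: scl_coeff_def)
  next
    fix b assume "b \<in> scl M ` ?I"
    then show "b \<in> {b. fspace.representation ?B f b \<noteq> 0}" by (auto simp: scl_coeff_def)
  qed
  have inj: "inj_on (scl M) ?I"
    using scl_coeff_nonzero by (intro inj_on_subset[OF scl_indep_span(1)[of l]]) auto
  have "finite (scl M ` ?I)" using fspace.finite_representation[of ?B f] I by simp
  then show "finite ?I" using inj finite_imageD by blast
  have "f = (\<Sum>b\<in>scl M ` ?I. fscale (fspace.representation ?B f b) b)"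
  proof -
    have "f \<in> fspace.span ?B" using assms by (simp only: span_minus_zero)
    from fspace.sum_nonzero_representation_eq[OF scl_indep_span(2) this]
    show ?thesis unfolding I by (rule sym)
  qed
  also have "\<dots> = (\<Sum>\<nu>\<in>?I. fscale (scl_coeff M l f \<nu>) (scl M \<nu>))"
    by (subst sum.reindex[OF inj]) (simp add: scl_coeff_def)
  finally show "f = (\<Sum>\<nu>\<in>?I. fscale (scl_coeff M l f \<nu>) (scl M \<nu>))" .
qed

lemma scl_coeff_add:
  "f \<in> fspace.span (scl M ` scl_idx M l) \<Longrightarrow> g \<in> fspace.span (scl M ` scl_idx M l) \<Longrightarrow>
    scl_coeff M l (f + g) \<nu> = scl_coeff M l f \<nu> + scl_coeff M l g \<nu>"
  unfolding scl_coeff_def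
  by (subst fspace.representation_add[OF scl_indep_span(2)]) (simp_all only: span_minus_zero)

lemma scl_coeff_scale:
  "f \<in> fspace.span (scl M ` scl_idx M l) \<Longrightarrow> scl_coeff M l (fscale c f) \<nu> = c * scl_coeff M l f \<nu>"
  unfolding scl_coeff_def
  by (subst fspace.representation_scale[OF scl_indep_span(2)]) (simp_all only: span_minus_zero)

lemma scl_coeff_zero: "scl_coeff M l 0 \<nu> = 0"
  using scl_coeff_scale[of 0 l 0 \<nu>] fspace.span_zero by (auto simp: fscale_def zero_fun_def)

lemma scl_coeff_sum:
  assumes "\<And>i. i \<in> S \<Longrightarrow> f i \<in> fspace.span (scl M ` scl_idx M l)"
  shows "scl_coeff M l (\<Sum>i\<in>S. fscale (c i) (f i)) \<nu> = (\<Sum>i\<in>S. c i * scl_coeff M l (f i) \<nu>)"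
  using assms
proof (induction S rule: infinite_finite_induct)
  case (insert x S)
  then show ?case
  proof -
    have x: "fscale (c x) (f x) \<in> fspace.span (scl M ` scl_idx M l)"
      using insert.prems by (intro fspace.span_scale) auto
    have S: "(\<Sum>i\<in>S. fscale (c i) (f i)) \<in> fspace.span (scl M ` scl_idx M l)"
      using insert.prems by (intro fspace.span_sum fspace.span_scale) auto
    show ?thesis
      unfolding sum.insert[OF insert.hyps(1,2)] scl_coeff_add[OF x S]
      using insert by (simp add: scl_coeff_scale)
  qed
qed (auto simp: scl_coeff_zero)

lemma scl_coeff_scl:
  assumes "\<nu> \<in> scl_idx M l" "\<mu> \<in> scl_idx M l" "scl M \<nu> \<noteq> 0"
  shows "scl_coeff M l (scl M \<mu>) \<nu> = (if \<nu> = \<mu> then 1 else 0)"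
proof (cases "scl M \<mu> = 0")
  case True
  then show ?thesis using assms by (auto simp: scl_coeff_zero)
next
  case False
  then have "fspace.representation (scl M ` scl_idx M l - {0}) (scl M \<mu>) =
     (\<lambda>v. if v = scl M \<mu> then 1 else 0)"
    using assms by (intro fspace.representation_basis scl_indep_span(2)) auto
  moreover have "scl M \<nu> = scl M \<mu> \<longleftrightarrow> \<nu> = \<mu>"
    using assms False inj_onD[OF scl_indep_span(1)[of l], of \<nu> \<mu>] by auto
  ultimately show ?thesis by (simp add: scl_coeff_def)
qed

text \<open>Local linear independence, applied on the complement of \<open>supp f\<close>.\<close>

lemma scl_coeff_local:
  assumes f: "f \<in> fspace.span (scl M ` scl_idx M l)"
    and \<nu>: "\<nu> \<in> scl_idx M l" "scl_coeff M l f \<nu> \<noteq> 0"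
  shows "supp Q (scl M \<nu>) \<subseteq> supp Q f"
proof (rule supp_mono, rule ccontr)
  fix x assume x: "x \<in> Q" "scl M \<nu> x \<noteq> 0" "x \<notin> supp Q f"
  let ?S = "Q - closure (support_on Q f)"
  let ?J = "{\<kappa> \<in> scl_idx M l. \<exists>x\<in>?S. scl M \<kappa> x \<noteq> 0}"
  let ?c = "scl_coeff M l f"
  let ?I = "{\<kappa> \<in> scl_idx M l. ?c \<kappa> \<noteq> 0}"
  let ?r = "\<lambda>\<kappa>. fun_restrict ?S (scl M \<kappa>)"
  have "open ?S" using domain(1) by (simp add: open_Diff)
  then have J: "inj_on ?r ?J" "fspace.independent (?r ` ?J)"
    using scl_indep[of ?S ?J l] by auto
  have fin: "finite ?I" using scl_coeff_expansion(1)[OF f] .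
  have "(\<Sum>\<kappa>\<in>?I \<inter> ?J. fscale (?c \<kappa>) (?r \<kappa>)) = 0"
  proof
    fix y
    show "(\<Sum>\<kappa>\<in>?I \<inter> ?J. fscale (?c \<kappa>) (?r \<kappa>)) y = 0 y"
    proof (cases "y \<in> ?S")
      case True
      have "(\<Sum>\<kappa>\<in>?I \<inter> ?J. fscale (?c \<kappa>) (?r \<kappa>)) y = (\<Sum>\<kappa>\<in>?I \<inter> ?J. ?c \<kappa> * scl M \<kappa> y)"
        using True by (simp add: sum_fun_apply fscale_def fun_restrict_def)
      also have "\<dots> = (\<Sum>\<kappa>\<in>?I. ?c \<kappa> * scl M \<kappa> y)"
        using fin True by (intro sum.mono_neutral_left) auto
      also have "\<dots> = f y"
        by (subst (2) scl_coeff_expansion(2)[OF f]) (simp add: sum_fun_apply fscale_def)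
      also have "f y = 0" using True closure_subset[of "support_on Q f"] by (auto simp: support_on_def)
      finally show ?thesis by simp
    next
      case False
      then have "?r \<kappa> y = 0" for \<kappa> unfolding fun_restrict_def by (rule if_not_P)
      then show ?thesis by (simp add: sum_fun_apply fscale_def)
    qed
  qed
  moreover have "(\<Sum>v\<in>?r ` (?I \<inter> ?J). fscale (?c (the_inv_into ?J ?r v)) v) =
      (\<Sum>\<kappa>\<in>?I \<inter> ?J. fscale (?c \<kappa>) (?r \<kappa>))"
    by (subst sum.reindex) (auto intro!: sum.cong inj_on_subset[OF J(1)] simp: the_inv_into_f_f[OF J(1)])
  moreover have "\<nu> \<in> ?I \<inter> ?J" using x \<nu> by (auto simp: supp_def)
  ultimately have "?c (the_inv_into ?J ?r (?r \<nu>)) = 0"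
    using fin by (intro fspace.independentD[OF J(2), of "?r ` (?I \<inter> ?J)"
        "\<lambda>v. ?c (the_inv_into ?J ?r v)"]) auto
  then have "?c \<nu> = 0" using \<open>\<nu> \<in> ?I \<inter> ?J\<close> by (simp add: the_inv_into_f_f[OF J(1)])
  then show False using \<nu> by simp
qed

lemma scl_span_Suc: "fspace.span (scl M ` scl_idx M l) \<subseteq> fspace.span (scl M ` scl_idx M (Suc l))"
  using span_refine[of l] by auto

lemma scl_span_mono: "l \<le> k \<Longrightarrow> fspace.span (scl M ` scl_idx M l) \<subseteq> fspace.span (scl M ` scl_idx M k)"
  by (induction k rule: dec_induct) (use scl_span_Suc in blast)+

lemma wvl_in_span:
  assumes "\<kappa> \<in> wvl_idx M" "lvl M \<kappa> \<le> l"
  shows "wvl M \<kappa> \<in> fspace.span (scl M ` scl_idx M l)"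
proof -
  have "wvl M \<kappa> \<in> fspace.span (scl M ` scl_idx M (lvl M \<kappa>))"
  proof (cases "lvl M \<kappa>")
    case 0
    then have "\<kappa> \<in> scl_idx M 0" using assms level_zero(1) by (auto simp: wvl_lev_def)
    then have "wvl M \<kappa> \<in> scl M ` scl_idx M 0" using level_zero(2)[of \<kappa>] by (metis imageI)
    then show ?thesis unfolding 0 by (rule fspace.span_base)
  next
    case (Suc k)
    then show ?thesis using span_refine[of k] assms by (auto simp: wvl_lev_def)
  qed
  then show ?thesis using scl_span_mono[OF assms(2)] by auto
qed

lemma scl_in_span: "\<nu> \<in> scl_idx M l \<Longrightarrow> scl M \<nu> \<in> fspace.span (scl M ` scl_idx M l)"
  by (intro fspace.span_base) auto

lemma span_le_scl_span: "fspace.span (scl M ` scl_idx M l) \<subseteq> scl_span M"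
  unfolding scl_span_def by (intro fspace.span_mono) (auto simp: scl_all_def)

lemma wvl_in_scl_span: "\<kappa> \<in> wvl_idx M \<Longrightarrow> wvl M \<kappa> \<in> scl_span M"
  using wvl_in_span[of \<kappa> "lvl M \<kappa>"] span_le_scl_span by auto

lemma scl_in_scl_span: "\<nu> \<in> scl_idx M l \<Longrightarrow> scl M \<nu> \<in> scl_span M"
  using scl_in_span span_le_scl_span by blast

lemma family_level_scl: "\<nu> \<in> scl_idx M l \<Longrightarrow> family_level M Scalings \<nu> = l"
  using scl_disjoint by (auto intro!: the_equality)

section \<open>Neighbourhoods\<close>

lemma supp_subset_region: "\<kappa> \<in> wvl_idx M \<Longrightarrow> supp Q (wvl M \<kappa>) \<subseteq> region_set Q M Wavelet_Nbhd \<kappa>"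
  using nbhd[of \<kappa>] by auto

text \<open>S(\<mu>) is covered by the neighbourhoods of its parents, so a common point of X and
  S(\<mu>) is handed on from child to parent, and the tree contains each of them. A parent has
  non-empty support, since it meets the support of its child in positive measure; its
  \<open>region_set\<close> is therefore the whole neighbourhood.\<close>

lemma ancestor:
  assumes "tree M T" "\<mu> \<in> T" "l \<le> lvl M \<mu>" "X \<inter> region_set Q M Wavelet_Nbhd \<mu> \<noteq> {}"
  shows "\<exists>\<kappa>\<in>T. lvl M \<kappa> = l \<and> X \<inter> region_set Q M Wavelet_Nbhd \<kappa> \<noteq> {}"
  using assms
proof (induction "lvl M \<mu> - l" arbitrary: \<mu>)
  case 0
  then show ?case by (intro bexI[of _ \<mu>]) auto
next
  case (Suc n)
  obtain k where k: "lvl M \<mu> = Suc k" using Suc(2) by (cases "lvl M \<mu>") auto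
  have \<mu>: "\<mu> \<in> wvl_idx M" using Suc.prems by (auto simp: tree_def)
  obtain x where x: "x \<in> X" "x \<in> nbhd M \<mu>"
    using Suc.prems(4) by (auto split: if_splits)
  then obtain \<kappa> where \<kappa>: "\<kappa> \<in> parents M \<mu>" "x \<in> nbhd M \<kappa>" using nbhd_parents[OF \<mu>] k by auto
  have par: "\<kappa> \<in> wvl_lev M k" "emeasure lborel (supp Q (wvl M \<mu>) \<inter> supp Q (wvl M \<kappa>)) > 0"
    using parents_Suc[of \<mu> k] \<mu> k \<kappa>(1) by (auto simp: wvl_lev_def)
  then have "supp Q (wvl M \<kappa>) \<noteq> {}" by auto
  then have "X \<inter> region_set Q M Wavelet_Nbhd \<kappa> \<noteq> {}" using x \<kappa> by auto
  moreover have "\<kappa> \<in> T" using Suc.prems \<kappa>(1) by (auto simp: tree_def)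
  ultimately show ?case using Suc.hyps(1)[of \<kappa>] Suc.hyps(2) Suc.prems k par
    by (auto simp: wvl_lev_def)
qed

end

text \<open>Compactness covers the ball of radius C by finitely many balls of radius 1/2, and
  scaling by r transports this to every S. The centres are then moved into S, at the price of
  doubling the radius, because the locality axioms count overlaps only around points of Q.\<close>

lemma cover_by_balls:
  fixes C :: real
  shows "\<exists>n::nat. \<forall>(S :: 'a::euclidean_space set) y r. 0 < r \<longrightarrow> S \<subseteq> cball y (C * r) \<longrightarrow>
    (\<exists>F. finite F \<and> card F \<le> n \<and> F \<subseteq> S \<and> S \<subseteq> (\<Union>x\<in>F. ball x r))"
proof -
  have "cball (0::'a) C \<subseteq> (\<Union>g\<in>UNIV. ball g (1/2))"
  proof
    fix x :: 'a
    show "x \<in> (\<Union>g\<in>UNIV. ball g (1/2))" by (rule UN_I[of x]) auto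
  qed
  then obtain G where G: "finite G" "cball (0::'a) C \<subseteq> (\<Union>g\<in>G. ball g (1/2))"
    by (rule compactE_image[OF compact_cball open_ball])
  have "\<exists>F. finite F \<and> card F \<le> card G \<and> F \<subseteq> S \<and> S \<subseteq> (\<Union>x\<in>F. ball x r)"
    if r: "0 < r" and S: "S \<subseteq> cball y (C * r)" for S :: "'a set" and y r
  proof -
    let ?P = "\<lambda>g x. x \<in> S \<and> dist (y + r *\<^sub>R g) x < r / 2"
    define p where "p g = (SOME x. ?P g x)" for g
    have p: "?P g (p g)" if "?P g x" for g x unfolding p_def using that by (rule someI)
    let ?G = "{g \<in> G. \<exists>x. ?P g x}"
    have "S \<subseteq> (\<Union>x\<in>p ` ?G. ball x r)"
    proof
      fix x assume x: "x \<in> S"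
      let ?z = "(1 / r) *\<^sub>R (x - y)"
      have "norm (x - y) \<le> C * r" using S x by (auto simp: dist_norm norm_minus_commute)
      moreover have "norm ?z = norm (x - y) / r" using r by (simp only: norm_scaleR) simp
      ultimately have "?z \<in> cball 0 C" using r by (simp add: divide_le_eq)
      then have "?z \<in> (\<Union>g\<in>G. ball g (1/2))" using G(2) by blast
      then obtain g where g: "g \<in> G" "dist g ?z < 1 / 2" by (auto simp del: scaleR_right_diff_distrib)
      have "dist (y + r *\<^sub>R g) x = r * dist g ?z"
      proof -
        have "y + r *\<^sub>R g - x = r *\<^sub>R (g - ?z)" using r by (simp add: algebra_simps)
        then show ?thesis using r by (simp only: dist_norm norm_scaleR)
      qed
      also have "\<dots> < r / 2" using g(2) r by simp
      finally have P: "?P g x" using x by simp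
      have "dist (p g) x < r"
        using dist_triangle_half_r[of "y + r *\<^sub>R g" "p g" r x] P p[OF P] by blast
      then show "x \<in> (\<Union>x\<in>p ` ?G. ball x r)" using g(1) P by auto
    qed
    moreover have "p ` ?G \<subseteq> S" using p by blast
    moreover have "card (p ` ?G) \<le> card G"
      using card_image_le[of ?G p] card_mono[of G ?G] G(1) by force
    ultimately show ?thesis using G(1) by (intro exI[of _ "p ` ?G"]) auto
  qed
  then show ?thesis by (intro exI[of _ "card G"] allI impI)
qed

text \<open>Boundedly many balls of radius 2^-l cover S(\<kappa>), and each of them meets at most N
  of the sets. On coarser levels the balls are larger, so one covering number serves all l up to
  |\<kappa>| + 1.\<close>

lemma (in multilevel_system) meeting_bound:
  fixes X :: "'j \<Rightarrow> 'a set" and I :: "nat \<Rightarrow> 'j set"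
  assumes loc: "\<forall>l. \<forall>x\<in>Q. finite {\<mu> \<in> I l. X \<mu> \<inter> ball x (1 / 2 ^ l) \<noteq> {}} \<and>
      card {\<mu> \<in> I l. X \<mu> \<inter> ball x (1 / 2 ^ l) \<noteq> {}} \<le> N"
  shows "\<exists>K. \<forall>\<kappa>\<in>wvl_idx M. \<forall>l. l \<le> lvl M \<kappa> + 1 \<longrightarrow>
     finite {\<mu> \<in> I l. nbhd M \<kappa> \<inter> X \<mu> \<noteq> {}} \<and> card {\<mu> \<in> I l. nbhd M \<kappa> \<inter> X \<mu> \<noteq> {}} \<le> K"
proof -
  obtain C where C: "\<forall>\<kappa>\<in>wvl_idx M. diam_le (nbhd M \<kappa>) (C / 2 ^ lvl M \<kappa>)" using nbhd_diam by auto
  obtain n where n: "\<And>(S :: 'a set) y r. 0 < r \<Longrightarrow> S \<subseteq> cball y ((2 * \<bar>C\<bar>) * r) \<Longrightarrow>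
    (\<exists>F. finite F \<and> card F \<le> n \<and> F \<subseteq> S \<and> S \<subseteq> (\<Union>x\<in>F. ball x r))"
    using cover_by_balls[of "2 * \<bar>C\<bar>"] by blast
  have "finite {\<mu> \<in> I l. nbhd M \<kappa> \<inter> X \<mu> \<noteq> {}} \<and> card {\<mu> \<in> I l. nbhd M \<kappa> \<inter> X \<mu> \<noteq> {}} \<le> n * N"
    if \<kappa>: "\<kappa> \<in> wvl_idx M" and l: "l \<le> lvl M \<kappa> + 1" for \<kappa> l
  proof -
    let ?S = "nbhd M \<kappa>"
    let ?B = "\<lambda>x. {\<mu> \<in> I l. X \<mu> \<inter> ball x (1 / 2 ^ l) \<noteq> {}}"
    have "\<exists>y. ?S \<subseteq> cball y (2 * \<bar>C\<bar> * (1 / 2 ^ l))"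
    proof (cases "?S = {}")
      case False
      then obtain y where y: "y \<in> ?S" by auto
      \<comment> \<open>The factor 2 pays for l = |\<kappa>| + 1; the absolute value is taken
        because the sign of C is unknown.\<close>
      have "C / 2 ^ lvl M \<kappa> \<le> 2 * \<bar>C\<bar> * (1 / 2 ^ l)"
      proof -
        have "(2::real) ^ l \<le> 2 ^ (lvl M \<kappa> + 1)" using l by (intro power_increasing) auto
        then have "\<bar>C\<bar> * 2 ^ l \<le> \<bar>C\<bar> * (2 * 2 ^ lvl M \<kappa>)" by (intro mult_left_mono) auto
        moreover have "C * 2 ^ l \<le> \<bar>C\<bar> * 2 ^ l" by (intro mult_right_mono) auto
        ultimately have "C * 2 ^ l \<le> \<bar>C\<bar> * (2 * 2 ^ lvl M \<kappa>)" by linarith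
        then show ?thesis by (simp add: field_simps)
      qed
      moreover have "dist y x \<le> C / 2 ^ lvl M \<kappa>" if "x \<in> ?S" for x
        using C \<kappa> y that diameter_bounded_bound[of ?S y x] by (force simp: diam_le_def)
      ultimately show ?thesis by (intro exI[of _ y]) fastforce
    qed auto
    then obtain y where y: "?S \<subseteq> cball y (2 * \<bar>C\<bar> * (1 / 2 ^ l))" by blast
    have r: "0 < 1 / (2::real) ^ l" by simp
    obtain F where F: "finite F" "card F \<le> n" "F \<subseteq> ?S" "?S \<subseteq> (\<Union>x\<in>F. ball x (1 / 2 ^ l))"
      using n[OF r y] that by blast
    have FQ: "F \<subseteq> Q" using F(3) nbhd[OF \<kappa>] by auto
    have sub: "{\<mu> \<in> I l. ?S \<inter> X \<mu> \<noteq> {}} \<subseteq> (\<Union>x\<in>F. ?B x)"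
    proof
      fix \<mu> assume \<mu>: "\<mu> \<in> {\<mu> \<in> I l. ?S \<inter> X \<mu> \<noteq> {}}"
      then obtain z where z: "z \<in> ?S" "z \<in> X \<mu>" by auto
      then obtain x where "x \<in> F" "z \<in> ball x (1 / 2 ^ l)" using F(4) by blast
      then show "\<mu> \<in> (\<Union>x\<in>F. ?B x)" using \<mu> z(2) by (intro UN_I[of x]) auto
    qed
    have fin: "finite (\<Union>x\<in>F. ?B x)" using F(1) FQ loc by auto
    have "card (\<Union>x\<in>F. ?B x) \<le> (\<Sum>x\<in>F. card (?B x))" by (rule card_UN_le[OF F(1)])
    also have "\<dots> \<le> (\<Sum>x\<in>F. N)" using FQ loc by (intro sum_mono) auto
    also have "\<dots> \<le> n * N" using F(2) by simp
    finally show ?thesis using card_mono[OF fin sub] finite_subset[OF sub fin] by auto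
  qed
  then show ?thesis by blast
qed

lemma overlapping_bound:
  fixes M :: "('a::euclidean_space, 'i) multilevel" and M' :: "('a, 'i) multilevel"
  assumes "multilevel_system Q M" "multilevel_system Q M'" "r \<in> {Wavelet_Supp, Scaling_Supp}"
  shows "\<exists>K. \<forall>\<kappa>\<in>wvl_idx M. finite (overlapping Q M Wavelet_Nbhd \<kappa> M' r) \<and>
     card (overlapping Q M Wavelet_Nbhd \<kappa> M' r) \<le> K"
proof -
  interpret M: multilevel_system Q M by fact
  interpret M': multilevel_system Q M' by fact
  let ?X = "region_set Q M' r"
  define I where "I l = (if r = Wavelet_Supp then wvl_lev M' l else scl_idx M' l)" for l
  have idx: "\<mu> \<in> I (family_level M' (family_of r) \<mu>)" if "\<mu> \<in> family_idx M' (family_of r)" for \<mu>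
    using that assms(3) M'.family_level_scl by (auto simp: I_def wvl_lev_def scl_all_def simp del: family_level.simps(2))
  have "\<exists>N. \<forall>l. \<forall>x\<in>Q. finite {\<mu> \<in> I l. ?X \<mu> \<inter> ball x (1 / 2 ^ l) \<noteq> {}} \<and>
      card {\<mu> \<in> I l. ?X \<mu> \<inter> ball x (1 / 2 ^ l) \<noteq> {}} \<le> N"
  proof (cases "r = Wavelet_Supp")
    case True
    then show ?thesis using M'.wvl_local by (simp add: I_def)
  next
    case False
    then have "r = Scaling_Supp" using assms(3) by simp
    then show ?thesis using M'.scl_local by (simp add: I_def)
  qed
  then obtain K where K: "\<And>\<kappa> l. \<kappa> \<in> wvl_idx M \<Longrightarrow> l \<le> lvl M \<kappa> + 1 \<Longrightarrow>
     finite {\<mu> \<in> I l. nbhd M \<kappa> \<inter> ?X \<mu> \<noteq> {}} \<and> card {\<mu> \<in> I l. nbhd M \<kappa> \<inter> ?X \<mu> \<noteq> {}} \<le> K"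
    using M.meeting_bound[of I ?X] by blast
  have "finite (overlapping Q M Wavelet_Nbhd \<kappa> M' r) \<and>
     card (overlapping Q M Wavelet_Nbhd \<kappa> M' r) \<le> 3 * K" if \<kappa>: "\<kappa> \<in> wvl_idx M" for \<kappa>
  proof -
    let ?Y = "\<lambda>l. {\<mu> \<in> I l. nbhd M \<kappa> \<inter> ?X \<mu> \<noteq> {}}"
    let ?l = "lvl M \<kappa>"
    have sub: "overlapping Q M Wavelet_Nbhd \<kappa> M' r \<subseteq> (\<Union>l\<in>{?l - 1, ?l, ?l + 1}. ?Y l)"
    proof
      fix \<mu> assume \<mu>: "\<mu> \<in> overlapping Q M Wavelet_Nbhd \<kappa> M' r"
      let ?k = "family_level M' (family_of r) \<mu>"
      have "nbhd M \<kappa> \<inter> ?X \<mu> \<noteq> {}" "\<mu> \<in> I ?k" "\<bar>int ?k - int ?l\<bar> \<le> 1"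
        using \<mu> idx[of \<mu>] by (auto simp: overlapping_def split: if_splits)
      moreover from this(3) have "?k \<in> {?l - 1, ?l, ?l + 1}" by auto
      ultimately show "\<mu> \<in> (\<Union>l\<in>{?l - 1, ?l, ?l + 1}. ?Y l)" by blast
    qed
    have fin: "finite (\<Union>l\<in>{?l - 1, ?l, ?l + 1}. ?Y l)" using K[OF \<kappa>] by auto
    have "card (\<Union>l\<in>{?l - 1, ?l, ?l + 1}. ?Y l) \<le> (\<Sum>l\<in>{?l - 1, ?l, ?l + 1}. card (?Y l))"
      by (rule card_UN_le) simp
    also have "\<dots> \<le> (\<Sum>l\<in>{?l - 1, ?l, ?l + 1}. K)" using K[OF \<kappa>] by (intro sum_mono) auto
    \<comment> \<open>On level 0 the truncated \<open>?l - 1\<close> coincides with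
      \<open>?l\<close>, so there are at most three levels.\<close>
    also have "\<dots> \<le> 3 * K" using card_insert_le_m1[of 3 "{?l, ?l + 1}" "?l - 1"] by simp
    finally show ?thesis using card_mono[OF fin sub] finite_subset[OF sub fin] by auto
  qed
  then show ?thesis by blast
qed

section \<open>One coordinate direction\<close>

fun opposite :: "side \<Rightarrow> side" where
  "opposite Trial = Test"
| "opposite Test = Trial"

text \<open>\<open>near_scl t s \<kappa> s' l\<close> and \<open>near_wvl t s \<kappa> l\<close> are the scaling functions on side \<open>s'\<close>, and the
  wavelets on the other side, of level \<open>l\<close> whose supports meet the neighbourhood of the wavelet
  \<open>\<kappa>\<close> on side \<open>s\<close>; \<open>l\<close> differs from the level of \<open>\<kappa>\<close> by at most one.\<close>

record 'i tables =
  near_scl :: "side \<Rightarrow> 'i \<Rightarrow> side \<Rightarrow> nat \<Rightarrow> 'i set"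
  near_wvl :: "side \<Rightarrow> 'i \<Rightarrow> nat \<Rightarrow> 'i set"
  wvl_level :: "side \<Rightarrow> 'i \<Rightarrow> nat"

text \<open>On level 0 a wavelet is its own scaling function, so only \<kappa> is kept. It drops out
  if it vanishes, as an empty support meets nothing.\<close>

definition own_scl :: "'i tables \<Rightarrow> side \<Rightarrow> 'i \<Rightarrow> 'i set"
  where "own_scl t s \<kappa> =
    {\<nu> \<in> near_scl t s \<kappa> s (wvl_level t s \<kappa>). wvl_level t s \<kappa> = 0 \<longrightarrow> \<nu> = \<kappa>}"

text \<open>The operator is split into the part with \<open>|\<mu>| \<le> |\<kappa>|\<close> (\<open>low\<close>), computed from the scaling
  coefficients of \<open>\<Sum>\<^bsub>|\<mu>| \<le> l\<^esub> x\<^sub>\<mu> \<psi>\<^sub>\<mu>\<close>, and the part with \<open>|\<mu>| > |\<kappa>|\<close> (\<open>upp\<close>), computed from the values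
  of \<open>A (\<Sum>\<^bsub>|\<mu>| \<ge> l\<^esub> x\<^sub>\<mu> \<psi>\<^sub>\<mu>)\<close> at scaling functions of level \<open>l\<close>.  The following index sets select the
  terms of the recursions for these quantities (\<open>p\<close>: from the adjacent level, \<open>q\<close>: from the
  input) and of the output (\<open>o\<close>).\<close>

definition low_idx :: "'i tables \<Rightarrow> 'i set \<Rightarrow> (nat \<times> 'i) set"
  where "low_idx t T = (SIGMA l:wvl_level t Test ` T.
    \<Union>\<kappa>\<in>{\<kappa> \<in> T. wvl_level t Test \<kappa> = l}. near_scl t Test \<kappa> Trial l)"

text \<open>Both indices have to be near the same \<kappa>. A non-zero mask entry forces the support
  of \<nu> into that of \<nu>2, so a \<kappa> near \<nu> is near \<nu>2 as well; charging the pair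
  to \<kappa> gives at most K * K terms per \<kappa>.\<close>

definition low_p :: "'i tables \<Rightarrow> 'i set \<Rightarrow> nat \<Rightarrow> 'i \<Rightarrow> 'i set"
  where "low_p t T l \<nu> = {\<nu>2. 1 \<le> l \<and> (\<exists>\<kappa>\<in>T. wvl_level t Test \<kappa> = l \<and>
    \<nu> \<in> near_scl t Test \<kappa> Trial l \<and> \<nu>2 \<in> near_scl t Test \<kappa> Trial (l - 1))}"

definition low_q :: "'i tables \<Rightarrow> 'i set \<Rightarrow> 'i set \<Rightarrow> nat \<Rightarrow> 'i \<Rightarrow> 'i set"
  where "low_q t U T l \<nu> = {\<mu> \<in> U. (l = 0 \<longrightarrow> \<nu> = \<mu>) \<and> (\<exists>\<kappa>\<in>T. wvl_level t Test \<kappa> = l \<and>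
    \<nu> \<in> near_scl t Test \<kappa> Trial l \<and> \<mu> \<in> near_wvl t Test \<kappa> l)}"

definition low_o :: "'i tables \<Rightarrow> 'i \<Rightarrow> ('i \<times> 'i) set"
  where "low_o t \<kappa> = own_scl t Test \<kappa> \<times> near_scl t Test \<kappa> Trial (wvl_level t Test \<kappa>)"

definition upp_idx :: "'i tables \<Rightarrow> 'i set \<Rightarrow> (nat \<times> 'i) set"
  where "upp_idx t T = (SIGMA l:wvl_level t Trial ` T.
    \<Union>\<mu>\<in>{\<mu> \<in> T. wvl_level t Trial \<mu> = l}. near_scl t Trial \<mu> Test l)"

definition upp_p :: "'i tables \<Rightarrow> 'i set \<Rightarrow> nat \<Rightarrow> 'i \<Rightarrow> 'i set"
  where "upp_p t T l \<nu> = {\<nu>2. \<exists>\<mu>\<in>T. wvl_level t Trial \<mu> = Suc l \<and>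
    \<nu>2 \<in> near_scl t Trial \<mu> Test (Suc l) \<and> \<nu> \<in> near_scl t Trial \<mu> Test l}"

definition upp_q :: "'i tables \<Rightarrow> 'i set \<Rightarrow> nat \<Rightarrow> 'i \<Rightarrow> ('i \<times> 'i) set"
  where "upp_q t T l \<nu> = (SIGMA \<mu>:{\<mu> \<in> T. wvl_level t Trial \<mu> = l \<and> \<nu> \<in> near_scl t Trial \<mu> Test l}.
    own_scl t Trial \<mu>)"

text \<open>Only those functions of the next level are listed for which the circuit has a node; by
  \<open>upp_nonzero\<close> the quantities left out are 0.\<close>

definition upp_o :: "'i tables \<Rightarrow> 'i set \<Rightarrow> 'i \<Rightarrow> ('i \<times> 'i) set"
  where "upp_o t T \<kappa> = own_scl t Test \<kappa> \<times>
    {\<nu> \<in> near_scl t Test \<kappa> Test (Suc (wvl_level t Test \<kappa>)). (Suc (wvl_level t Test \<kappa>), \<nu>) \<in> upp_idx t T}"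

text \<open>The mask matrix \<open>\<qq>\<^sub>0\<close> does not exist; since \<open>\<Phi>\<^sub>0 = \<Psi>\<^sub>0\<close>, it is to be read as the identity.\<close>

definition q_val :: "(side \<Rightarrow> nat \<Rightarrow> 'i \<Rightarrow> 'i \<Rightarrow> real) \<Rightarrow> side \<Rightarrow> nat \<Rightarrow> 'i \<Rightarrow> 'i \<Rightarrow> real"
  where "q_val q s l \<nu> \<kappa> = (if l = 0 then 1 else q s l \<nu> \<kappa>)"

text \<open>The two directions live on domains of different types. This interface mentions only
  indices and reals, so both directions become members of one family indexed by the axis, and the
  two-dimensional argument treats them uniformly. Of trees it keeps the closure under unions and the
  recursions that hold on them.\<close>

locale axis =
  fixes t :: "'i tables" and W :: "side \<Rightarrow> 'i set" and tr :: "side \<Rightarrow> 'i set \<Rightarrow> bool"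
    and p q :: "side \<Rightarrow> nat \<Rightarrow> 'i \<Rightarrow> 'i \<Rightarrow> real" and a mat :: "'i \<Rightarrow> 'i \<Rightarrow> real"
    and low upp :: "'i set \<Rightarrow> ('i \<Rightarrow> real) \<Rightarrow> nat \<Rightarrow> 'i \<Rightarrow> real" and K :: nat
  assumes tree_Union: "(\<And>T. T \<in> \<T> \<Longrightarrow> tr s T \<and> T \<subseteq> W s) \<Longrightarrow> tr s (\<Union>\<T>)"
    and near_scl_bound: "\<kappa> \<in> W s \<Longrightarrow> finite (near_scl t s \<kappa> s' l) \<and> card (near_scl t s \<kappa> s' l) \<le> K"
    and near_wvl_bound: "\<kappa> \<in> W s \<Longrightarrow> finite (near_wvl t s \<kappa> l) \<and> card (near_wvl t s \<kappa> l) \<le> K"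
    and near_wvl_level: "\<kappa> \<in> W s \<Longrightarrow> \<mu> \<in> near_wvl t s \<kappa> l \<Longrightarrow>
      \<mu> \<in> W (opposite s) \<and> wvl_level t (opposite s) \<mu> = l"
    and low_p_idx: "tr Test T \<Longrightarrow> T \<subseteq> W Test \<Longrightarrow> (l, \<nu>) \<in> low_idx t T \<Longrightarrow> \<nu>2 \<in> low_p t T l \<nu> \<Longrightarrow>
      1 \<le> l \<and> (l - 1, \<nu>2) \<in> low_idx t T"
    and low_rec: "tr Test T \<Longrightarrow> T \<subseteq> W Test \<Longrightarrow> U \<subseteq> W Trial \<Longrightarrow> (l, \<nu>) \<in> low_idx t T \<Longrightarrow>
      low U x l \<nu> = (\<Sum>\<nu>2\<in>low_p t T l \<nu>. p Trial l \<nu> \<nu>2 * low U x (l - 1) \<nu>2) +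
        (\<Sum>\<mu>\<in>low_q t U T l \<nu>. q_val q Trial l \<nu> \<mu> * x \<mu>)"
    and low_out: "\<kappa> \<in> W Test \<Longrightarrow> U \<subseteq> W Trial \<Longrightarrow> l = wvl_level t Test \<kappa> \<Longrightarrow>
      (\<Sum>\<mu> | \<mu> \<in> U \<and> wvl_level t Trial \<mu> \<le> l. mat \<kappa> \<mu> * x \<mu>) =
      (\<Sum>(\<nu>', \<nu>)\<in>low_o t \<kappa>. q_val q Test l \<nu>' \<kappa> * a \<nu>' \<nu> * low U x l \<nu>)"
    and upp_rec: "tr Trial T \<Longrightarrow> T \<subseteq> W Trial \<Longrightarrow> (l, \<nu>') \<in> upp_idx t T \<Longrightarrow>
      upp T x l \<nu>' = (\<Sum>\<nu>2\<in>upp_p t T l \<nu>'. p Test (Suc l) \<nu>2 \<nu>' * upp T x (Suc l) \<nu>2) +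
        (\<Sum>(\<mu>, \<nu>)\<in>upp_q t T l \<nu>'. q_val q Trial l \<nu> \<mu> * a \<nu>' \<nu> * x \<mu>)"
    and upp_out: "\<kappa> \<in> W Test \<Longrightarrow> tr Trial T \<Longrightarrow> T \<subseteq> W Trial \<Longrightarrow> l = wvl_level t Test \<kappa> \<Longrightarrow>
      (\<Sum>\<mu> | \<mu> \<in> T \<and> l < wvl_level t Trial \<mu>. mat \<kappa> \<mu> * x \<mu>) =
      (\<Sum>(\<nu>', \<nu>2)\<in>upp_o t T \<kappa>. q_val q Test l \<nu>' \<kappa> * p Test (Suc l) \<nu>2 \<nu>' * upp T x (Suc l) \<nu>2)"
    and upp_zero: "\<kappa> \<in> W Test \<Longrightarrow> tr Trial T \<Longrightarrow> T \<subseteq> W Trial \<Longrightarrow> \<mu> \<in> T \<Longrightarrow>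
      l = wvl_level t Test \<kappa> \<Longrightarrow> l < wvl_level t Trial \<mu> \<Longrightarrow> mat \<kappa> \<mu> \<noteq> 0 \<Longrightarrow>
      \<exists>\<mu>2\<in>T. wvl_level t Trial \<mu>2 = Suc l \<and> \<kappa> \<in> near_wvl t Trial \<mu>2 l"

section \<open>Local operators\<close>

declare region_set.simps [simp del]

text \<open>\<open>W\<close> holds the wavelet indices that occur in the given index sets in this
  direction. Lookups fill the tables for these only, so all assumptions on the tables are confined
  to \<open>W\<close>.\<close>

locale local_axis =
  fixes Q :: "'a::euclidean_space set" and N :: "side \<Rightarrow> ('a, 'i) multilevel"
    and A :: "('a \<Rightarrow> real) \<Rightarrow> ('a \<Rightarrow> real) \<Rightarrow> real" and t :: "'i tables" and W :: "side \<Rightarrow> 'i set" and K :: nat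
  assumes sys: "multilevel_system Q (N s)"
    and A: "local_operator Q (N Trial) (N Test) A"
    and finite_W: "finite (W s)" and W_idx: "W s \<subseteq> wvl_idx (N s)"
    and near_scl_iff: "\<kappa> \<in> W s \<Longrightarrow> \<nu> \<in> near_scl t s \<kappa> s' l \<longleftrightarrow> \<nu> \<in> scl_idx (N s') l \<and>
      \<bar>int l - int (lvl (N s) \<kappa>)\<bar> \<le> 1 \<and>
      region_set Q (N s) Wavelet_Nbhd \<kappa> \<inter> supp Q (scl (N s') \<nu>) \<noteq> {}"
    and near_wvl_iff: "\<kappa> \<in> W s \<Longrightarrow> \<mu> \<in> near_wvl t s \<kappa> l \<longleftrightarrow> \<mu> \<in> W (opposite s) \<and>
      lvl (N (opposite s)) \<mu> = l \<and> \<bar>int l - int (lvl (N s) \<kappa>)\<bar> \<le> 1 \<and>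
      region_set Q (N s) Wavelet_Nbhd \<kappa> \<inter> supp Q (wvl (N (opposite s)) \<mu>) \<noteq> {}"
    and level: "\<kappa> \<in> W s \<Longrightarrow> wvl_level t s \<kappa> = lvl (N s) \<kappa>"
    and near_scl_card: "\<kappa> \<in> W s \<Longrightarrow> finite (near_scl t s \<kappa> s' l) \<and> card (near_scl t s \<kappa> s' l) \<le> K"
    and near_wvl_card: "\<kappa> \<in> W s \<Longrightarrow> finite (near_wvl t s \<kappa> l) \<and> card (near_wvl t s \<kappa> l) \<le> K"
begin

abbreviation U0 where "U0 \<equiv> scl_span (N Trial)"
abbreviation V0 where "V0 \<equiv> scl_span (N Test)"
abbreviation span_lev where "span_lev s l \<equiv> fspace.span (scl (N s) ` scl_idx (N s) l)"
abbreviation reg where "reg s \<kappa> \<equiv> region_set Q (N s) Wavelet_Nbhd \<kappa>"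

section \<open>Bilinearity, locality and expansion of wavelets into scaling functions\<close>

lemma scl_span_closed:
  "f \<in> scl_span (N s) \<Longrightarrow> fscale c f \<in> scl_span (N s)"
  "(\<And>i. i \<in> S \<Longrightarrow> g i \<in> scl_span (N s)) \<Longrightarrow> sum g S \<in> scl_span (N s)"
  "0 \<in> scl_span (N s)"
  unfolding scl_span_def by (auto intro: fspace.span_scale fspace.span_sum fspace.span_zero)

lemma W_mem: "\<kappa> \<in> W s \<Longrightarrow> \<kappa> \<in> wvl_idx (N s)" using W_idx by blast

lemma wvl_mem: "\<kappa> \<in> W s \<Longrightarrow> wvl (N s) \<kappa> \<in> scl_span (N s)"
  using multilevel_system.wvl_in_scl_span[OF sys] W_mem by blast

lemma scl_mem: "\<nu> \<in> scl_idx (N s) l \<Longrightarrow> scl (N s) \<nu> \<in> scl_span (N s)"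
  using multilevel_system.scl_in_scl_span[OF sys] by blast

lemma A_add_right: "u \<in> U0 \<Longrightarrow> v \<in> V0 \<Longrightarrow> w \<in> V0 \<Longrightarrow> A u (v + w) = A u v + A u w"
  and A_scale_right: "u \<in> U0 \<Longrightarrow> v \<in> V0 \<Longrightarrow> A u (fscale c v) = c * A u v"
  and A_add_left: "u \<in> U0 \<Longrightarrow> w \<in> U0 \<Longrightarrow> v \<in> V0 \<Longrightarrow> A (u + w) v = A u v + A w v"
  and A_scale_left: "u \<in> U0 \<Longrightarrow> v \<in> V0 \<Longrightarrow> A (fscale c u) v = c * A u v"
  using A unfolding local_operator_def by blast+

lemma A_local:
  assumes "u \<in> U0" "w \<in> U0" "v \<in> V0" "\<And>x. x \<in> supp Q v \<Longrightarrow> u x = w x"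
  shows "A u v = A w v"
proof -
  have "AE x in lborel. x \<in> supp Q v \<longrightarrow> u x = w x" using assms(4) by auto
  then show ?thesis using A assms(1-3) unfolding local_operator_def by blast
qed

lemma A_zero_right: "u \<in> U0 \<Longrightarrow> A u 0 = 0"
  using A_scale_right[of u 0 0] scl_span_closed(3) by (simp add: fscale_def zero_fun_def)

lemma A_zero_left: "v \<in> V0 \<Longrightarrow> A 0 v = 0"
  using A_scale_left[of 0 v 0] scl_span_closed(3) by (simp add: fscale_def zero_fun_def)

lemma A_sum_right:
  assumes "u \<in> U0" "\<And>i. i \<in> S \<Longrightarrow> v i \<in> V0"
  shows "A u (\<Sum>i\<in>S. fscale (c i) (v i)) = (\<Sum>i\<in>S. c i * A u (v i))"
  using assms(2)
proof (induction S rule: infinite_finite_induct)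
  case (insert x S)
  have x: "fscale (c x) (v x) \<in> V0" using insert.prems by (intro scl_span_closed(1)) auto
  have S: "(\<Sum>i\<in>S. fscale (c i) (v i)) \<in> V0"
    using insert.prems by (intro scl_span_closed(2) scl_span_closed(1)) auto
  show ?case unfolding sum.insert[OF insert.hyps(1,2)] A_add_right[OF assms(1) x S]
    using insert assms(1) by (simp add: A_scale_right)
qed (auto simp: A_zero_right[OF assms(1)])

lemma A_sum_left:
  assumes "v \<in> V0" "\<And>i. i \<in> S \<Longrightarrow> u i \<in> U0"
  shows "A (\<Sum>i\<in>S. fscale (c i) (u i)) v = (\<Sum>i\<in>S. c i * A (u i) v)"
  using assms(2)
proof (induction S rule: infinite_finite_induct)
  case (insert x S)
  have x: "fscale (c x) (u x) \<in> U0" using insert.prems by (intro scl_span_closed(1)) auto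
  have S: "(\<Sum>i\<in>S. fscale (c i) (u i)) \<in> U0"
    using insert.prems by (intro scl_span_closed(2) scl_span_closed(1)) auto
  show ?case unfolding sum.insert[OF insert.hyps(1,2)] A_add_left[OF x S assms(1)]
    using insert assms(1) by (simp add: A_scale_left)
qed (auto simp: A_zero_left[OF assms(1)])

lemma A_disjoint:
  assumes "u \<in> U0" "v \<in> V0" "\<And>x. x \<notin> Q \<Longrightarrow> u x = 0" "supp Q u \<inter> supp Q v = {}"
  shows "A u v = 0"
proof -
  have "u x = 0 x" if "x \<in> supp Q v" for x
    using assms(3)[of x] assms(4) that in_supp[of x Q u] by auto
  then show ?thesis
    using A_local[OF assms(1) scl_span_closed(3) assms(2)] A_zero_left[OF assms(2)] by auto
qed

lemma wvl_outside: "\<kappa> \<in> W s \<Longrightarrow> x \<notin> Q \<Longrightarrow> wvl (N s) \<kappa> x = 0"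
  using multilevel_system.wvl_on[OF sys] W_mem by blast

lemma supp_region: "\<kappa> \<in> W s \<Longrightarrow> supp Q (wvl (N s) \<kappa>) \<subseteq> reg s \<kappa>"
  using multilevel_system.supp_subset_region[OF sys] W_mem by blast

lemma supp_empty: "(\<And>x. x \<notin> Q \<Longrightarrow> f x = 0) \<Longrightarrow> supp Q f = {} \<Longrightarrow> f = 0"
  using in_supp[of _ Q f] by fastforce

lemma scl_supp_nonempty: "\<nu> \<in> scl_idx (N s) l \<Longrightarrow> scl (N s) \<nu> \<noteq> 0 \<Longrightarrow> supp Q (scl (N s) \<nu>) \<noteq> {}"
  using supp_empty multilevel_system.scl_outside[OF sys] by blast

text \<open>A scaling function with non-zero coefficient does not vanish and is supported in the
  support of the wavelet, so it meets S(\<kappa>) and is in the table. On level 0 the sum has the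
  wavelet itself as its only term, or is empty if the wavelet is 0.\<close>

lemma wvl_expansion:
  assumes \<kappa>: "\<kappa> \<in> W s"
  shows "wvl (N s) \<kappa> = (\<Sum>\<nu>\<in>own_scl t s \<kappa>. fscale (q_val (\<lambda>s. mask_q (N s)) s (lvl (N s) \<kappa>) \<nu> \<kappa>) (scl (N s) \<nu>))"
proof -
  interpret multilevel_system Q "N s" by (rule sys)
  let ?l = "lvl (N s) \<kappa>"
  have near: "\<nu> \<in> near_scl t s \<kappa> s ?l"
    if "\<nu> \<in> scl_idx (N s) ?l" "scl (N s) \<nu> \<noteq> 0" "supp Q (scl (N s) \<nu>) \<subseteq> supp Q (wvl (N s) \<kappa>)" for \<nu>
    using scl_supp_nonempty[of \<nu> s ?l] that supp_region[OF \<kappa>] unfolding near_scl_iff[OF \<kappa>] by auto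
  show ?thesis
  proof (cases "?l = 0")
    case True
    then have \<kappa>0: "\<kappa> \<in> scl_idx (N s) 0" using W_mem[OF \<kappa>] level_zero(1) by (auto simp: wvl_lev_def)
    note eq = level_zero(2)[OF \<kappa>0]
    show ?thesis
    proof (cases "wvl (N s) \<kappa> = 0")
      case True
      then have "own_scl t s \<kappa> = {}"
        using \<open>?l = 0\<close> \<kappa> by (auto simp: own_scl_def level near_scl_iff eq)
      then show ?thesis using True by simp
    next
      case False
      then have "own_scl t s \<kappa> = {\<kappa>}"
        using \<open>?l = 0\<close> \<kappa> \<kappa>0 near[of \<kappa>] by (auto simp: own_scl_def level eq)
      then show ?thesis using \<open>?l = 0\<close> by (simp add: q_val_def eq fscale_def)
    qed
  next
    case False
    let ?c = "scl_coeff (N s) ?l (wvl (N s) \<kappa>)"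
    have f: "wvl (N s) \<kappa> \<in> span_lev s ?l" using wvl_in_span[OF W_mem[OF \<kappa>]] by simp
    have own: "own_scl t s \<kappa> = near_scl t s \<kappa> s ?l" using False \<kappa> by (auto simp: own_scl_def level)
    have fin: "finite (near_scl t s \<kappa> s ?l)" using near_scl_card[OF \<kappa>] by simp
    have "wvl (N s) \<kappa> = (\<Sum>\<nu> | \<nu> \<in> scl_idx (N s) ?l \<and> ?c \<nu> \<noteq> 0. fscale (?c \<nu>) (scl (N s) \<nu>))"
      by (rule scl_coeff_expansion(2)[OF f])
    also have "\<dots> = (\<Sum>\<nu>\<in>near_scl t s \<kappa> s ?l. fscale (?c \<nu>) (scl (N s) \<nu>))"
    proof (rule sum.mono_neutral_left[OF fin])
      show "{\<nu> \<in> scl_idx (N s) ?l. ?c \<nu> \<noteq> 0} \<subseteq> near_scl t s \<kappa> s ?l"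
      proof
        fix \<nu> assume "\<nu> \<in> {\<nu> \<in> scl_idx (N s) ?l. ?c \<nu> \<noteq> 0}"
        then have \<nu>: "\<nu> \<in> scl_idx (N s) ?l" "?c \<nu> \<noteq> 0" by auto
        show "\<nu> \<in> near_scl t s \<kappa> s ?l"
          by (rule near[OF \<nu>(1) scl_coeff_nonzero[OF \<nu>(2)] scl_coeff_local[OF f \<nu>]])
      qed
      show "\<forall>\<nu>\<in>near_scl t s \<kappa> s ?l - {\<nu> \<in> scl_idx (N s) ?l. ?c \<nu> \<noteq> 0}. fscale (?c \<nu>) (scl (N s) \<nu>) = 0"
        using near_scl_iff[OF \<kappa>] by (auto simp: fscale_def)
    qed
    also have "\<dots> = (\<Sum>\<nu>\<in>own_scl t s \<kappa>. fscale (q_val (\<lambda>s. mask_q (N s)) s ?l \<nu> \<kappa>) (scl (N s) \<nu>))"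
      unfolding own
    proof (rule sum.cong[OF refl])
      fix \<nu> assume "\<nu> \<in> near_scl t s \<kappa> s ?l"
      then show "fscale (?c \<nu>) (scl (N s) \<nu>) =
          fscale (q_val (\<lambda>s. mask_q (N s)) s ?l \<nu> \<kappa>) (scl (N s) \<nu>)"
        using near_scl_iff[OF \<kappa>] False W_mem[OF \<kappa>] by (simp add: q_val_def mask_q_def wvl_lev_def)
    qed
    finally show ?thesis .
  qed
qed

lemma own_scl_supp:
  assumes \<kappa>: "\<kappa> \<in> W s" and \<nu>: "\<nu> \<in> own_scl t s \<kappa>"
    and q: "q_val (\<lambda>s. mask_q (N s)) s (lvl (N s) \<kappa>) \<nu> \<kappa> \<noteq> 0"
  shows "supp Q (scl (N s) \<nu>) \<subseteq> supp Q (wvl (N s) \<kappa>)"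
proof -
  interpret multilevel_system Q "N s" by (rule sys)
  have \<nu>l: "\<nu> \<in> scl_idx (N s) (lvl (N s) \<kappa>)" using \<nu> by (auto simp: own_scl_def level[OF \<kappa>] near_scl_iff[OF \<kappa>])
  show ?thesis
  proof (cases "lvl (N s) \<kappa> = 0")
    case True
    then show ?thesis using \<nu> \<nu>l level_zero(2)[of \<nu>] by (auto simp: own_scl_def level[OF \<kappa>])
  next
    case False
    then have "scl_coeff (N s) (lvl (N s) \<kappa>) (wvl (N s) \<kappa>) \<nu> \<noteq> 0"
      using q by (auto simp: q_val_def mask_q_def split: if_splits)
    then show ?thesis by (rule scl_coeff_local[OF wvl_in_span[OF W_mem[OF \<kappa>] order_refl] \<nu>l])
  qed
qed

lemma finite_own_scl: "\<kappa> \<in> W s \<Longrightarrow> finite (own_scl t s \<kappa>)"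
  using near_scl_card unfolding own_scl_def by auto

lemma own_scl_idx: "\<kappa> \<in> W s \<Longrightarrow> \<nu> \<in> own_scl t s \<kappa> \<Longrightarrow> \<nu> \<in> scl_idx (N s) (lvl (N s) \<kappa>)"
  by (auto simp: own_scl_def level near_scl_iff)

lemma A_wvl_right:
  assumes "\<kappa> \<in> W Test" "u \<in> U0"
  shows "A u (wvl (N Test) \<kappa>) = (\<Sum>\<nu>\<in>own_scl t Test \<kappa>.
     q_val (\<lambda>s. mask_q (N s)) Test (lvl (N Test) \<kappa>) \<nu> \<kappa> * A u (scl (N Test) \<nu>))"
  by (subst wvl_expansion[OF assms(1)], rule A_sum_right[OF assms(2)])
    (use own_scl_idx[OF assms(1)] scl_mem in blast)

lemma A_wvl_left:
  assumes "\<mu> \<in> W Trial" "v \<in> V0"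
  shows "A (wvl (N Trial) \<mu>) v = (\<Sum>\<nu>\<in>own_scl t Trial \<mu>.
     q_val (\<lambda>s. mask_q (N s)) Trial (lvl (N Trial) \<mu>) \<nu> \<mu> * A (scl (N Trial) \<nu>) v)"
  by (subst wvl_expansion[OF assms(1)], rule A_sum_left[OF assms(2)])
    (use own_scl_idx[OF assms(1)] scl_mem in blast)

lemma scl_entry_eq: "\<nu>' \<in> scl_idx (N Test) l \<Longrightarrow> \<nu> \<in> scl_idx (N Trial) k \<Longrightarrow>
    scl_entry N A \<nu>' \<nu> = A (scl (N Trial) \<nu>) (scl (N Test) \<nu>')"
  by (auto simp: scl_entry_def scl_all_def)

definition comb :: "'i set \<Rightarrow> ('i \<Rightarrow> real) \<Rightarrow> (nat \<Rightarrow> bool) \<Rightarrow> 'a \<Rightarrow> real"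
  where "comb U x P = (\<Sum>\<mu> | \<mu> \<in> U \<and> P (lvl (N Trial) \<mu>). fscale (x \<mu>) (wvl (N Trial) \<mu>))"

definition low :: "'i set \<Rightarrow> ('i \<Rightarrow> real) \<Rightarrow> nat \<Rightarrow> 'i \<Rightarrow> real"
  where "low U x l \<nu> = scl_coeff (N Trial) l (comb U x (\<lambda>k. k \<le> l)) \<nu>"

definition upp :: "'i set \<Rightarrow> ('i \<Rightarrow> real) \<Rightarrow> nat \<Rightarrow> 'i \<Rightarrow> real"
  where "upp T x l \<nu> = A (comb T x (\<lambda>k. l \<le> k)) (scl (N Test) \<nu>)"

lemma comb_mem: "U \<subseteq> W Trial \<Longrightarrow> comb U x P \<in> U0"
  unfolding comb_def by (intro scl_span_closed(2) scl_span_closed(1) wvl_mem) auto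

lemma comb_span:
  assumes "U \<subseteq> W Trial" "\<And>k. P k \<Longrightarrow> k \<le> l"
  shows "comb U x P \<in> span_lev Trial l"
  unfolding comb_def using assms W_idx[of Trial]
  by (intro fspace.span_sum fspace.span_scale multilevel_system.wvl_in_span[OF sys]) auto

lemma comb_split:
  assumes "U \<subseteq> W Trial" "\<And>k. P k \<longleftrightarrow> P1 k \<or> P2 k" "\<And>k. \<not> (P1 k \<and> P2 k)"
  shows "comb U x P = comb U x P1 + comb U x P2"
proof -
  have "finite U" using assms(1) finite_W finite_subset by blast
  then show ?thesis unfolding comb_def using assms(2,3)
    by (subst sum.union_disjoint[symmetric]) (auto intro!: sum.cong)
qed

lemma A_comb:
  assumes "U \<subseteq> W Trial" "v \<in> V0"
  shows "A (comb U x P) v = (\<Sum>\<mu> | \<mu> \<in> U \<and> P (lvl (N Trial) \<mu>). x \<mu> * A (wvl (N Trial) \<mu>) v)"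
  unfolding comb_def by (rule A_sum_left[OF assms(2)]) (use assms(1) wvl_mem in blast)

lemma near_scl_nonzero:
  assumes "\<kappa> \<in> W s" "\<nu> \<in> near_scl t s \<kappa> s' l"
  shows "scl (N s') \<nu> \<noteq> 0"
proof
  assume "scl (N s') \<nu> = 0"
  then have "supp Q (scl (N s') \<nu>) = {}" by simp
  then show False using assms(2) unfolding near_scl_iff[OF assms(1)] by simp
qed

section \<open>The lower part: scaling coefficients from coarse to fine\<close>

lemma low_idxE:
  assumes "(l, \<nu>) \<in> low_idx t T" "T \<subseteq> W Test"
  obtains \<kappa> where "\<kappa> \<in> T" "\<kappa> \<in> W Test" "lvl (N Test) \<kappa> = l" "\<nu> \<in> near_scl t Test \<kappa> Trial l"
    "\<nu> \<in> scl_idx (N Trial) l" "scl (N Trial) \<nu> \<noteq> 0" "reg Test \<kappa> \<inter> supp Q (scl (N Trial) \<nu>) \<noteq> {}"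
proof -
  obtain \<kappa> where \<kappa>: "\<kappa> \<in> T" "wvl_level t Test \<kappa> = l" "\<nu> \<in> near_scl t Test \<kappa> Trial l"
    using assms(1) by (auto simp: low_idx_def)
  moreover from \<kappa>(1) have "\<kappa> \<in> W Test" using assms(2) by auto
  ultimately show ?thesis using that[of \<kappa>] near_scl_nonzero[of \<kappa> Test \<nu> Trial l]
    by (auto simp: level near_scl_iff)
qed

lemma low_idxI:
  "\<kappa> \<in> T \<Longrightarrow> wvl_level t Test \<kappa> = l \<Longrightarrow> \<nu> \<in> near_scl t Test \<kappa> Trial l \<Longrightarrow> (l, \<nu>) \<in> low_idx t T"
  unfolding low_idx_def by (intro SigmaI UN_I[of \<kappa>]) auto

text \<open>Here the tree structure of the test set enters: \<nu>2 meets S(\<kappa>), hence the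
  neighbourhood of an ancestor of \<kappa> on level l - 1, which puts it into
  \<open>low_idx\<close>. The recursion thus never leaves this index set.\<close>

lemma low_p_idx:
  assumes "tree (N Test) T" "T \<subseteq> W Test" "\<nu>2 \<in> low_p t T l \<nu>"
  shows "1 \<le> l \<and> (l - 1, \<nu>2) \<in> low_idx t T"
proof -
  interpret multilevel_system Q "N Test" by (rule sys)
  obtain \<kappa> where \<kappa>: "\<kappa> \<in> T" "wvl_level t Test \<kappa> = l" "\<nu>2 \<in> near_scl t Test \<kappa> Trial (l - 1)" "1 \<le> l"
    using assms(3) by (auto simp: low_p_def)
  then have "\<kappa> \<in> W Test" using assms(2) by auto
  then have *: "\<nu>2 \<in> scl_idx (N Trial) (l - 1)" "supp Q (scl (N Trial) \<nu>2) \<inter> reg Test \<kappa> \<noteq> {}"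
    using \<kappa>(3) near_scl_iff by auto
  obtain \<kappa>2 where \<kappa>2: "\<kappa>2 \<in> T" "lvl (N Test) \<kappa>2 = l - 1" "supp Q (scl (N Trial) \<nu>2) \<inter> reg Test \<kappa>2 \<noteq> {}"
    using ancestor[OF assms(1) \<kappa>(1) _ *(2), of "l - 1"] \<kappa>(2) level[OF \<open>\<kappa> \<in> W Test\<close>] by auto
  then have "\<kappa>2 \<in> W Test" using assms(2) by auto
  have "\<nu>2 \<in> near_scl t Test \<kappa>2 Trial (l - 1)"
    unfolding near_scl_iff[OF \<open>\<kappa>2 \<in> W Test\<close>] using * \<kappa>2 by (auto simp: Int_commute)
  then show ?thesis using \<kappa>(4) \<kappa>2 level[OF \<open>\<kappa>2 \<in> W Test\<close>] by (auto intro!: low_idxI)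
qed

text \<open>The coarse sum is expanded on level l and every term refined. A function \<phi> of level
  l contributes to \<nu> only if its support contains that of \<nu>; then it meets the same
  S(\<kappa>) as \<nu>, so the tables of \<kappa> list both.\<close>

lemma low_p_sum:
  assumes T: "T \<subseteq> W Test" and U: "U \<subseteq> W Trial" and idx: "(Suc l, \<nu>) \<in> low_idx t T"
  shows "scl_coeff (N Trial) (Suc l) (comb U x (\<lambda>k. k \<le> l)) \<nu> =
    (\<Sum>\<nu>2\<in>low_p t T (Suc l) \<nu>. mask_p (N Trial) (Suc l) \<nu> \<nu>2 * low U x l \<nu>2)"
proof -
  interpret multilevel_system Q "N Trial" by (rule sys)
  obtain \<kappa> where \<kappa>: "\<kappa> \<in> T" "\<kappa> \<in> W Test" "lvl (N Test) \<kappa> = Suc l" "\<nu> \<in> near_scl t Test \<kappa> Trial (Suc l)"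
    and \<nu>: "\<nu> \<in> scl_idx (N Trial) (Suc l)" "scl (N Trial) \<nu> \<noteq> 0" "reg Test \<kappa> \<inter> supp Q (scl (N Trial) \<nu>) \<noteq> {}"
    using low_idxE[OF idx T] by metis
  let ?u = "comb U x (\<lambda>k. k \<le> l)"
  let ?I = "{\<nu>2 \<in> scl_idx (N Trial) l. scl_coeff (N Trial) l ?u \<nu>2 \<noteq> 0}"
  have u: "?u \<in> span_lev Trial l" by (rule comb_span[OF U])
  have "scl_coeff (N Trial) (Suc l) ?u \<nu> = scl_coeff (N Trial) (Suc l)
      (\<Sum>\<nu>2\<in>?I. fscale (low U x l \<nu>2) (scl (N Trial) \<nu>2)) \<nu>"
    unfolding low_def using scl_coeff_expansion(2)[OF u] by simp
  also have "\<dots> = (\<Sum>\<nu>2\<in>?I. low U x l \<nu>2 * scl_coeff (N Trial) (Suc l) (scl (N Trial) \<nu>2) \<nu>)"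
    by (rule scl_coeff_sum) (use scl_in_span scl_span_Suc in blast)
  also have "\<dots> = (\<Sum>\<nu>2\<in>low_p t T (Suc l) \<nu>. mask_p (N Trial) (Suc l) \<nu> \<nu>2 * low U x l \<nu>2)"
  proof (rule sum.mono_neutral_cong)
    show "finite ?I" using scl_coeff_expansion(1)[OF u] .
    have "finite T" using T finite_W finite_subset by blast
    moreover have "low_p t T (Suc l) \<nu> \<subseteq> (\<Union>\<kappa>\<in>T. near_scl t Test \<kappa> Trial l)" by (auto simp: low_p_def)
    ultimately show "finite (low_p t T (Suc l) \<nu>)"
      using T near_scl_card by (meson finite_UN_I finite_subset subsetD)
  next
    fix \<nu>2 assume \<nu>2: "\<nu>2 \<in> low_p t T (Suc l) \<nu> - ?I"
    then obtain \<kappa>2 where "\<kappa>2 \<in> T" "\<nu>2 \<in> near_scl t Test \<kappa>2 Trial l" by (auto simp: low_p_def)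
    then have "\<nu>2 \<in> scl_idx (N Trial) l" using T near_scl_iff by blast
    then show "mask_p (N Trial) (Suc l) \<nu> \<nu>2 * low U x l \<nu>2 = 0" using \<nu>2 by (simp add: low_def)
  next
    fix \<nu>2 assume \<nu>2: "\<nu>2 \<in> ?I - low_p t T (Suc l) \<nu>"
    then have \<nu>2_span: "scl (N Trial) \<nu>2 \<in> span_lev Trial (Suc l)" using scl_in_span scl_span_Suc by blast
    have "scl_coeff (N Trial) (Suc l) (scl (N Trial) \<nu>2) \<nu> = 0"
    proof (rule ccontr)
      assume "scl_coeff (N Trial) (Suc l) (scl (N Trial) \<nu>2) \<nu> \<noteq> 0"
      from scl_coeff_local[OF \<nu>2_span \<nu>(1) this]
      have "\<nu>2 \<in> near_scl t Test \<kappa> Trial l" unfolding near_scl_iff[OF \<kappa>(2)] using \<nu> \<nu>2 \<kappa>(3) by auto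
      then have "\<nu>2 \<in> low_p t T (Suc l) \<nu>" using \<kappa> level[OF \<kappa>(2)] by (auto simp: low_p_def)
      then show False using \<nu>2 by simp
    qed
    then show "low U x l \<nu>2 * scl_coeff (N Trial) (Suc l) (scl (N Trial) \<nu>2) \<nu> = 0" by simp
  next
    fix \<nu>2 assume "\<nu>2 \<in> ?I \<inter> low_p t T (Suc l) \<nu>"
    then show "low U x l \<nu>2 * scl_coeff (N Trial) (Suc l) (scl (N Trial) \<nu>2) \<nu> =
      mask_p (N Trial) (Suc l) \<nu> \<nu>2 * low U x l \<nu>2" using \<nu>(1) by (simp add: mask_p_def)
  qed
  finally show ?thesis .
qed

text \<open>A wavelet with non-zero coefficient at \<nu> has a support containing that of \<nu>, so
  it is near the \<kappa> through which \<nu> entered \<open>low_idx\<close>. On level 0 the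
  coefficient is a Kronecker delta, whence the condition \<nu> = \<mu> in
  \<open>low_q\<close>.\<close>

lemma low_q_sum:
  assumes T: "T \<subseteq> W Test" and U: "U \<subseteq> W Trial" and idx: "(l, \<nu>) \<in> low_idx t T"
  shows "scl_coeff (N Trial) l (comb U x (\<lambda>k. k = l)) \<nu> =
    (\<Sum>\<mu>\<in>low_q t U T l \<nu>. q_val (\<lambda>s. mask_q (N s)) Trial l \<nu> \<mu> * x \<mu>)"
proof -
  interpret multilevel_system Q "N Trial" by (rule sys)
  obtain \<kappa> where \<kappa>: "\<kappa> \<in> T" "\<kappa> \<in> W Test" "lvl (N Test) \<kappa> = l" "\<nu> \<in> near_scl t Test \<kappa> Trial l"
    and \<nu>: "\<nu> \<in> scl_idx (N Trial) l" "scl (N Trial) \<nu> \<noteq> 0" "reg Test \<kappa> \<inter> supp Q (scl (N Trial) \<nu>) \<noteq> {}"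
    using low_idxE[OF idx T] by metis
  let ?I = "{\<mu> \<in> U. lvl (N Trial) \<mu> = l}"
  have finU: "finite U" using U finite_W finite_subset by blast
  have span: "wvl (N Trial) \<mu> \<in> span_lev Trial l" if "\<mu> \<in> ?I" for \<mu>
    using that U W_idx[of Trial] by (intro wvl_in_span) auto
  have q: "q_val (\<lambda>s. mask_q (N s)) Trial l \<nu> \<mu> = scl_coeff (N Trial) l (wvl (N Trial) \<mu>) \<nu>"
    if \<mu>: "\<mu> \<in> ?I" "l = 0 \<longrightarrow> \<nu> = \<mu>" for \<mu>
  proof (cases "l = 0")
    case True
    then have "wvl (N Trial) \<mu> = scl (N Trial) \<nu>" using \<mu> \<nu>(1) level_zero(2)[of \<nu>] by simp
    then show ?thesis using True scl_coeff_scl[OF \<nu>(1) \<nu>(1) \<nu>(2)] by (simp add: q_val_def)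
  next
    case False
    then show ?thesis using \<mu> \<nu>(1) U W_idx[of Trial] by (auto simp: q_val_def mask_q_def wvl_lev_def)
  qed
  have "scl_coeff (N Trial) l (comb U x (\<lambda>k. k = l)) \<nu> =
      (\<Sum>\<mu>\<in>?I. x \<mu> * scl_coeff (N Trial) l (wvl (N Trial) \<mu>) \<nu>)"
    unfolding comb_def by (rule scl_coeff_sum) (rule span)
  also have "\<dots> = (\<Sum>\<mu>\<in>low_q t U T l \<nu>. q_val (\<lambda>s. mask_q (N s)) Trial l \<nu> \<mu> * x \<mu>)"
  proof (rule sum.mono_neutral_cong_right)
    show "finite ?I" using finU by simp
    show sub: "low_q t U T l \<nu> \<subseteq> ?I"
    proof
      fix \<mu> assume "\<mu> \<in> low_q t U T l \<nu>"
      then obtain \<kappa>2 where "\<kappa>2 \<in> T" "\<mu> \<in> near_wvl t Test \<kappa>2 l" "\<mu> \<in> U" by (auto simp: low_q_def)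
      then show "\<mu> \<in> ?I" using T near_wvl_iff[of \<kappa>2 Test \<mu> l] by auto
    qed
    show "x \<mu> * scl_coeff (N Trial) l (wvl (N Trial) \<mu>) \<nu> = q_val (\<lambda>s. mask_q (N s)) Trial l \<nu> \<mu> * x \<mu>"
      if "\<mu> \<in> low_q t U T l \<nu>" for \<mu>
    proof -
      have "l = 0 \<longrightarrow> \<nu> = \<mu>" using that by (simp add: low_q_def)
      then show ?thesis using q[of \<mu>] that sub by auto
    qed
    show "\<forall>\<mu>\<in>?I - low_q t U T l \<nu>. x \<mu> * scl_coeff (N Trial) l (wvl (N Trial) \<mu>) \<nu> = 0"
    proof (rule ballI, rule ccontr)
      fix \<mu> assume \<mu>: "\<mu> \<in> ?I - low_q t U T l \<nu>"
        and "x \<mu> * scl_coeff (N Trial) l (wvl (N Trial) \<mu>) \<nu> \<noteq> 0"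
      then have c: "scl_coeff (N Trial) l (wvl (N Trial) \<mu>) \<nu> \<noteq> 0" by simp
      have "supp Q (scl (N Trial) \<nu>) \<subseteq> supp Q (wvl (N Trial) \<mu>)"
        by (rule scl_coeff_local[OF span \<nu>(1) c]) (use \<mu> in simp)
      then have "\<mu> \<in> near_wvl t Test \<kappa> l" using \<mu> \<nu>(3) \<kappa>(3) U unfolding near_wvl_iff[OF \<kappa>(2)] by auto
      moreover have "\<nu> = \<mu>" if "l = 0"
      proof -
        have "\<mu> \<in> scl_idx (N Trial) l" using \<mu> U W_idx[of Trial] that level_zero(1) by (auto simp: wvl_lev_def)
        then have "scl_coeff (N Trial) l (scl (N Trial) \<mu>) \<nu> \<noteq> 0" using c level_zero(2)[of \<mu>] that by simp
        then show ?thesis using scl_coeff_scl[OF \<nu>(1) \<open>\<mu> \<in> scl_idx (N Trial) l\<close> \<nu>(2)] by (simp split: if_splits)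
      qed
      ultimately have "\<mu> \<in> low_q t U T l \<nu>" using \<mu> \<kappa> level[OF \<kappa>(2)] by (auto simp: low_q_def)
      then show False using \<mu> by simp
    qed
  qed
  finally show ?thesis .
qed

lemma low_rec:
  assumes T: "T \<subseteq> W Test" and U: "U \<subseteq> W Trial" and idx: "(l, \<nu>) \<in> low_idx t T"
  shows "low U x l \<nu> = (\<Sum>\<nu>2\<in>low_p t T l \<nu>. mask_p (N Trial) l \<nu> \<nu>2 * low U x (l - 1) \<nu>2) +
    (\<Sum>\<mu>\<in>low_q t U T l \<nu>. q_val (\<lambda>s. mask_q (N s)) Trial l \<nu> \<mu> * x \<mu>)"
proof (cases l)
  case 0
  \<comment> \<open>Nothing is coarser than level 0: \<open>low_p\<close> is empty there, so the
    first sum of the claim is 0 although l - 1 = 0.\<close>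
  have "comb U x (\<lambda>k. k \<le> 0) = comb U x (\<lambda>k. k = 0)" by (simp add: comb_def)
  moreover have "low_p t T 0 \<nu> = {}" by (simp add: low_p_def)
  ultimately show ?thesis using low_q_sum[OF T U idx] 0 by (simp add: low_def)
next
  case (Suc k)
  have "low U x l \<nu> = scl_coeff (N Trial) l (comb U x (\<lambda>j. j \<le> k) + comb U x (\<lambda>j. j = l)) \<nu>"
    unfolding low_def by (subst comb_split[OF U]) (auto simp: Suc)
  also have "\<dots> = scl_coeff (N Trial) l (comb U x (\<lambda>j. j \<le> k)) \<nu> + scl_coeff (N Trial) l (comb U x (\<lambda>j. j = l)) \<nu>"
    by (rule multilevel_system.scl_coeff_add[OF sys]; rule comb_span[OF U]) (auto simp: Suc)
  finally show ?thesis using low_p_sum[OF T U, of k \<nu>] low_q_sum[OF T U idx] idx by (simp add: Suc)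
qed

text \<open>Every \<nu>' that enters the expansion of the test wavelet is supported in S(\<kappa>),
  so locality of A discards all trial scaling functions whose supports miss S(\<kappa>).\<close>

lemma low_out:
  assumes \<kappa>: "\<kappa> \<in> W Test" and U: "U \<subseteq> W Trial" and l: "l = wvl_level t Test \<kappa>"
  shows "(\<Sum>\<mu> | \<mu> \<in> U \<and> wvl_level t Trial \<mu> \<le> l. op_matrix (N Trial) (N Test) A \<kappa> \<mu> * x \<mu>) =
    (\<Sum>(\<nu>', \<nu>)\<in>low_o t \<kappa>. q_val (\<lambda>s. mask_q (N s)) Test l \<nu>' \<kappa> * scl_entry N A \<nu>' \<nu> * low U x l \<nu>)"
proof -
  interpret multilevel_system Q "N Trial" by (rule sys)
  note l' = l[unfolded level[OF \<kappa>]]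
  let ?u = "comb U x (\<lambda>k. k \<le> l)"
  let ?I = "{\<nu> \<in> scl_idx (N Trial) l. scl_coeff (N Trial) l ?u \<nu> \<noteq> 0}"
  let ?q = "\<lambda>\<nu>'. q_val (\<lambda>s. mask_q (N s)) Test l \<nu>' \<kappa>"
  let ?near = "near_scl t Test \<kappa> Trial l"
  have u: "?u \<in> span_lev Trial l" by (rule comb_span[OF U])
  have "(\<Sum>\<mu> | \<mu> \<in> U \<and> wvl_level t Trial \<mu> \<le> l. op_matrix (N Trial) (N Test) A \<kappa> \<mu> * x \<mu>) =
      A ?u (wvl (N Test) \<kappa>)"
    unfolding A_comb[OF U wvl_mem[OF \<kappa>]] using level U
    by (intro sum.cong) (auto simp: op_matrix_def subset_iff)
  also have "\<dots> = (\<Sum>\<nu>'\<in>own_scl t Test \<kappa>. ?q \<nu>' * A ?u (scl (N Test) \<nu>'))"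
    unfolding l' by (rule A_wvl_right[OF \<kappa> comb_mem[OF U]])
  also have "\<dots> = (\<Sum>\<nu>'\<in>own_scl t Test \<kappa>. \<Sum>\<nu>\<in>?near. ?q \<nu>' * scl_entry N A \<nu>' \<nu> * low U x l \<nu>)"
  proof (rule sum.cong[OF refl])
    fix \<nu>' assume \<nu>': "\<nu>' \<in> own_scl t Test \<kappa>"
    then have \<nu>'l: "\<nu>' \<in> scl_idx (N Test) l" using own_scl_idx[OF \<kappa>] l' by simp
    show "?q \<nu>' * A ?u (scl (N Test) \<nu>') = (\<Sum>\<nu>\<in>?near. ?q \<nu>' * scl_entry N A \<nu>' \<nu> * low U x l \<nu>)"
    proof (cases "?q \<nu>' = 0")
      case False
      have sub: "supp Q (scl (N Test) \<nu>') \<subseteq> reg Test \<kappa>"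
        using own_scl_supp[OF \<kappa> \<nu>'] False supp_region[OF \<kappa>] l' by blast
      have "A ?u (scl (N Test) \<nu>') = A (\<Sum>\<nu>\<in>?I. fscale (low U x l \<nu>) (scl (N Trial) \<nu>)) (scl (N Test) \<nu>')"
        unfolding low_def using scl_coeff_expansion(2)[OF u] by simp
      also have "\<dots> = (\<Sum>\<nu>\<in>?I. low U x l \<nu> * A (scl (N Trial) \<nu>) (scl (N Test) \<nu>'))"
        by (rule A_sum_left[OF scl_mem[OF \<nu>'l]]) (use scl_mem in blast)
      also have "\<dots> = (\<Sum>\<nu>\<in>?near. low U x l \<nu> * A (scl (N Trial) \<nu>) (scl (N Test) \<nu>'))"
      proof (rule sum.mono_neutral_cong)
        show "finite ?I" using scl_coeff_expansion(1)[OF u] .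
        show "finite ?near" using near_scl_card[OF \<kappa>] by simp
        show "low U x l \<nu> * A (scl (N Trial) \<nu>) (scl (N Test) \<nu>') = 0" if "\<nu> \<in> ?near - ?I" for \<nu>
          using that by (auto simp: low_def near_scl_iff[OF \<kappa>])
        show "low U x l \<nu> * A (scl (N Trial) \<nu>) (scl (N Test) \<nu>') = 0" if "\<nu> \<in> ?I - ?near" for \<nu>
        proof -
          have \<nu>: "\<nu> \<in> scl_idx (N Trial) l" "\<nu> \<notin> ?near" using that by auto
          then have "reg Test \<kappa> \<inter> supp Q (scl (N Trial) \<nu>) = {}" unfolding near_scl_iff[OF \<kappa>] using l' by auto
          then have "A (scl (N Trial) \<nu>) (scl (N Test) \<nu>') = 0"
            using sub scl_outside[OF \<nu>(1)] by (intro A_disjoint scl_mem[OF \<nu>(1)] scl_mem[OF \<nu>'l]) auto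
          then show ?thesis by simp
        qed
      qed simp
      also have "\<dots> = (\<Sum>\<nu>\<in>?near. scl_entry N A \<nu>' \<nu> * low U x l \<nu>)"
        by (intro sum.cong refl) (auto simp: near_scl_iff[OF \<kappa>] scl_entry_eq[OF \<nu>'l])
      finally show ?thesis by (simp add: sum_distrib_left mult.assoc)
    qed simp
  qed
  also have "\<dots> = (\<Sum>(\<nu>', \<nu>)\<in>low_o t \<kappa>. ?q \<nu>' * scl_entry N A \<nu>' \<nu> * low U x l \<nu>)"
    unfolding low_o_def l[symmetric] by (rule sum.cartesian_product)
  finally show ?thesis .
qed

section \<open>The upper part: functional values from fine to coarse\<close>

lemma A_wvl_region:
  assumes "\<mu> \<in> W Trial" "v \<in> V0" "A (wvl (N Trial) \<mu>) v \<noteq> 0"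
  shows "supp Q v \<inter> reg Trial \<mu> \<noteq> {}"
proof
  assume "supp Q v \<inter> reg Trial \<mu> = {}"
  then have "supp Q (wvl (N Trial) \<mu>) \<inter> supp Q v = {}" using supp_region[OF assms(1)] by blast
  then show False using A_disjoint[OF wvl_mem[OF assms(1)] assms(2) wvl_outside[OF assms(1)]] assms(3) by simp
qed

text \<open>Some \<mu> of level at least l interacts with \<nu>, so S(\<mu>) meets the support of
  \<nu>; being a tree, T contains an ancestor of \<mu> on level l with the same property.\<close>

lemma upp_nonzero:
  assumes T: "tree (N Trial) T" "T \<subseteq> W Trial" and \<nu>: "\<nu> \<in> scl_idx (N Test) l" and "upp T x l \<nu> \<noteq> 0"
  shows "\<exists>\<mu>\<in>T. lvl (N Trial) \<mu> = l \<and> supp Q (scl (N Test) \<nu>) \<inter> reg Trial \<mu> \<noteq> {}"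
proof -
  have "(\<Sum>\<mu> | \<mu> \<in> T \<and> l \<le> lvl (N Trial) \<mu>. x \<mu> * A (wvl (N Trial) \<mu>) (scl (N Test) \<nu>)) \<noteq> 0"
    using assms(4) by (simp add: upp_def A_comb[OF T(2) scl_mem[OF \<nu>]])
  then obtain \<mu> where \<mu>: "\<mu> \<in> T" "l \<le> lvl (N Trial) \<mu>" "A (wvl (N Trial) \<mu>) (scl (N Test) \<nu>) \<noteq> 0"
    by (metis (mono_tags, lifting) mem_Collect_eq mult_zero_right sum.neutral)
  have "supp Q (scl (N Test) \<nu>) \<inter> reg Trial \<mu> \<noteq> {}"
    using \<mu> T(2) by (intro A_wvl_region scl_mem[OF \<nu>]) auto
  from multilevel_system.ancestor[OF sys T(1) \<mu>(1,2) this] show ?thesis .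
qed

lemma upp_idx_iff:
  assumes "T \<subseteq> W Trial"
  shows "(l, \<nu>) \<in> upp_idx t T \<longleftrightarrow> \<nu> \<in> scl_idx (N Test) l \<and>
    (\<exists>\<mu>\<in>T. lvl (N Trial) \<mu> = l \<and> supp Q (scl (N Test) \<nu>) \<inter> reg Trial \<mu> \<noteq> {})"
proof
  assume "(l, \<nu>) \<in> upp_idx t T"
  then obtain \<mu> where \<mu>: "\<mu> \<in> T" "wvl_level t Trial \<mu> = l" "\<nu> \<in> near_scl t Trial \<mu> Test l"
    by (auto simp: upp_idx_def)
  then have "\<mu> \<in> W Trial" using assms by auto
  then show "\<nu> \<in> scl_idx (N Test) l \<and>
    (\<exists>\<mu>\<in>T. lvl (N Trial) \<mu> = l \<and> supp Q (scl (N Test) \<nu>) \<inter> reg Trial \<mu> \<noteq> {})"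
    using \<mu> level near_scl_iff by (auto simp: Int_commute)
next
  assume *: "\<nu> \<in> scl_idx (N Test) l \<and>
    (\<exists>\<mu>\<in>T. lvl (N Trial) \<mu> = l \<and> supp Q (scl (N Test) \<nu>) \<inter> reg Trial \<mu> \<noteq> {})"
  then obtain \<mu> where \<mu>: "\<mu> \<in> T" "lvl (N Trial) \<mu> = l" "supp Q (scl (N Test) \<nu>) \<inter> reg Trial \<mu> \<noteq> {}" by auto
  then have "\<mu> \<in> W Trial" using assms by auto
  then have "\<nu> \<in> near_scl t Trial \<mu> Test l" "wvl_level t Trial \<mu> = l"
    using * \<mu> level near_scl_iff by (auto simp: Int_commute)
  then show "(l, \<nu>) \<in> upp_idx t T" using \<mu>(1) by (auto simp: upp_idx_def)
qed

text \<open>The test function is refined to the next level. The set J is left free because the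
  recursion and the output list the refining functions differently; it only has to contain those
  that lie in \<open>upp_idx\<close> and are supported in the refined one.\<close>

lemma upp_expansion:
  assumes T: "tree (N Trial) T" "T \<subseteq> W Trial" and \<nu>: "\<nu> \<in> scl_idx (N Test) l" and J: "finite J"
    and J_sub: "J \<subseteq> scl_idx (N Test) (Suc l)"
    and J_sup: "\<And>\<nu>2. (Suc l, \<nu>2) \<in> upp_idx t T \<Longrightarrow> supp Q (scl (N Test) \<nu>2) \<subseteq> supp Q (scl (N Test) \<nu>) \<Longrightarrow>
      scl (N Test) \<nu>2 \<noteq> 0 \<Longrightarrow> \<nu>2 \<in> J"
  shows "A (comb T x (\<lambda>k. Suc l \<le> k)) (scl (N Test) \<nu>) =
    (\<Sum>\<nu>2\<in>J. mask_p (N Test) (Suc l) \<nu>2 \<nu> * upp T x (Suc l) \<nu>2)"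
proof -
  interpret multilevel_system Q "N Test" by (rule sys)
  let ?u = "comb T x (\<lambda>k. Suc l \<le> k)"
  let ?c = "scl_coeff (N Test) (Suc l) (scl (N Test) \<nu>)"
  let ?I = "{\<nu>2 \<in> scl_idx (N Test) (Suc l). ?c \<nu>2 \<noteq> 0}"
  have f: "scl (N Test) \<nu> \<in> span_lev Test (Suc l)" using scl_in_span[OF \<nu>] scl_span_Suc by blast
  have "A ?u (scl (N Test) \<nu>) = A ?u (\<Sum>\<nu>2\<in>?I. fscale (?c \<nu>2) (scl (N Test) \<nu>2))"
    using scl_coeff_expansion(2)[OF f] by simp
  also have "\<dots> = (\<Sum>\<nu>2\<in>?I. ?c \<nu>2 * A ?u (scl (N Test) \<nu>2))"
    by (rule A_sum_right[OF comb_mem[OF T(2)]]) (use scl_mem in blast)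
  also have "\<dots> = (\<Sum>\<nu>2\<in>J. mask_p (N Test) (Suc l) \<nu>2 \<nu> * upp T x (Suc l) \<nu>2)"
  proof (rule sum.mono_neutral_cong)
    show "finite ?I" using scl_coeff_expansion(1)[OF f] .
    show "finite J" by fact
    show "mask_p (N Test) (Suc l) \<nu>2 \<nu> * upp T x (Suc l) \<nu>2 = 0" if "\<nu>2 \<in> J - ?I" for \<nu>2
      using that J_sub by (auto simp: mask_p_def)
    show "?c \<nu>2 * A ?u (scl (N Test) \<nu>2) = mask_p (N Test) (Suc l) \<nu>2 \<nu> * upp T x (Suc l) \<nu>2"
      if "\<nu>2 \<in> ?I \<inter> J" for \<nu>2
      using that \<nu> by (simp add: mask_p_def upp_def)
    show "?c \<nu>2 * A ?u (scl (N Test) \<nu>2) = 0" if "\<nu>2 \<in> ?I - J" for \<nu>2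
    proof (rule ccontr)
      assume *: "?c \<nu>2 * A ?u (scl (N Test) \<nu>2) \<noteq> 0"
      have \<nu>2: "\<nu>2 \<in> scl_idx (N Test) (Suc l)" "?c \<nu>2 \<noteq> 0" "upp T x (Suc l) \<nu>2 \<noteq> 0"
        using that * by (auto simp: upp_def)
      have "(Suc l, \<nu>2) \<in> upp_idx t T"
        unfolding upp_idx_iff[OF T(2)] using upp_nonzero[OF T \<nu>2(1,3)] \<nu>2(1) by simp
      then have "\<nu>2 \<in> J" by (rule J_sup[OF _ scl_coeff_local[OF f \<nu>2(1,2)] scl_coeff_nonzero[OF \<nu>2(2)]])
      then show False using that by simp
    qed
  qed
  finally show ?thesis .
qed

text \<open>Wavelets finer than l are handled by refining the test function, those of level l by
  expanding the wavelets themselves into scaling functions.\<close>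

lemma upp_rec:
  assumes T: "tree (N Trial) T" "T \<subseteq> W Trial" and idx: "(l, \<nu>') \<in> upp_idx t T"
  shows "upp T x l \<nu>' = (\<Sum>\<nu>2\<in>upp_p t T l \<nu>'. mask_p (N Test) (Suc l) \<nu>2 \<nu>' * upp T x (Suc l) \<nu>2) +
    (\<Sum>(\<mu>, \<nu>)\<in>upp_q t T l \<nu>'. q_val (\<lambda>s. mask_q (N s)) Trial l \<nu> \<mu> * scl_entry N A \<nu>' \<nu> * x \<mu>)"
proof -
  have finT: "finite T" using T by (simp add: tree_def)
  have \<nu>': "\<nu>' \<in> scl_idx (N Test) l" using idx by (simp add: upp_idx_iff[OF T(2)])
  note v = scl_mem[OF \<nu>']
  have "upp T x l \<nu>' = A (comb T x (\<lambda>k. Suc l \<le> k) + comb T x (\<lambda>k. k = l)) (scl (N Test) \<nu>')"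
    unfolding upp_def by (subst comb_split[OF T(2)]) auto
  also have "\<dots> = A (comb T x (\<lambda>k. Suc l \<le> k)) (scl (N Test) \<nu>') + A (comb T x (\<lambda>k. k = l)) (scl (N Test) \<nu>')"
    by (rule A_add_left[OF comb_mem[OF T(2)] comb_mem[OF T(2)] v])
  also have "A (comb T x (\<lambda>k. Suc l \<le> k)) (scl (N Test) \<nu>') =
    (\<Sum>\<nu>2\<in>upp_p t T l \<nu>'. mask_p (N Test) (Suc l) \<nu>2 \<nu>' * upp T x (Suc l) \<nu>2)"
  proof (rule upp_expansion[OF T \<nu>'])
    have "upp_p t T l \<nu>' \<subseteq> (\<Union>\<mu>\<in>T. near_scl t Trial \<mu> Test (Suc l))" by (auto simp: upp_p_def)
    then show "finite (upp_p t T l \<nu>')"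
      using finT T(2) near_scl_card by (meson finite_UN_I finite_subset subsetD)
    show "upp_p t T l \<nu>' \<subseteq> scl_idx (N Test) (Suc l)"
      using T(2) near_scl_iff by (fastforce simp: upp_p_def)
    show "\<nu>2 \<in> upp_p t T l \<nu>'" if idx2: "(Suc l, \<nu>2) \<in> upp_idx t T"
      and sub: "supp Q (scl (N Test) \<nu>2) \<subseteq> supp Q (scl (N Test) \<nu>')" for \<nu>2
    proof -
      obtain \<mu> where \<mu>: "\<mu> \<in> T" "lvl (N Trial) \<mu> = Suc l" "supp Q (scl (N Test) \<nu>2) \<inter> reg Trial \<mu> \<noteq> {}"
        "\<nu>2 \<in> scl_idx (N Test) (Suc l)"
        using idx2 by (auto simp: upp_idx_iff[OF T(2)])
      then have \<mu>W: "\<mu> \<in> W Trial" using T(2) by auto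
      \<comment> \<open>S(\<mu>) meets the support of \<nu>2, which is part of the support of
        \<nu>'; one \<mu> thus serves both indices, as \<open>upp_p\<close> demands.\<close>
      have "\<nu>2 \<in> near_scl t Trial \<mu> Test (Suc l)" "\<nu>' \<in> near_scl t Trial \<mu> Test l"
        unfolding near_scl_iff[OF \<mu>W] using \<mu> \<nu>' sub by auto
      then show ?thesis using \<mu> level[OF \<mu>W] by (auto simp: upp_p_def)
    qed
  qed
  also have "A (comb T x (\<lambda>k. k = l)) (scl (N Test) \<nu>') =
    (\<Sum>\<mu> | \<mu> \<in> T \<and> lvl (N Trial) \<mu> = l. x \<mu> * A (wvl (N Trial) \<mu>) (scl (N Test) \<nu>'))"
    by (rule A_comb[OF T(2) v])
  also have "\<dots> = (\<Sum>\<mu> | \<mu> \<in> T \<and> wvl_level t Trial \<mu> = l \<and> \<nu>' \<in> near_scl t Trial \<mu> Test l.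
      \<Sum>\<nu>\<in>own_scl t Trial \<mu>. q_val (\<lambda>s. mask_q (N s)) Trial l \<nu> \<mu> * scl_entry N A \<nu>' \<nu> * x \<mu>)"
  proof (rule sum.mono_neutral_cong_right)
    show "{\<mu> \<in> T. wvl_level t Trial \<mu> = l \<and> \<nu>' \<in> near_scl t Trial \<mu> Test l} \<subseteq> {\<mu> \<in> T. lvl (N Trial) \<mu> = l}"
      using T(2) level by force
    show "\<forall>\<mu>\<in>{\<mu> \<in> T. lvl (N Trial) \<mu> = l} -
        {\<mu> \<in> T. wvl_level t Trial \<mu> = l \<and> \<nu>' \<in> near_scl t Trial \<mu> Test l}.
        x \<mu> * A (wvl (N Trial) \<mu>) (scl (N Test) \<nu>') = 0"
    proof (rule ballI, rule ccontr)
      fix \<mu> assume \<mu>: "\<mu> \<in> {\<mu> \<in> T. lvl (N Trial) \<mu> = l} -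
        {\<mu> \<in> T. wvl_level t Trial \<mu> = l \<and> \<nu>' \<in> near_scl t Trial \<mu> Test l}"
        and *: "x \<mu> * A (wvl (N Trial) \<mu>) (scl (N Test) \<nu>') \<noteq> 0"
      then have \<mu>W: "\<mu> \<in> W Trial" using T(2) by auto
      have "supp Q (scl (N Test) \<nu>') \<inter> reg Trial \<mu> \<noteq> {}" using * by (intro A_wvl_region[OF \<mu>W v]) auto
      then have "\<nu>' \<in> near_scl t Trial \<mu> Test l" unfolding near_scl_iff[OF \<mu>W] using \<mu> \<nu>' by auto
      then show False using \<mu> level[OF \<mu>W] by auto
    qed
    fix \<mu> assume "\<mu> \<in> {\<mu> \<in> T. wvl_level t Trial \<mu> = l \<and> \<nu>' \<in> near_scl t Trial \<mu> Test l}"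
    then have \<mu>: "\<mu> \<in> W Trial" "lvl (N Trial) \<mu> = l" using T(2) level by auto
    show "x \<mu> * A (wvl (N Trial) \<mu>) (scl (N Test) \<nu>') =
      (\<Sum>\<nu>\<in>own_scl t Trial \<mu>. q_val (\<lambda>s. mask_q (N s)) Trial l \<nu> \<mu> * scl_entry N A \<nu>' \<nu> * x \<mu>)"
      unfolding A_wvl_left[OF \<mu>(1) v] sum_distrib_left \<mu>(2)
      by (intro sum.cong refl) (simp add: scl_entry_eq[OF \<nu>' own_scl_idx[OF \<mu>(1)]])
  qed (use finT in simp)
  also have "\<dots> = (\<Sum>(\<mu>, \<nu>)\<in>upp_q t T l \<nu>'. q_val (\<lambda>s. mask_q (N s)) Trial l \<nu> \<mu> * scl_entry N A \<nu>' \<nu> * x \<mu>)"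
    unfolding upp_q_def using finT T(2) finite_own_scl by (intro sum.Sigma) auto
  finally show ?thesis .
qed

lemma upp_out:
  assumes \<kappa>: "\<kappa> \<in> W Test" and T: "tree (N Trial) T" "T \<subseteq> W Trial" and l: "l = wvl_level t Test \<kappa>"
  shows "(\<Sum>\<mu> | \<mu> \<in> T \<and> l < wvl_level t Trial \<mu>. op_matrix (N Trial) (N Test) A \<kappa> \<mu> * x \<mu>) =
    (\<Sum>(\<nu>', \<nu>2)\<in>upp_o t T \<kappa>. q_val (\<lambda>s. mask_q (N s)) Test l \<nu>' \<kappa> *
       mask_p (N Test) (Suc l) \<nu>2 \<nu>' * upp T x (Suc l) \<nu>2)"
proof -
  note l' = l[unfolded level[OF \<kappa>]]
  let ?u = "comb T x (\<lambda>k. Suc l \<le> k)"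
  let ?q = "\<lambda>\<nu>'. q_val (\<lambda>s. mask_q (N s)) Test l \<nu>' \<kappa>"
  let ?J = "{\<nu> \<in> near_scl t Test \<kappa> Test (Suc l). (Suc l, \<nu>) \<in> upp_idx t T}"
  have "(\<Sum>\<mu> | \<mu> \<in> T \<and> l < wvl_level t Trial \<mu>. op_matrix (N Trial) (N Test) A \<kappa> \<mu> * x \<mu>) =
      A ?u (wvl (N Test) \<kappa>)"
    unfolding A_comb[OF T(2) wvl_mem[OF \<kappa>]] using level T(2)
    by (intro sum.cong) (auto simp: op_matrix_def subset_iff)
  also have "\<dots> = (\<Sum>\<nu>'\<in>own_scl t Test \<kappa>. ?q \<nu>' * A ?u (scl (N Test) \<nu>'))"
    unfolding l' by (rule A_wvl_right[OF \<kappa> comb_mem[OF T(2)]])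
  also have "\<dots> = (\<Sum>\<nu>'\<in>own_scl t Test \<kappa>. \<Sum>\<nu>2\<in>?J. ?q \<nu>' *
       mask_p (N Test) (Suc l) \<nu>2 \<nu>' * upp T x (Suc l) \<nu>2)"
  proof (rule sum.cong[OF refl])
    fix \<nu>' assume \<nu>': "\<nu>' \<in> own_scl t Test \<kappa>"
    then have \<nu>'l: "\<nu>' \<in> scl_idx (N Test) l" using own_scl_idx[OF \<kappa>] l' by simp
    show "?q \<nu>' * A ?u (scl (N Test) \<nu>') =
        (\<Sum>\<nu>2\<in>?J. ?q \<nu>' * mask_p (N Test) (Suc l) \<nu>2 \<nu>' * upp T x (Suc l) \<nu>2)"
    proof (cases "?q \<nu>' = 0")
      case False
      have sub: "supp Q (scl (N Test) \<nu>') \<subseteq> reg Test \<kappa>"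
        using own_scl_supp[OF \<kappa> \<nu>'] False supp_region[OF \<kappa>] l' by blast
      have "A ?u (scl (N Test) \<nu>') = (\<Sum>\<nu>2\<in>?J. mask_p (N Test) (Suc l) \<nu>2 \<nu>' * upp T x (Suc l) \<nu>2)"
      proof (rule upp_expansion[OF T \<nu>'l])
        show "finite ?J" using near_scl_card[OF \<kappa>] by simp
        show "?J \<subseteq> scl_idx (N Test) (Suc l)" using near_scl_iff[OF \<kappa>] by auto
        show "\<nu>2 \<in> ?J" if "(Suc l, \<nu>2) \<in> upp_idx t T"
          "supp Q (scl (N Test) \<nu>2) \<subseteq> supp Q (scl (N Test) \<nu>')" "scl (N Test) \<nu>2 \<noteq> 0" for \<nu>2
        proof -
          have \<nu>2: "\<nu>2 \<in> scl_idx (N Test) (Suc l)" using that(1) by (simp add: upp_idx_iff[OF T(2)])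
          then show ?thesis using that sub l' scl_supp_nonempty[OF \<nu>2 that(3)]
            unfolding near_scl_iff[OF \<kappa>] by auto
        qed
      qed
      then show ?thesis by (simp add: sum_distrib_left mult.assoc)
    qed simp
  qed
  also have "\<dots> = (\<Sum>(\<nu>', \<nu>2)\<in>upp_o t T \<kappa>. ?q \<nu>' * mask_p (N Test) (Suc l) \<nu>2 \<nu>' * upp T x (Suc l) \<nu>2)"
    unfolding upp_o_def l[symmetric] by (rule sum.cartesian_product)
  finally show ?thesis .
qed

text \<open>An interacting trial wavelet on any finer level has an ancestor in T exactly one level
  above that of \<kappa> whose neighbourhood meets the support of \<kappa>. This is what makes
  \<open>mid2\<close> a sufficient index set.\<close>

lemma upp_zero:
  assumes \<kappa>: "\<kappa> \<in> W Test" and T: "tree (N Trial) T" "T \<subseteq> W Trial" and \<mu>: "\<mu> \<in> T"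
    and l: "l = wvl_level t Test \<kappa>" "l < wvl_level t Trial \<mu>"
    and nz: "op_matrix (N Trial) (N Test) A \<kappa> \<mu> \<noteq> 0"
  shows "\<exists>\<mu>2\<in>T. wvl_level t Trial \<mu>2 = Suc l \<and> \<kappa> \<in> near_wvl t Trial \<mu>2 l"
proof -
  have \<mu>W: "\<mu> \<in> W Trial" using \<mu> T(2) by auto
  have "supp Q (wvl (N Test) \<kappa>) \<inter> reg Trial \<mu> \<noteq> {}"
    using nz by (intro A_wvl_region[OF \<mu>W wvl_mem[OF \<kappa>]]) (simp add: op_matrix_def)
  from multilevel_system.ancestor[OF sys T(1) \<mu> _ this, of "Suc l"]
  obtain \<mu>2 where \<mu>2: "\<mu>2 \<in> T" "lvl (N Trial) \<mu>2 = Suc l" "supp Q (wvl (N Test) \<kappa>) \<inter> reg Trial \<mu>2 \<noteq> {}"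
    using l level[OF \<mu>W] by auto
  have \<mu>2W: "\<mu>2 \<in> W Trial" using \<mu>2 T(2) by auto
  have "\<kappa> \<in> near_wvl t Trial \<mu>2 l"
    unfolding near_wvl_iff[OF \<mu>2W] using \<mu>2 \<kappa> l level[OF \<kappa>] by auto
  then show ?thesis using \<mu>2 level[OF \<mu>2W] by auto
qed

lemma axis: "axis t W (\<lambda>s. tree (N s)) (\<lambda>s. mask_p (N s)) (\<lambda>s. mask_q (N s)) (scl_entry N A)
    (op_matrix (N Trial) (N Test) A) low upp K"
proof (unfold_locales, goal_cases)
  case (1 \<T> s)
  have T: "tree (N s) T" "T \<subseteq> W s" if "T \<in> \<T>" for T using 1[OF that] by auto
  have "\<Union>\<T> \<subseteq> W s" using T(2) by (rule Union_least)
  then have "finite (\<Union>\<T>)" by (rule finite_subset[OF _ finite_W])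
  moreover have "\<Union>\<T> \<subseteq> wvl_idx (N s)" using \<open>\<Union>\<T> \<subseteq> W s\<close> W_idx by (rule subset_trans)
  moreover have "parents (N s) \<kappa> \<subseteq> \<Union>\<T>" if "\<kappa> \<in> \<Union>\<T>" for \<kappa>
  proof -
    from that obtain T where "T \<in> \<T>" "\<kappa> \<in> T" by (rule UnionE)
    then have "parents (N s) \<kappa> \<subseteq> T" using T(1)[of T] by (simp add: tree_def)
    then show ?thesis using \<open>T \<in> \<T>\<close> by (metis Union_upper subset_trans)
  qed
  ultimately show ?case by (simp add: tree_def)
next
  case 2 then show ?case by (rule near_scl_card)
next
  case 3 then show ?case by (rule near_wvl_card)
next
  case (4 \<kappa> s \<mu> l)
  then show ?case using near_wvl_iff[OF 4(1)] level by auto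
next
  case 5 then show ?case by (intro low_p_idx)
next
  case 6 then show ?case by (intro low_rec)
next
  case 7 then show ?case by (intro low_out)
next
  case 8 then show ?case by (intro upp_rec)
next
  case 9 then show ?case by (intro upp_out)
next
  case (10 \<kappa> T \<mu> l) then show ?case by (intro upp_zero)
qed

end

section \<open>The circuit for two directions\<close>

text \<open>In the order of their evaluation, the stages compute
  \<open>S1\<close>: \<open>Id \<otimes> A\<^sub>1\<close> on the index set \<open>mid1\<close>, from the input,
  \<open>S2\<close>: the lower part of \<open>A\<^sub>0\<close>, tensorized with \<open>Id\<close>, from the result of \<open>S1\<close>,
  \<open>S3\<close>: the upper part of \<open>A\<^sub>0\<close>, tensorized with \<open>Id\<close>, on the index set \<open>mid2\<close>, from the input,
  \<open>S4\<close>: \<open>Id \<otimes> A\<^sub>1\<close> from the result of \<open>S3\<close>.\<close>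

datatype stage = S1 | S2 | S3 | S4

text \<open>The second argument of \<open>Low\<close> and \<open>Upp\<close> is the index that is fixed in the other direction.\<close>

datatype 'i node =
    Inp 'i 'i
  | Low stage 'i nat 'i
  | Upp stage 'i nat 'i
  | Mid1 'i 'i
  | Mid2 'i 'i
  | Out 'i 'i

fun stage_axis :: "stage \<Rightarrow> axis" where
  "stage_axis S1 = Ax1"
| "stage_axis S2 = Ax0"
| "stage_axis S3 = Ax0"
| "stage_axis S4 = Ax1"

fun source :: "stage \<Rightarrow> 'i \<Rightarrow> 'i \<Rightarrow> 'i node" where
  "source S1 z \<mu> = Inp z \<mu>"
| "source S2 z \<mu> = Mid1 \<mu> z"
| "source S3 z \<mu> = Inp \<mu> z"
| "source S4 z \<mu> = Mid2 z \<mu>"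

text \<open>The entries that stage \<open>S2\<close> reads: for a test index \<kappa>0, the
  recursion takes in wavelets of the level of \<kappa>0 in its vicinity.\<close>

definition mid1 :: "(axis \<Rightarrow> 'i tables) \<Rightarrow> (side \<Rightarrow> ('i \<times> 'i) set) \<Rightarrow> ('i \<times> 'i) set"
  where "mid1 t L = {(\<mu>0, \<kappa>1). \<exists>\<kappa>0. (\<kappa>0, \<kappa>1) \<in> L Test \<and>
    \<mu>0 \<in> near_wvl (t Ax0) Test \<kappa>0 (wvl_level (t Ax0) Test \<kappa>0)}"

text \<open>Contains the positions at which the output of \<open>S3\<close> can be non-zero. For
  \<mu>0 of level 0 the truncated subtraction adds indices of level 0, which enlarges the set within
  the same bound.\<close>

definition mid2 :: "(axis \<Rightarrow> 'i tables) \<Rightarrow> (side \<Rightarrow> ('i \<times> 'i) set) \<Rightarrow> ('i \<times> 'i) set"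
  where "mid2 t L = {(\<kappa>0, \<mu>1). \<exists>\<mu>0. (\<mu>0, \<mu>1) \<in> L Trial \<and>
    \<kappa>0 \<in> near_wvl (t Ax0) Trial \<mu>0 (wvl_level (t Ax0) Trial \<mu>0 - 1)}"

text \<open>The index that stays fixed is put first, hence the converse for the stage that acts in
  direction 0. The set is empty for \<open>S3\<close>, which computes an upper part only.\<close>

fun low_pairs :: "(axis \<Rightarrow> 'i tables) \<Rightarrow> (side \<Rightarrow> ('i \<times> 'i) set) \<Rightarrow> stage \<Rightarrow> ('i \<times> 'i) set" where
  "low_pairs t L S1 = mid1 t L"
| "low_pairs t L S2 = (L Test)\<inverse>"
| "low_pairs t L S3 = {}"
| "low_pairs t L S4 = L Test"

fun upp_pairs :: "(axis \<Rightarrow> 'i tables) \<Rightarrow> (side \<Rightarrow> ('i \<times> 'i) set) \<Rightarrow> stage \<Rightarrow> ('i \<times> 'i) set" where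
  "upp_pairs t L S1 = L Trial"
| "upp_pairs t L S2 = {}"
| "upp_pairs t L S3 = (L Trial)\<inverse>"
| "upp_pairs t L S4 = mid2 t L"

text \<open>For \<open>S2\<close> the sums extend over all first trial indices, so that they
  represent the entire lower part, while \<open>low_q\<close> reads only entries that lie in
  \<open>mid1\<close>. In the other stages the domain is the trial fibre itself.\<close>

definition low_dom :: "(axis \<Rightarrow> 'i tables) \<Rightarrow> (side \<Rightarrow> ('i \<times> 'i) set) \<Rightarrow> stage \<Rightarrow> 'i \<Rightarrow> 'i set"
  where "low_dom t L st z = (if st = S2 then fst ` L Trial else upp_pairs t L st `` {z})"

definition q_data :: "axis \<Rightarrow> side \<Rightarrow> nat \<Rightarrow> 'i \<Rightarrow> 'i \<Rightarrow> 'i datum list"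
  where "q_data i s l \<nu> \<kappa> = (if l = 0 then [] else [Mask_Q i s l \<nu> \<kappa>])"

type_synonym 'i terms = "('i datum list \<times> 'i node) set"

definition low_p_terms ::
  "(axis \<Rightarrow> 'i tables) \<Rightarrow> (side \<Rightarrow> ('i \<times> 'i) set) \<Rightarrow> stage \<Rightarrow> 'i \<Rightarrow> nat \<Rightarrow> 'i \<Rightarrow> 'i terms"
  where "low_p_terms t L st z l \<nu> = (let i = stage_axis st in
    (\<lambda>\<nu>2. ([Mask_P i Trial l \<nu> \<nu>2], Low st z (l - 1) \<nu>2)) `
      low_p (t i) (low_pairs t L st `` {z}) l \<nu>)"

definition low_q_terms ::
  "(axis \<Rightarrow> 'i tables) \<Rightarrow> (side \<Rightarrow> ('i \<times> 'i) set) \<Rightarrow> stage \<Rightarrow> 'i \<Rightarrow> nat \<Rightarrow> 'i \<Rightarrow> 'i terms"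
  where "low_q_terms t L st z l \<nu> = (let i = stage_axis st in
    (\<lambda>\<mu>. (q_data i Trial l \<nu> \<mu>, source st z \<mu>)) `
      low_q (t i) (low_dom t L st z) (low_pairs t L st `` {z}) l \<nu>)"

definition upp_p_terms ::
  "(axis \<Rightarrow> 'i tables) \<Rightarrow> (side \<Rightarrow> ('i \<times> 'i) set) \<Rightarrow> stage \<Rightarrow> 'i \<Rightarrow> nat \<Rightarrow> 'i \<Rightarrow> 'i terms"
  where "upp_p_terms t L st z l \<nu> = (let i = stage_axis st in
    (\<lambda>\<nu>2. ([Mask_P i Test (Suc l) \<nu>2 \<nu>], Upp st z (Suc l) \<nu>2)) `
      upp_p (t i) (upp_pairs t L st `` {z}) l \<nu>)"

definition upp_q_terms ::
  "(axis \<Rightarrow> 'i tables) \<Rightarrow> (side \<Rightarrow> ('i \<times> 'i) set) \<Rightarrow> stage \<Rightarrow> 'i \<Rightarrow> nat \<Rightarrow> 'i \<Rightarrow> 'i terms"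
  where "upp_q_terms t L st z l \<nu>' = (let i = stage_axis st in
    (\<lambda>(\<mu>, \<nu>). (q_data i Trial l \<nu> \<mu> @ [Op_Entry i \<nu>' \<nu>], source st z \<mu>)) `
      upp_q (t i) (upp_pairs t L st `` {z}) l \<nu>')"

definition low_o_terms :: "(axis \<Rightarrow> 'i tables) \<Rightarrow> stage \<Rightarrow> 'i \<Rightarrow> 'i \<Rightarrow> 'i terms"
  where "low_o_terms t st z \<kappa> = (let i = stage_axis st; l = wvl_level (t i) Test \<kappa> in
    (\<lambda>(\<nu>', \<nu>). (q_data i Test l \<nu>' \<kappa> @ [Op_Entry i \<nu>' \<nu>], Low st z l \<nu>)) ` low_o (t i) \<kappa>)"

definition upp_o_terms ::
  "(axis \<Rightarrow> 'i tables) \<Rightarrow> (side \<Rightarrow> ('i \<times> 'i) set) \<Rightarrow> stage \<Rightarrow> 'i \<Rightarrow> 'i \<Rightarrow> 'i terms"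
  where "upp_o_terms t L st z \<kappa> = (let i = stage_axis st; l = wvl_level (t i) Test \<kappa> in
    (\<lambda>(\<nu>', \<nu>2). (q_data i Test l \<nu>' \<kappa> @ [Mask_P i Test (Suc l) \<nu>2 \<nu>'], Upp st z (Suc l) \<nu>2)) `
      upp_o (t i) (upp_pairs t L st `` {z}) \<kappa>)"

fun node_terms :: "(axis \<Rightarrow> 'i tables) \<Rightarrow> (side \<Rightarrow> ('i \<times> 'i) set) \<Rightarrow> 'i node \<Rightarrow> 'i terms" where
  "node_terms t L (Inp \<mu>0 \<mu>1) = {}"
| "node_terms t L (Low st z l \<nu>) = low_p_terms t L st z l \<nu> \<union> low_q_terms t L st z l \<nu>"
| "node_terms t L (Upp st z l \<nu>) = upp_p_terms t L st z l \<nu> \<union> upp_q_terms t L st z l \<nu>"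
| "node_terms t L (Mid1 \<mu>0 \<kappa>1) = low_o_terms t S1 \<mu>0 \<kappa>1 \<union> upp_o_terms t L S1 \<mu>0 \<kappa>1"
| "node_terms t L (Mid2 \<kappa>0 \<mu>1) = upp_o_terms t L S3 \<mu>1 \<kappa>0"
| "node_terms t L (Out \<kappa>0 \<kappa>1) =
     low_o_terms t S2 \<kappa>1 \<kappa>0 \<union> (low_o_terms t S4 \<kappa>0 \<kappa>1 \<union> upp_o_terms t L S4 \<kappa>0 \<kappa>1)"

definition low_nodes :: "(axis \<Rightarrow> 'i tables) \<Rightarrow> (side \<Rightarrow> ('i \<times> 'i) set) \<Rightarrow> 'i node set"
  where "low_nodes t L =
    {Low st z l \<nu> | st z l \<nu>. (l, \<nu>) \<in> low_idx (t (stage_axis st)) (low_pairs t L st `` {z})}"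

definition upp_nodes :: "(axis \<Rightarrow> 'i tables) \<Rightarrow> (side \<Rightarrow> ('i \<times> 'i) set) \<Rightarrow> 'i node set"
  where "upp_nodes t L =
    {Upp st z l \<nu> | st z l \<nu>. (l, \<nu>) \<in> upp_idx (t (stage_axis st)) (upp_pairs t L st `` {z})}"

definition nodes :: "(axis \<Rightarrow> 'i tables) \<Rightarrow> (side \<Rightarrow> ('i \<times> 'i) set) \<Rightarrow> 'i node set"
  where "nodes t L = low_nodes t L \<union> upp_nodes t L \<union> case_prod Mid1 ` mid1 t L \<union>
    case_prod Mid2 ` mid2 t L \<union> case_prod Out ` L Test"

fun node_datum :: "'i node \<Rightarrow> 'i datum" where
  "node_datum (Inp \<mu>0 \<mu>1) = Input \<mu>0 \<mu>1"
| "node_datum _ = undefined"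

definition tensor_circuit :: "(axis \<Rightarrow> 'i tables) \<Rightarrow> (side \<Rightarrow> ('i \<times> 'i) set) \<Rightarrow> 'i prog"
  where "tensor_circuit t L =
    circuit node_datum (case_prod Inp ` L Trial) (node_terms t L) (nodes t L) (case_prod Out)"

text \<open>An infinite set has \<open>card\<close> 0, so a bound on \<open>card\<close> is
  informative only together with finiteness.\<close>

definition sized :: "'x set \<Rightarrow> nat \<Rightarrow> bool"
  where "sized X m \<longleftrightarrow> finite X \<and> card X \<le> m"

lemma sized_subset: "sized Y m \<Longrightarrow> X \<subseteq> Y \<Longrightarrow> sized X m"
  unfolding sized_def using card_mono finite_subset by (metis order_trans)

lemma sized_mono: "sized X m \<Longrightarrow> m \<le> n \<Longrightarrow> sized X n"
  unfolding sized_def by simp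

lemma sized_image: "sized X m \<Longrightarrow> sized (f ` X) m"
  unfolding sized_def using card_image_le order_trans by blast

lemma sized_Un: "sized X m \<Longrightarrow> sized Y n \<Longrightarrow> sized (X \<union> Y) (m + n)"
  unfolding sized_def using card_Un_le[of X Y] by auto

lemma sized_Times: "sized X m \<Longrightarrow> sized Y n \<Longrightarrow> sized (X \<times> Y) (m * n)"
  unfolding sized_def by (auto intro: mult_mono)

lemma sized_UN:
  assumes "sized X m" "\<And>x. x \<in> X \<Longrightarrow> sized (f x) k"
  shows "sized (\<Union>x\<in>X. f x) (m * k)"
proof -
  have "card (\<Union>x\<in>X. f x) \<le> (\<Sum>x\<in>X. card (f x))" using assms by (intro card_UN_le) (simp add: sized_def)
  also have "\<dots> \<le> (\<Sum>x\<in>X. k)" using assms by (intro sum_mono) (auto simp: sized_def)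
  also have "\<dots> \<le> m * k" using assms by (simp add: sized_def)
  finally show ?thesis using assms by (auto simp: sized_def)
qed

lemma sized_UN_pairs:
  "sized X m \<Longrightarrow> (\<And>x y. (x, y) \<in> X \<Longrightarrow> sized (f x y) k) \<Longrightarrow> sized (\<Union>(x, y)\<in>X. f x y) (m * k)"
  by (rule sized_UN) auto

instance stage :: finite
proof
  have *: "(UNIV :: stage set) = {S1, S2, S3, S4}" using stage.exhaust by auto
  show "finite (UNIV :: stage set)" unfolding * by simp
qed

lemma sized_stage: "sized (UNIV :: stage set) 4"
proof -
  have *: "(UNIV :: stage set) = {S1, S2, S3, S4}" using stage.exhaust by auto
  show ?thesis unfolding * by (simp add: sized_def)
qed

text \<open>The terms of a node form a set, in which equal terms would be merged. The sums over
  index sets are therefore recovered through injectivity; even on level 0, where the mask entry is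
  absent, the last datum and the node determine the indices.\<close>

lemma q_data_same [simp]: "q_data i s l \<nu> \<kappa> @ [d] = q_data i s l \<nu>2 \<kappa>2 @ [d'] \<longleftrightarrow>
    d = d' \<and> (l \<noteq> 0 \<longrightarrow> \<nu> = \<nu>2 \<and> \<kappa> = \<kappa>2)"
  by (auto simp: q_data_def)

lemma source_inj [simp]: "source st z \<mu> = source st z \<mu>2 \<longleftrightarrow> \<mu> = \<mu>2"
  by (cases st) auto

lemma source_not [simp]: "source st z \<mu> \<noteq> Low a b c d" "source st z \<mu> \<noteq> Upp a b c d"
  "Low a b c d \<noteq> source st z \<mu>" "Upp a b c d \<noteq> source st z \<mu>"
  by (cases st; simp)+

locale two_axes =
  fixes t :: "axis \<Rightarrow> 'i tables" and L :: "side \<Rightarrow> ('i \<times> 'i) set"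
    and tr :: "axis \<Rightarrow> side \<Rightarrow> 'i set \<Rightarrow> bool"
    and p q :: "axis \<Rightarrow> side \<Rightarrow> nat \<Rightarrow> 'i \<Rightarrow> 'i \<Rightarrow> real" and a mat :: "axis \<Rightarrow> 'i \<Rightarrow> 'i \<Rightarrow> real"
    and low upp :: "axis \<Rightarrow> 'i set \<Rightarrow> ('i \<Rightarrow> real) \<Rightarrow> nat \<Rightarrow> 'i \<Rightarrow> real" and K :: nat
    and E :: "'i environment"
  assumes ax: "axis (t i) (\<lambda>s. axis_proj i ` L s) (tr i) (p i) (q i) (a i) (mat i) (low i) (upp i) K"
    and finite_L: "finite (L s)"
    and tree0: "tr Ax0 s ((L s)\<inverse> `` {z})" and tree1: "tr Ax1 s (L s `` {z})"
    and E_simps [simp]: "datum_val E (Op_Entry i \<kappa> \<mu>) = a i \<kappa> \<mu>"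
      "datum_val E (Mask_P i s l \<nu> \<kappa>) = p i s l \<nu> \<kappa>" "datum_val E (Mask_Q i s l \<nu> \<kappa>) = q i s l \<nu> \<kappa>"
    and out_idx: "out_idx E = L Test"
begin

section \<open>Index sets of the stages and their fibres\<close>

definition W :: "axis \<Rightarrow> side \<Rightarrow> 'i set" where "W i s = axis_proj i ` L s"

lemma axis_W: "axis (t i) (W i) (tr i) (p i) (q i) (a i) (mat i) (low i) (upp i) K"
proof -
  have "W i = (\<lambda>s. axis_proj i ` L s)" by (auto simp: W_def)
  then show ?thesis using ax[of i] by simp
qed

lemma W_pair: "(x, y) \<in> L s \<Longrightarrow> x \<in> W Ax0 s \<and> y \<in> W Ax1 s"
  by (force simp: W_def)

lemma mid1_W: "(\<mu>, \<kappa>) \<in> mid1 t L \<Longrightarrow> \<mu> \<in> W Ax0 Trial \<and> \<kappa> \<in> W Ax1 Test"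
  using axis.near_wvl_level[OF axis_W, of _ Ax0 Test] W_pair by (fastforce simp: mid1_def)

lemma mid2_W: "(\<kappa>, \<mu>) \<in> mid2 t L \<Longrightarrow> \<kappa> \<in> W Ax0 Test \<and> \<mu> \<in> W Ax1 Trial"
  using axis.near_wvl_level[OF axis_W, of _ Ax0 Trial] W_pair by (fastforce simp: mid2_def)

lemma low_pairs_W: "(z, \<kappa>) \<in> low_pairs t L st \<Longrightarrow> \<kappa> \<in> W (stage_axis st) Test"
  by (cases st) (use W_pair mid1_W in auto)

lemma upp_pairs_W: "(z, \<mu>) \<in> upp_pairs t L st \<Longrightarrow> \<mu> \<in> W (stage_axis st) Trial"
  by (cases st) (use W_pair mid2_W in auto)

lemma low_T: "low_pairs t L st `` {z} \<subseteq> W (stage_axis st) Test"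
  using low_pairs_W by auto

lemma upp_T: "upp_pairs t L st `` {z} \<subseteq> W (stage_axis st) Trial"
  using upp_pairs_W by auto

lemma low_dom_W: "low_dom t L st z \<subseteq> W (stage_axis st) Trial"
  using upp_T W_pair by (auto simp: low_dom_def)

lemma tree_UN:
  assumes "\<And>x. x \<in> X \<Longrightarrow> tr i s (f x) \<and> f x \<subseteq> W i s"
  shows "tr i s (\<Union>x\<in>X. f x)"
  by (rule axis.tree_Union[OF axis_W]) (use assms in blast)

lemma tree_empty: "tr i s {}"
  using tree_UN[of "{}"] by simp

lemma low_tree: "tr (stage_axis st) Test (low_pairs t L st `` {z})"
proof (cases st)
  case S1
  \<comment> \<open>Nearness involves only z and \<kappa>0, so with each \<kappa>0 the entire fibre
    of L' over \<kappa>0 belongs to the fibre of \<open>mid1\<close> over z.\<close>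
  have "mid1 t L `` {z} = (\<Union>\<kappa>0\<in>{\<kappa>0. z \<in> near_wvl (t Ax0) Test \<kappa>0 (wvl_level (t Ax0) Test \<kappa>0)}.
      L Test `` {\<kappa>0})" by (auto simp: mid1_def)
  moreover have "tr Ax1 Test \<dots>" by (rule tree_UN) (use tree1 W_pair in auto)
  ultimately show ?thesis using S1 by simp
qed (use tree0 tree1 tree_empty in auto)

lemma upp_tree: "tr (stage_axis st) Trial (upp_pairs t L st `` {z})"
proof (cases st)
  case S4
  have "mid2 t L `` {z} = (\<Union>\<mu>0\<in>{\<mu>0. z \<in> near_wvl (t Ax0) Trial \<mu>0 (wvl_level (t Ax0) Trial \<mu>0 - 1)}.
      L Trial `` {\<mu>0})" by (auto simp: mid2_def)
  moreover have "tr Ax1 Trial \<dots>" by (rule tree_UN) (use tree1 W_pair in auto)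
  ultimately show ?thesis using S4 by simp
qed (use tree0 tree1 tree_empty in auto)

section \<open>Prescribed values of the nodes\<close>

abbreviation coef :: "'i \<Rightarrow> 'i \<Rightarrow> real" where "coef \<mu>0 \<mu>1 \<equiv> datum_val E (Input \<mu>0 \<mu>1)"

text \<open>The vectors on which the stages act: the input c for \<open>S1\<close> and
  \<open>S3\<close>, (Id \<otimes> A1) c for \<open>S2\<close>, and (U0 \<otimes> Id) c for
  \<open>S4\<close>. They are defined at all positions, although nodes exist only on
  \<open>mid1\<close> and \<open>mid2\<close>.\<close>

fun inp :: "stage \<Rightarrow> 'i \<Rightarrow> 'i \<Rightarrow> real" where
  "inp S1 \<mu>0 \<mu>1 = coef \<mu>0 \<mu>1"
| "inp S2 \<kappa>1 \<mu>0 = (\<Sum>\<mu>1\<in>L Trial `` {\<mu>0}. mat Ax1 \<kappa>1 \<mu>1 * coef \<mu>0 \<mu>1)"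
| "inp S3 \<mu>1 \<mu>0 = coef \<mu>0 \<mu>1"
| "inp S4 \<kappa>0 \<mu>1 = (\<Sum>\<mu>0 | \<mu>0 \<in> (L Trial)\<inverse> `` {\<mu>1} \<and>
     wvl_level (t Ax0) Test \<kappa>0 < wvl_level (t Ax0) Trial \<mu>0. mat Ax0 \<kappa>0 \<mu>0 * coef \<mu>0 \<mu>1)"

fun val :: "'i node \<Rightarrow> real" where
  "val (Inp \<mu>0 \<mu>1) = coef \<mu>0 \<mu>1"
| "val (Low st z l \<nu>) = low (stage_axis st) (low_dom t L st z) (inp st z) l \<nu>"
| "val (Upp st z l \<nu>) = upp (stage_axis st) (upp_pairs t L st `` {z}) (inp st z) l \<nu>"
| "val (Mid1 \<mu>0 \<kappa>1) = inp S2 \<kappa>1 \<mu>0"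
| "val (Mid2 \<kappa>0 \<mu>1) = inp S4 \<kappa>0 \<mu>1"
| "val (Out \<kappa>0 \<kappa>1) = (\<Sum>(\<mu>0, \<mu>1)\<in>L Trial. mat Ax0 \<kappa>0 \<mu>0 * mat Ax1 \<kappa>1 \<mu>1 * coef \<mu>0 \<mu>1)"

lemma val_source: "val (source st z \<mu>) = inp st z \<mu>"
  by (cases st) auto

lemma data_prod_q: "data_prod E (q_data i s l \<nu> \<kappa>) = q_val (q i) s l \<nu> \<kappa>"
  by (simp add: q_data_def q_val_def)

lemma data_prod_append: "data_prod E (xs @ ys) = data_prod E xs * data_prod E ys"
  by (simp add: data_prod_def)

abbreviation term_sum :: "'i terms \<Rightarrow> real"
  where "term_sum X \<equiv> (\<Sum>(ds, w)\<in>X. data_prod E ds * val w)"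

lemma sum_low_p: "term_sum (low_p_terms t L st z l \<nu>) =
    (\<Sum>\<nu>2\<in>low_p (t (stage_axis st)) (low_pairs t L st `` {z}) l \<nu>.
      p (stage_axis st) Trial l \<nu> \<nu>2 * low (stage_axis st) (low_dom t L st z) (inp st z) (l - 1) \<nu>2)"
  unfolding low_p_terms_def Let_def by (subst sum.reindex) (auto intro!: inj_onI)

lemma sum_low_q: "term_sum (low_q_terms t L st z l \<nu>) =
    (\<Sum>\<mu>\<in>low_q (t (stage_axis st)) (low_dom t L st z) (low_pairs t L st `` {z}) l \<nu>.
      q_val (q (stage_axis st)) Trial l \<nu> \<mu> * inp st z \<mu>)"
  unfolding low_q_terms_def Let_def
  by (subst sum.reindex) (auto intro!: inj_onI simp: data_prod_q val_source)

lemma sum_upp_p: "term_sum (upp_p_terms t L st z l \<nu>) =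
    (\<Sum>\<nu>2\<in>upp_p (t (stage_axis st)) (upp_pairs t L st `` {z}) l \<nu>.
      p (stage_axis st) Test (Suc l) \<nu>2 \<nu> * upp (stage_axis st) (upp_pairs t L st `` {z}) (inp st z) (Suc l) \<nu>2)"
  unfolding upp_p_terms_def Let_def by (subst sum.reindex) (auto intro!: inj_onI)

lemma sum_upp_q: "term_sum (upp_q_terms t L st z l \<nu>') =
    (\<Sum>(\<mu>, \<nu>)\<in>upp_q (t (stage_axis st)) (upp_pairs t L st `` {z}) l \<nu>'.
      q_val (q (stage_axis st)) Trial l \<nu> \<mu> * a (stage_axis st) \<nu>' \<nu> * inp st z \<mu>)"
  unfolding upp_q_terms_def Let_def
  by (subst sum.reindex) (auto intro!: inj_onI sum.cong simp: data_prod_append data_prod_q val_source)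

lemma sum_low_o:
  assumes "\<kappa> \<in> W (stage_axis st) Test"
  shows "term_sum (low_o_terms t st z \<kappa>) = (\<Sum>\<mu> | \<mu> \<in> low_dom t L st z \<and>
    wvl_level (t (stage_axis st)) Trial \<mu> \<le> wvl_level (t (stage_axis st)) Test \<kappa>.
    mat (stage_axis st) \<kappa> \<mu> * inp st z \<mu>)"
  unfolding axis.low_out[OF axis_W assms low_dom_W refl] low_o_terms_def Let_def
  by (subst sum.reindex) (auto intro!: inj_onI sum.cong simp: data_prod_append data_prod_q)

lemma sum_upp_o:
  assumes "\<kappa> \<in> W (stage_axis st) Test"
  shows "term_sum (upp_o_terms t L st z \<kappa>) = (\<Sum>\<mu> | \<mu> \<in> upp_pairs t L st `` {z} \<and>
    wvl_level (t (stage_axis st)) Test \<kappa> < wvl_level (t (stage_axis st)) Trial \<mu>.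
    mat (stage_axis st) \<kappa> \<mu> * inp st z \<mu>)"
  unfolding axis.upp_out[OF axis_W assms upp_tree upp_T refl] upp_o_terms_def Let_def
  by (subst sum.reindex) (auto intro!: inj_onI sum.cong simp: data_prod_append data_prod_q)

section \<open>Numbers of nodes and terms\<close>

lemma finite_W: "finite (W i s)"
  using finite_L by (simp add: W_def)

lemma near_scl_sized: "\<kappa> \<in> W i s \<Longrightarrow> sized (near_scl (t i) s \<kappa> s' l) K"
  using axis.near_scl_bound[OF axis_W] by (simp add: sized_def)

lemma near_wvl_sized: "\<kappa> \<in> W i s \<Longrightarrow> sized (near_wvl (t i) s \<kappa> l) K"
  using axis.near_wvl_bound[OF axis_W] by (simp add: sized_def)

lemma own_scl_sized: "\<kappa> \<in> W i s \<Longrightarrow> sized (own_scl (t i) s \<kappa>) K"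
  by (rule sized_subset[OF near_scl_sized]) (auto simp: own_scl_def)

text \<open>A common bound for all pair sets of the stages: the factor K is due to
  \<open>mid1\<close> and \<open>mid2\<close>, the summand 1 to L and L' themselves.\<close>

definition pairs_bound :: nat where "pairs_bound = (K + 1) * (card (L Test) + card (L Trial))"

lemma sized_L: "sized (L s) (card (L Test) + card (L Trial))"
  using finite_L by (cases s) (auto simp: sized_def)

lemma sized_L': "sized (L s) pairs_bound"
  by (rule sized_mono[OF sized_L]) (simp add: pairs_bound_def)

lemma sized_mid1: "sized (mid1 t L) pairs_bound"
proof -
  have "mid1 t L \<subseteq> (\<Union>(\<kappa>0, \<kappa>1)\<in>L Test.
      (\<lambda>\<mu>0. (\<mu>0, \<kappa>1)) ` near_wvl (t Ax0) Test \<kappa>0 (wvl_level (t Ax0) Test \<kappa>0))"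
    by (auto simp: mid1_def)
  moreover have "sized \<dots> ((card (L Test) + card (L Trial)) * K)"
    by (intro sized_UN_pairs[OF sized_L] sized_image near_wvl_sized) (rule W_pair[THEN conjunct1])
  ultimately have "sized (mid1 t L) ((card (L Test) + card (L Trial)) * K)" by (rule sized_subset[rotated])
  then show ?thesis by (rule sized_mono) (simp add: pairs_bound_def algebra_simps)
qed

lemma sized_mid2: "sized (mid2 t L) pairs_bound"
proof -
  have "mid2 t L \<subseteq> (\<Union>(\<mu>0, \<mu>1)\<in>L Trial.
      (\<lambda>\<kappa>0. (\<kappa>0, \<mu>1)) ` near_wvl (t Ax0) Trial \<mu>0 (wvl_level (t Ax0) Trial \<mu>0 - 1))"
    by (auto simp: mid2_def)
  moreover have "sized \<dots> ((card (L Test) + card (L Trial)) * K)"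
    by (intro sized_UN_pairs[OF sized_L] sized_image near_wvl_sized) (rule W_pair[THEN conjunct1])
  ultimately have "sized (mid2 t L) ((card (L Test) + card (L Trial)) * K)" by (rule sized_subset[rotated])
  then show ?thesis by (rule sized_mono) (simp add: pairs_bound_def algebra_simps)
qed

lemma sized_converse: "sized X m \<Longrightarrow> sized (X\<inverse>) m"
  by (simp add: sized_def)

lemma sized_low_pairs: "sized (low_pairs t L st) pairs_bound"
  using sized_L'[of Test] sized_mid1 sized_converse[OF sized_L'[of Test]]
  by (cases st) (auto simp: sized_def)

lemma sized_upp_pairs: "sized (upp_pairs t L st) pairs_bound"
  using sized_L'[of Trial] sized_mid2 sized_converse[OF sized_L'[of Trial]]
  by (cases st) (auto simp: sized_def)

lemma sized_low_nodes: "sized (low_nodes t L) (4 * (pairs_bound * K))"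
proof -
  have "low_nodes t L \<subseteq> (\<Union>st. \<Union>(z, \<kappa>)\<in>low_pairs t L st.
     Low st z (wvl_level (t (stage_axis st)) Test \<kappa>) `
       near_scl (t (stage_axis st)) Test \<kappa> Trial (wvl_level (t (stage_axis st)) Test \<kappa>))"
  proof
    fix v assume "v \<in> low_nodes t L"
    then obtain st z l \<nu> where v: "v = Low st z l \<nu>"
      and "(l, \<nu>) \<in> low_idx (t (stage_axis st)) (low_pairs t L st `` {z})" by (auto simp: low_nodes_def)
    then obtain \<kappa> where "(z, \<kappa>) \<in> low_pairs t L st" "wvl_level (t (stage_axis st)) Test \<kappa> = l"
      "\<nu> \<in> near_scl (t (stage_axis st)) Test \<kappa> Trial l" by (auto simp: low_idx_def)
    with v show "v \<in> (\<Union>st. \<Union>(z, \<kappa>)\<in>low_pairs t L st.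
       Low st z (wvl_level (t (stage_axis st)) Test \<kappa>) `
         near_scl (t (stage_axis st)) Test \<kappa> Trial (wvl_level (t (stage_axis st)) Test \<kappa>))"
      by (intro UN_I[of st] UN_I[of "(z, \<kappa>)"]) auto
  qed
  moreover have "sized \<dots> (4 * (pairs_bound * K))"
    by (intro sized_UN[OF sized_stage] sized_UN_pairs[OF sized_low_pairs] sized_image near_scl_sized)
      (rule low_pairs_W)
  ultimately show ?thesis by (rule sized_subset[rotated])
qed

lemma sized_upp_nodes: "sized (upp_nodes t L) (4 * (pairs_bound * K))"
proof -
  have "upp_nodes t L \<subseteq> (\<Union>st. \<Union>(z, \<mu>)\<in>upp_pairs t L st.
     Upp st z (wvl_level (t (stage_axis st)) Trial \<mu>) `
       near_scl (t (stage_axis st)) Trial \<mu> Test (wvl_level (t (stage_axis st)) Trial \<mu>))"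
  proof
    fix v assume "v \<in> upp_nodes t L"
    then obtain st z l \<nu> where v: "v = Upp st z l \<nu>"
      and "(l, \<nu>) \<in> upp_idx (t (stage_axis st)) (upp_pairs t L st `` {z})" by (auto simp: upp_nodes_def)
    then obtain \<mu> where "(z, \<mu>) \<in> upp_pairs t L st" "wvl_level (t (stage_axis st)) Trial \<mu> = l"
      "\<nu> \<in> near_scl (t (stage_axis st)) Trial \<mu> Test l" by (auto simp: upp_idx_def)
    with v show "v \<in> (\<Union>st. \<Union>(z, \<mu>)\<in>upp_pairs t L st.
       Upp st z (wvl_level (t (stage_axis st)) Trial \<mu>) `
         near_scl (t (stage_axis st)) Trial \<mu> Test (wvl_level (t (stage_axis st)) Trial \<mu>))"
      by (intro UN_I[of st] UN_I[of "(z, \<mu>)"]) auto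
  qed
  moreover have "sized \<dots> (4 * (pairs_bound * K))"
    by (intro sized_UN[OF sized_stage] sized_UN_pairs[OF sized_upp_pairs] sized_image near_scl_sized)
      (rule upp_pairs_W)
  ultimately show ?thesis by (rule sized_subset[rotated])
qed

lemma sized_nodes: "sized (nodes t L) (4 * (pairs_bound * K) + 4 * (pairs_bound * K) + pairs_bound + pairs_bound + pairs_bound)"
  unfolding nodes_def
  by (intro sized_Un sized_image sized_low_nodes sized_upp_nodes sized_mid1 sized_mid2 sized_L')

lemma sized_low_o: "\<kappa> \<in> W (stage_axis st) Test \<Longrightarrow> sized (low_o_terms t st z \<kappa>) (K * K)"
  unfolding low_o_terms_def Let_def low_o_def
  by (intro sized_image sized_Times own_scl_sized near_scl_sized)

lemma sized_upp_o: "\<kappa> \<in> W (stage_axis st) Test \<Longrightarrow> sized (upp_o_terms t L st z \<kappa>) (K * K)"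
  unfolding upp_o_terms_def Let_def upp_o_def
  by (intro sized_image sized_Times own_scl_sized sized_subset[OF near_scl_sized, of \<kappa>]) auto

text \<open>Terms are charged to the wavelet near which their indices lie, not to the node that owns
  them; the bound then follows from the table sizes of that wavelet: K * K pairs for each of the two
  kinds of terms, in four stages.\<close>

lemma sized_low_edges: "sized (Sigma (low_nodes t L) (node_terms t L)) (4 * (pairs_bound * (K * K + K * K)))"
proof -
  let ?l = "\<lambda>st. wvl_level (t (stage_axis st)) Test"
  let ?n = "\<lambda>st \<kappa>. near_scl (t (stage_axis st)) Test \<kappa> Trial"
  have "Sigma (low_nodes t L) (node_terms t L) \<subseteq> (\<Union>st. \<Union>(z, \<kappa>)\<in>low_pairs t L st.
     (\<lambda>(\<nu>, \<nu>2). (Low st z (?l st \<kappa>) \<nu>,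
        [Mask_P (stage_axis st) Trial (?l st \<kappa>) \<nu> \<nu>2], Low st z (?l st \<kappa> - 1) \<nu>2)) `
       (?n st \<kappa> (?l st \<kappa>) \<times> ?n st \<kappa> (?l st \<kappa> - 1)) \<union>
     (\<lambda>(\<nu>, \<mu>). (Low st z (?l st \<kappa>) \<nu>, q_data (stage_axis st) Trial (?l st \<kappa>) \<nu> \<mu>, source st z \<mu>)) `
       (?n st \<kappa> (?l st \<kappa>) \<times> near_wvl (t (stage_axis st)) Test \<kappa> (?l st \<kappa>)))" (is "_ \<subseteq> ?R")
  proof (rule subsetI)
    fix e assume "e \<in> Sigma (low_nodes t L) (node_terms t L)"
    then obtain st z l \<nu> w where e: "e = (Low st z l \<nu>, w)" "w \<in> node_terms t L (Low st z l \<nu>)"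
      by (auto simp: low_nodes_def)
    then consider (p) \<nu>2 where "\<nu>2 \<in> low_p (t (stage_axis st)) (low_pairs t L st `` {z}) l \<nu>"
        "w = ([Mask_P (stage_axis st) Trial l \<nu> \<nu>2], Low st z (l - 1) \<nu>2)"
      | (q) \<mu> where "\<mu> \<in> low_q (t (stage_axis st)) (low_dom t L st z) (low_pairs t L st `` {z}) l \<nu>"
        "w = (q_data (stage_axis st) Trial l \<nu> \<mu>, source st z \<mu>)"
      by (auto simp: low_p_terms_def low_q_terms_def Let_def)
    then show "e \<in> ?R"
    proof cases
      case p
      then obtain \<kappa> where "(z, \<kappa>) \<in> low_pairs t L st" "l = ?l st \<kappa>" "\<nu> \<in> ?n st \<kappa> l" "\<nu>2 \<in> ?n st \<kappa> (l - 1)"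
        by (auto simp: low_p_def)
      then show ?thesis using p(2) e(1)
        by (intro UN_I[of st] UN_I[of "(z, \<kappa>)"]) (auto intro!: image_eqI[of _ _ "(\<nu>, \<nu>2)"])
    next
      case q
      then obtain \<kappa> where "(z, \<kappa>) \<in> low_pairs t L st" "l = ?l st \<kappa>" "\<nu> \<in> ?n st \<kappa> l"
        "\<mu> \<in> near_wvl (t (stage_axis st)) Test \<kappa> l"
        by (auto simp: low_q_def)
      then show ?thesis using q(2) e(1)
        by (intro UN_I[of st] UN_I[of "(z, \<kappa>)"]) (auto intro!: image_eqI[of _ _ "(\<nu>, \<mu>)"])
    qed
  qed
  moreover have "sized ?R (4 * (pairs_bound * (K * K + K * K)))"
    by (intro sized_UN[OF sized_stage] sized_UN_pairs[OF sized_low_pairs] sized_Un sized_image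
        sized_Times near_scl_sized near_wvl_sized; rule low_pairs_W)
  ultimately show ?thesis by (rule sized_subset[rotated])
qed

lemma sized_upp_edges: "sized (Sigma (upp_nodes t L) (node_terms t L)) (4 * (pairs_bound * (K * K + K * K)))"
proof -
  let ?l = "\<lambda>st. wvl_level (t (stage_axis st)) Trial"
  let ?n = "\<lambda>st \<mu>. near_scl (t (stage_axis st)) Trial \<mu> Test"
  \<comment> \<open>A term leading from level l to level l + 1 is charged to a trial wavelet on the
    finer level, so its node has level \<open>?l st \<mu> - 1\<close>.\<close>
  have "Sigma (upp_nodes t L) (node_terms t L) \<subseteq> (\<Union>st. \<Union>(z, \<mu>)\<in>upp_pairs t L st.
     (\<lambda>(\<nu>, \<nu>2). (Upp st z (?l st \<mu> - 1) \<nu>,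
        [Mask_P (stage_axis st) Test (?l st \<mu>) \<nu>2 \<nu>], Upp st z (?l st \<mu>) \<nu>2)) `
       (?n st \<mu> (?l st \<mu> - 1) \<times> ?n st \<mu> (?l st \<mu>)) \<union>
     (\<lambda>(\<nu>', \<nu>). (Upp st z (?l st \<mu>) \<nu>',
        q_data (stage_axis st) Trial (?l st \<mu>) \<nu> \<mu> @ [Op_Entry (stage_axis st) \<nu>' \<nu>], source st z \<mu>)) `
       (?n st \<mu> (?l st \<mu>) \<times> own_scl (t (stage_axis st)) Trial \<mu>))" (is "_ \<subseteq> ?R")
  proof (rule subsetI)
    fix e assume "e \<in> Sigma (upp_nodes t L) (node_terms t L)"
    then obtain st z l \<nu> w where e: "e = (Upp st z l \<nu>, w)" "w \<in> node_terms t L (Upp st z l \<nu>)"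
      by (auto simp: upp_nodes_def)
    then consider (p) \<nu>2 where "\<nu>2 \<in> upp_p (t (stage_axis st)) (upp_pairs t L st `` {z}) l \<nu>"
        "w = ([Mask_P (stage_axis st) Test (Suc l) \<nu>2 \<nu>], Upp st z (Suc l) \<nu>2)"
      | (q) \<mu> \<nu>2 where "(\<mu>, \<nu>2) \<in> upp_q (t (stage_axis st)) (upp_pairs t L st `` {z}) l \<nu>"
        "w = (q_data (stage_axis st) Trial l \<nu>2 \<mu> @ [Op_Entry (stage_axis st) \<nu> \<nu>2], source st z \<mu>)"
      by (auto simp: upp_p_terms_def upp_q_terms_def Let_def)
    then show "e \<in> ?R"
    proof cases
      case p
      then obtain \<mu> where "(z, \<mu>) \<in> upp_pairs t L st" "Suc l = ?l st \<mu>" "\<nu> \<in> ?n st \<mu> l" "\<nu>2 \<in> ?n st \<mu> (Suc l)"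
        by (auto simp: upp_p_def)
      then show ?thesis using p(2) e(1)
        by (intro UN_I[of st] UN_I[of "(z, \<mu>)"]) (auto intro!: image_eqI[of _ _ "(\<nu>, \<nu>2)"] simp flip: \<open>Suc l = ?l st \<mu>\<close>)
    next
      case q
      then have "(z, \<mu>) \<in> upp_pairs t L st" "l = ?l st \<mu>" "\<nu> \<in> ?n st \<mu> l"
        "\<nu>2 \<in> own_scl (t (stage_axis st)) Trial \<mu>"
        by (auto simp: upp_q_def)
      then show ?thesis using q(2) e(1)
        by (intro UN_I[of st] UN_I[of "(z, \<mu>)"]) (auto intro!: image_eqI[of _ _ "(\<nu>, \<nu>2)"])
    qed
  qed
  moreover have "sized ?R (4 * (pairs_bound * (K * K + K * K)))"
    by (intro sized_UN[OF sized_stage] sized_UN_pairs[OF sized_upp_pairs] sized_Un sized_image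
        sized_Times near_scl_sized own_scl_sized; rule upp_pairs_W)
  ultimately show ?thesis by (rule sized_subset[rotated])
qed

lemma sized_image_edges:
  assumes "sized X m" "\<And>x. x \<in> X \<Longrightarrow> sized (node_terms t L (f x)) k"
  shows "sized (Sigma (f ` X) (node_terms t L)) (m * k)"
proof -
  have "Sigma (f ` X) (node_terms t L) = (\<Union>x\<in>X. Pair (f x) ` node_terms t L (f x))" by auto
  then show ?thesis using assms by (auto intro!: sized_UN sized_image)
qed

lemma sized_edges: "sized (Sigma (nodes t L) (node_terms t L)) (22 * (K * K) * pairs_bound)"
proof -
  have eq: "Sigma (nodes t L) (node_terms t L) =
      Sigma (low_nodes t L) (node_terms t L) \<union> Sigma (upp_nodes t L) (node_terms t L) \<union>
      Sigma (case_prod Mid1 ` mid1 t L) (node_terms t L) \<union>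
      Sigma (case_prod Mid2 ` mid2 t L) (node_terms t L) \<union>
      Sigma (case_prod Out ` L Test) (node_terms t L)"
    by (auto simp: nodes_def)
  have 1: "sized (node_terms t L (case_prod Mid1 x)) (K * K + K * K)" if "x \<in> mid1 t L" for x
  proof -
    obtain \<mu>0 \<kappa>1 where x: "x = (\<mu>0, \<kappa>1)" by (cases x)
    then have "\<kappa>1 \<in> W Ax1 Test" using mid1_W that by auto
    then show ?thesis unfolding x prod.case node_terms.simps
      by (intro sized_Un sized_low_o sized_upp_o) auto
  qed
  have 2: "sized (node_terms t L (case_prod Mid2 x)) (K * K)" if "x \<in> mid2 t L" for x
  proof -
    obtain \<kappa>0 \<mu>1 where x: "x = (\<kappa>0, \<mu>1)" by (cases x)
    then have "\<kappa>0 \<in> W Ax0 Test" using mid2_W that by auto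
    then show ?thesis unfolding x prod.case node_terms.simps by (intro sized_upp_o) auto
  qed
  have 3: "sized (node_terms t L (case_prod Out x)) (K * K + (K * K + K * K))" if "x \<in> L Test" for x
  proof -
    obtain \<kappa>0 \<kappa>1 where x: "x = (\<kappa>0, \<kappa>1)" by (cases x)
    then have "\<kappa>0 \<in> W Ax0 Test" "\<kappa>1 \<in> W Ax1 Test" using W_pair that by auto
    then show ?thesis unfolding x prod.case node_terms.simps
      by (intro sized_Un sized_low_o sized_upp_o) auto
  qed
  \<comment> \<open>In units of K * K and \<open>pairs_bound\<close> the summands are 8 + 8 + 2 + 1
    + 3 = 22.\<close>
  have "sized (Sigma (nodes t L) (node_terms t L)) (4 * (pairs_bound * (K * K + K * K)) +
     4 * (pairs_bound * (K * K + K * K)) + pairs_bound * (K * K + K * K) + pairs_bound * (K * K) +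
     pairs_bound * (K * K + (K * K + K * K)))"
    unfolding eq by (intro sized_Un sized_low_edges sized_upp_edges sized_image_edges[OF sized_mid1 1]
      sized_image_edges[OF sized_mid2 2] sized_image_edges[OF sized_L' 3])
  then show ?thesis by (rule sized_mono) (simp add: algebra_simps)
qed

lemma finite_terms: "v \<in> nodes t L \<Longrightarrow> finite (node_terms t L v)"
proof -
  assume "v \<in> nodes t L"
  then have "Pair v ` node_terms t L v \<subseteq> Sigma (nodes t L) (node_terms t L)" by auto
  then have "finite (Pair v ` node_terms t L v)" using sized_edges finite_subset by (auto simp: sized_def)
  then show ?thesis by (rule finite_imageD) (auto intro: inj_onI)
qed

lemma term_sum_Un:
  assumes "v \<in> nodes t L" "node_terms t L v = X \<union> Y" "X \<inter> Y = {}"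
  shows "term_sum (node_terms t L v) = term_sum X + term_sum Y"
  using finite_terms[OF assms(1)] assms(2,3) by (simp add: sum.union_disjoint)

section \<open>The prescribed values solve the equations of the circuit\<close>

lemma val_low:
  assumes "Low st z l \<nu> \<in> nodes t L"
  shows "val (Low st z l \<nu>) = term_sum (node_terms t L (Low st z l \<nu>))"
proof -
  have idx: "(l, \<nu>) \<in> low_idx (t (stage_axis st)) (low_pairs t L st `` {z})"
    using assms by (auto simp: nodes_def low_nodes_def upp_nodes_def)
  have "low_p_terms t L st z l \<nu> \<inter> low_q_terms t L st z l \<nu> = {}"
    by (auto simp: low_p_terms_def low_q_terms_def Let_def)
  then have "term_sum (node_terms t L (Low st z l \<nu>)) =
      term_sum (low_p_terms t L st z l \<nu>) + term_sum (low_q_terms t L st z l \<nu>)"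
    by (intro term_sum_Un[OF assms]) auto
  then show ?thesis
    using axis.low_rec[OF axis_W low_tree low_T low_dom_W idx] by (simp add: sum_low_p sum_low_q)
qed

lemma val_upp:
  assumes "Upp st z l \<nu> \<in> nodes t L"
  shows "val (Upp st z l \<nu>) = term_sum (node_terms t L (Upp st z l \<nu>))"
proof -
  have idx: "(l, \<nu>) \<in> upp_idx (t (stage_axis st)) (upp_pairs t L st `` {z})"
    using assms by (auto simp: nodes_def low_nodes_def upp_nodes_def)
  have "upp_p_terms t L st z l \<nu> \<inter> upp_q_terms t L st z l \<nu> = {}"
    by (auto simp: upp_p_terms_def upp_q_terms_def Let_def)
  then have "term_sum (node_terms t L (Upp st z l \<nu>)) =
      term_sum (upp_p_terms t L st z l \<nu>) + term_sum (upp_q_terms t L st z l \<nu>)"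
    by (intro term_sum_Un[OF assms]) auto
  then show ?thesis
    using axis.upp_rec[OF axis_W upp_tree upp_T idx] by (simp add: sum_upp_p sum_upp_q)
qed

lemma sum_level_split:
  fixes f :: "'i \<Rightarrow> real" and g :: "'i \<Rightarrow> nat"
  assumes "finite X"
  shows "(\<Sum>\<mu> | \<mu> \<in> X \<and> g \<mu> \<le> l. f \<mu>) + (\<Sum>\<mu> | \<mu> \<in> X \<and> l < g \<mu>. f \<mu>) = sum f X"
  using assms by (subst sum.union_disjoint[symmetric]) (auto intro!: sum.cong)

lemma finite_upp_pairs: "finite (upp_pairs t L st `` {z})"
  by (rule finite_subset[OF upp_T finite_W])

lemma low_upp_o_disjoint: "low_o_terms t st z \<kappa> \<inter> upp_o_terms t L st2 z2 \<kappa>2 = {}"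
  by (auto simp: low_o_terms_def upp_o_terms_def Let_def)

text \<open>Outside \<open>S2\<close> both parts run over the same trial fibre, so the two level
  ranges add up to the full operator.\<close>

lemma sum_low_upp_o:
  assumes "\<kappa> \<in> W (stage_axis st) Test" "st \<noteq> S2"
  shows "term_sum (low_o_terms t st z \<kappa>) + term_sum (upp_o_terms t L st z \<kappa>) =
    (\<Sum>\<mu>\<in>upp_pairs t L st `` {z}. mat (stage_axis st) \<kappa> \<mu> * inp st z \<mu>)"
  using sum_level_split[OF finite_upp_pairs] assms
  by (simp add: sum_low_o sum_upp_o low_dom_def)

lemma val_mid1:
  assumes "Mid1 \<mu>0 \<kappa>1 \<in> nodes t L"
  shows "val (Mid1 \<mu>0 \<kappa>1) = term_sum (node_terms t L (Mid1 \<mu>0 \<kappa>1))"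
proof -
  have \<kappa>1: "\<kappa>1 \<in> W (stage_axis S1) Test"
    using assms mid1_W by (auto simp: nodes_def low_nodes_def upp_nodes_def)
  have "term_sum (node_terms t L (Mid1 \<mu>0 \<kappa>1)) =
      term_sum (low_o_terms t S1 \<mu>0 \<kappa>1) + term_sum (upp_o_terms t L S1 \<mu>0 \<kappa>1)"
    by (intro term_sum_Un[OF assms] low_upp_o_disjoint) simp
  then show ?thesis using sum_low_upp_o[OF \<kappa>1] by simp
qed

lemma val_mid2:
  assumes "Mid2 \<kappa>0 \<mu>1 \<in> nodes t L"
  shows "val (Mid2 \<kappa>0 \<mu>1) = term_sum (node_terms t L (Mid2 \<kappa>0 \<mu>1))"
proof -
  have \<kappa>0: "\<kappa>0 \<in> W (stage_axis S3) Test"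
    using assms mid2_W by (auto simp: nodes_def low_nodes_def upp_nodes_def)
  show ?thesis using sum_upp_o[OF \<kappa>0] by simp
qed

text \<open>If an entry of (U0 \<otimes> Id) c is non-zero, so is a matrix entry in its sum;
  \<open>upp_zero\<close>, applied in the trial fibre over \<mu>1, then yields the witness that
  \<open>mid2\<close> asks for. Restricting \<open>S4\<close> to \<open>mid2\<close> loses
  nothing.\<close>

lemma inp_S4_zero:
  assumes "\<kappa>0 \<in> W Ax0 Test" "inp S4 \<kappa>0 \<mu>1 \<noteq> 0"
  shows "(\<kappa>0, \<mu>1) \<in> mid2 t L"
proof -
  let ?l = "wvl_level (t Ax0) Test \<kappa>0"
  obtain \<mu>0 where \<mu>0: "\<mu>0 \<in> (L Trial)\<inverse> `` {\<mu>1}" "?l < wvl_level (t Ax0) Trial \<mu>0" "mat Ax0 \<kappa>0 \<mu>0 \<noteq> 0"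
    using assms(2) by (auto elim!: sum.not_neutral_contains_not_neutral)
  have sub: "(L Trial)\<inverse> `` {\<mu>1} \<subseteq> W Ax0 Trial" using W_pair by auto
  obtain \<mu>2 where "\<mu>2 \<in> (L Trial)\<inverse> `` {\<mu>1}" "wvl_level (t Ax0) Trial \<mu>2 = Suc ?l"
    "\<kappa>0 \<in> near_wvl (t Ax0) Trial \<mu>2 ?l"
    using axis.upp_zero[OF axis_W assms(1) tree0 sub \<mu>0(1) refl \<mu>0(2,3)] by blast
  then show ?thesis by (auto simp: mid2_def)
qed

text \<open>The double sum is split by comparing the level of \<mu>0 with that of \<kappa>0. The
  coarse half is summed over \<mu>1 first, the fine half over \<mu>0 first; these two orders are the
  two products of the splitting.\<close>

lemma val_out:
  assumes "(\<kappa>0, \<kappa>1) \<in> L Test"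
  shows "val (Out \<kappa>0 \<kappa>1) = term_sum (node_terms t L (Out \<kappa>0 \<kappa>1))"
proof -
  let ?L = "L Trial"
  let ?l = "wvl_level (t Ax0) Test \<kappa>0"
  let ?lv = "wvl_level (t Ax0) Trial"
  let ?f = "\<lambda>\<mu>0 \<mu>1. mat Ax0 \<kappa>0 \<mu>0 * mat Ax1 \<kappa>1 \<mu>1 * coef \<mu>0 \<mu>1"
  have \<kappa>: "\<kappa>0 \<in> W (stage_axis S2) Test" "\<kappa>1 \<in> W (stage_axis S4) Test" using W_pair[OF assms] by auto
  have node: "Out \<kappa>0 \<kappa>1 \<in> nodes t L" using assms by (force simp: nodes_def)
  have fin: "finite ?L" by (rule finite_L)
  have split: "(\<Sum>(\<mu>0, \<mu>1)\<in>?L. ?f \<mu>0 \<mu>1) =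
      (\<Sum>(\<mu>0, \<mu>1) | (\<mu>0, \<mu>1) \<in> ?L \<and> ?lv \<mu>0 \<le> ?l. ?f \<mu>0 \<mu>1) +
      (\<Sum>(\<mu>0, \<mu>1) | (\<mu>0, \<mu>1) \<in> ?L \<and> ?l < ?lv \<mu>0. ?f \<mu>0 \<mu>1)"
    using fin by (subst sum.union_disjoint[symmetric])
      (auto intro!: sum.cong finite_subset[OF _ fin])
  have "(\<Sum>(\<mu>0, \<mu>1) | (\<mu>0, \<mu>1) \<in> ?L \<and> ?lv \<mu>0 \<le> ?l. ?f \<mu>0 \<mu>1) =
      (\<Sum>(\<mu>0, \<mu>1)\<in>(SIGMA \<mu>0:{\<mu>0 \<in> fst ` ?L. ?lv \<mu>0 \<le> ?l}. ?L `` {\<mu>0}). ?f \<mu>0 \<mu>1)"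
    by (rule sum.cong) force+
  also have "\<dots> = (\<Sum>\<mu>0 | \<mu>0 \<in> fst ` ?L \<and> ?lv \<mu>0 \<le> ?l. \<Sum>\<mu>1\<in>?L `` {\<mu>0}. ?f \<mu>0 \<mu>1)"
    using fin by (intro sum.Sigma[symmetric]) auto
  also have "\<dots> = (\<Sum>\<mu>0 | \<mu>0 \<in> fst ` ?L \<and> ?lv \<mu>0 \<le> ?l. mat Ax0 \<kappa>0 \<mu>0 * inp S2 \<kappa>1 \<mu>0)"
    by (simp add: sum_distrib_left mult.assoc)
  also have "\<dots> = term_sum (low_o_terms t S2 \<kappa>1 \<kappa>0)"
    using sum_low_o[OF \<kappa>(1), of \<kappa>1] by (simp add: low_dom_def)
  finally have 1: "(\<Sum>(\<mu>0, \<mu>1) | (\<mu>0, \<mu>1) \<in> ?L \<and> ?lv \<mu>0 \<le> ?l. ?f \<mu>0 \<mu>1) =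
    term_sum (low_o_terms t S2 \<kappa>1 \<kappa>0)" .
  have "(\<Sum>(\<mu>0, \<mu>1) | (\<mu>0, \<mu>1) \<in> ?L \<and> ?l < ?lv \<mu>0. ?f \<mu>0 \<mu>1) =
      (\<Sum>(\<mu>1, \<mu>0)\<in>(SIGMA \<mu>1:snd ` ?L. {\<mu>0 \<in> ?L\<inverse> `` {\<mu>1}. ?l < ?lv \<mu>0}). ?f \<mu>0 \<mu>1)"
    by (rule sum.reindex_bij_witness[of _ prod.swap prod.swap]) force+
  also have "\<dots> = (\<Sum>\<mu>1\<in>snd ` ?L. \<Sum>\<mu>0 | \<mu>0 \<in> ?L\<inverse> `` {\<mu>1} \<and> ?l < ?lv \<mu>0. ?f \<mu>0 \<mu>1)"
  proof (intro sum.Sigma[symmetric] ballI)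
    fix \<mu>1
    have "{\<mu>0 \<in> ?L\<inverse> `` {\<mu>1}. ?l < ?lv \<mu>0} \<subseteq> fst ` ?L" by force
    then show "finite {\<mu>0 \<in> ?L\<inverse> `` {\<mu>1}. ?l < ?lv \<mu>0}" using fin finite_subset by blast
  qed (use fin in simp)
  also have "\<dots> = (\<Sum>\<mu>1\<in>snd ` ?L. mat Ax1 \<kappa>1 \<mu>1 * inp S4 \<kappa>0 \<mu>1)"
    by (simp add: sum_distrib_left mult_ac)
  also have "\<dots> = (\<Sum>\<mu>1\<in>mid2 t L `` {\<kappa>0}. mat Ax1 \<kappa>1 \<mu>1 * inp S4 \<kappa>0 \<mu>1)"
  proof (rule sum.mono_neutral_right)
    show "finite (snd ` ?L)" using fin by simp
    show "mid2 t L `` {\<kappa>0} \<subseteq> snd ` ?L" by (force simp: mid2_def)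
    show "\<forall>\<mu>1\<in>snd ` ?L - mid2 t L `` {\<kappa>0}. mat Ax1 \<kappa>1 \<mu>1 * inp S4 \<kappa>0 \<mu>1 = 0"
      using inp_S4_zero[of \<kappa>0] \<kappa>(1) by (auto simp del: inp.simps)
  qed
  also have "\<dots> = term_sum (low_o_terms t S4 \<kappa>0 \<kappa>1) + term_sum (upp_o_terms t L S4 \<kappa>0 \<kappa>1)"
    using sum_low_upp_o[OF \<kappa>(2), of \<kappa>0] by simp
  finally have 2: "(\<Sum>(\<mu>0, \<mu>1) | (\<mu>0, \<mu>1) \<in> ?L \<and> ?l < ?lv \<mu>0. ?f \<mu>0 \<mu>1) =
    term_sum (low_o_terms t S4 \<kappa>0 \<kappa>1) + term_sum (upp_o_terms t L S4 \<kappa>0 \<kappa>1)" .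
  have disj: "low_o_terms t S2 \<kappa>1 \<kappa>0 \<inter> (low_o_terms t S4 \<kappa>0 \<kappa>1 \<union> upp_o_terms t L S4 \<kappa>0 \<kappa>1) = {}"
    by (auto simp: low_o_terms_def upp_o_terms_def Let_def)
  have "term_sum (node_terms t L (Out \<kappa>0 \<kappa>1)) = term_sum (low_o_terms t S2 \<kappa>1 \<kappa>0) +
      term_sum (low_o_terms t S4 \<kappa>0 \<kappa>1 \<union> upp_o_terms t L S4 \<kappa>0 \<kappa>1)"
    by (rule term_sum_Un[OF node _ disj]) simp
  also have "term_sum (low_o_terms t S4 \<kappa>0 \<kappa>1 \<union> upp_o_terms t L S4 \<kappa>0 \<kappa>1) =
      term_sum (low_o_terms t S4 \<kappa>0 \<kappa>1) + term_sum (upp_o_terms t L S4 \<kappa>0 \<kappa>1)"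
    using finite_terms[OF node] by (intro sum.union_disjoint low_upp_o_disjoint) auto
  finally show ?thesis using split 1 2 by simp
qed

lemma val_eq: "v \<in> nodes t L \<Longrightarrow> val v = term_sum (node_terms t L v)"
proof -
  assume v: "v \<in> nodes t L"
  show ?thesis
  proof (cases v)
    case (Inp \<mu>0 \<mu>1)
    then show ?thesis using v by (auto simp: nodes_def low_nodes_def upp_nodes_def)
  next
    case (Out \<kappa>0 \<kappa>1)
    then have "(\<kappa>0, \<kappa>1) \<in> L Test" using v by (auto simp: nodes_def low_nodes_def upp_nodes_def)
    then show ?thesis using val_out Out by blast
  qed (use v val_low val_upp val_mid1 val_mid2 in blast)+
qed

section \<open>Terms refer to existing nodes, without cycles\<close>

lemma low_o_node:
  assumes "(z, \<kappa>) \<in> low_pairs t L st" "(ds, w) \<in> low_o_terms t st z \<kappa>"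
  shows "\<exists>l \<nu>. w = Low st z l \<nu> \<and> w \<in> low_nodes t L"
proof -
  let ?i = "stage_axis st"
  obtain \<nu> where \<nu>: "w = Low st z (wvl_level (t ?i) Test \<kappa>) \<nu>"
    "\<nu> \<in> near_scl (t ?i) Test \<kappa> Trial (wvl_level (t ?i) Test \<kappa>)"
    using assms(2) by (auto simp: low_o_terms_def low_o_def Let_def)
  then have "(wvl_level (t ?i) Test \<kappa>, \<nu>) \<in> low_idx (t ?i) (low_pairs t L st `` {z})"
    using assms(1) unfolding low_idx_def by (intro SigmaI UN_I[of \<kappa>]) auto
  then show ?thesis using \<nu> by (auto simp: low_nodes_def)
qed

lemma upp_o_node:
  assumes "(ds, w) \<in> upp_o_terms t L st z \<kappa>"
  shows "\<exists>l \<nu>. w = Upp st z l \<nu> \<and> w \<in> upp_nodes t L"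
  using assms by (auto simp: upp_o_terms_def upp_o_def Let_def upp_nodes_def)

text \<open>For terms on the coarser level this is \<open>low_p_idx\<close>. For the source of
  \<open>S2\<close>, the test wavelet required by \<open>low_q\<close> is the very witness in the
  definition of \<open>mid1\<close>.\<close>

lemma low_node:
  assumes "Low st z l \<nu> \<in> low_nodes t L" "(ds, w) \<in> node_terms t L (Low st z l \<nu>)"
  shows "(\<exists>\<nu>2. 1 \<le> l \<and> w = Low st z (l - 1) \<nu>2 \<and> w \<in> low_nodes t L) \<or>
    (\<exists>\<mu>. w = source st z \<mu> \<and> w \<in> case_prod Inp ` L Trial \<union> nodes t L)"
proof -
  let ?i = "stage_axis st"
  have idx: "(l, \<nu>) \<in> low_idx (t ?i) (low_pairs t L st `` {z})" using assms(1) by (auto simp: low_nodes_def)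
  consider (p) \<nu>2 where "\<nu>2 \<in> low_p (t ?i) (low_pairs t L st `` {z}) l \<nu>" "w = Low st z (l - 1) \<nu>2"
    | (q) \<mu> where "\<mu> \<in> low_q (t ?i) (low_dom t L st z) (low_pairs t L st `` {z}) l \<nu>" "w = source st z \<mu>"
    using assms(2) by (auto simp: low_p_terms_def low_q_terms_def Let_def)
  then show ?thesis
  proof cases
    case p
    then show ?thesis using axis.low_p_idx[OF axis_W low_tree low_T idx p(1)] by (auto simp: low_nodes_def)
  next
    case q
    have "source st z \<mu> \<in> case_prod Inp ` L Trial \<union> nodes t L"
    proof (cases st)
      case S2
      then obtain \<kappa>0 where "(\<kappa>0, z) \<in> L Test" "wvl_level (t Ax0) Test \<kappa>0 = l" "\<mu> \<in> near_wvl (t Ax0) Test \<kappa>0 l"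
        using q(1) by (auto simp: low_q_def)
      then have "(\<mu>, z) \<in> mid1 t L" by (auto simp: mid1_def)
      then show ?thesis using S2 by (force simp: nodes_def)
    next
      case S3
      then show ?thesis using q(1) by (auto simp: low_q_def)
    qed (use q(1) in \<open>force simp: low_q_def low_dom_def nodes_def\<close>)+
    then show ?thesis using q(2) by blast
  qed
qed

lemma upp_node:
  assumes "Upp st z l \<nu> \<in> upp_nodes t L" "(ds, w) \<in> node_terms t L (Upp st z l \<nu>)"
  shows "(\<exists>\<nu>2. w = Upp st z (Suc l) \<nu>2 \<and> w \<in> upp_nodes t L) \<or>
    (\<exists>\<mu>. w = source st z \<mu> \<and> w \<in> case_prod Inp ` L Trial \<union> nodes t L)"
proof -
  let ?i = "stage_axis st"
  consider (p) \<nu>2 where "\<nu>2 \<in> upp_p (t ?i) (upp_pairs t L st `` {z}) l \<nu>" "w = Upp st z (Suc l) \<nu>2"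
    | (q) \<mu> \<nu>2 where "(\<mu>, \<nu>2) \<in> upp_q (t ?i) (upp_pairs t L st `` {z}) l \<nu>" "w = source st z \<mu>"
    using assms(2) by (auto simp: upp_p_terms_def upp_q_terms_def Let_def)
  then show ?thesis
  proof cases
    case p
    then obtain \<mu> where "(z, \<mu>) \<in> upp_pairs t L st" "wvl_level (t ?i) Trial \<mu> = Suc l"
      "\<nu>2 \<in> near_scl (t ?i) Trial \<mu> Test (Suc l)" by (auto simp: upp_p_def)
    then have "(Suc l, \<nu>2) \<in> upp_idx (t ?i) (upp_pairs t L st `` {z})"
      unfolding upp_idx_def by (intro SigmaI UN_I[of \<mu>]) (auto intro: rev_image_eqI)
    then show ?thesis using p(2) by (auto simp: upp_nodes_def)
  next
    case q
    then have "(z, \<mu>) \<in> upp_pairs t L st" by (auto simp: upp_q_def)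
    then have "source st z \<mu> \<in> case_prod Inp ` L Trial \<union> nodes t L"
      by (cases st) (force simp: nodes_def)+
    then show ?thesis using q(2) by blast
  qed
qed

text \<open>With B bounding all levels, the ranks form consecutive blocks: inputs at 0,
  \<open>S1\<close> and \<open>S3\<close> in 1 to B + 1, both intermediate vectors at B + 2,
  \<open>S2\<close> and \<open>S4\<close> in B + 3 to 2 * B + 3, the output last. Inside a block,
  lower nodes are ordered by increasing and upper nodes by decreasing level.\<close>

fun rank :: "nat \<Rightarrow> 'i node \<Rightarrow> nat" where
  "rank B (Inp \<mu>0 \<mu>1) = 0"
| "rank B (Low st z l \<nu>) = (if st \<in> {S1, S3} then 1 + l else B + 3 + l)"
| "rank B (Upp st z l \<nu>) = (if st \<in> {S1, S3} then 1 + (B - l) else B + 3 + (B - l))"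
| "rank B (Mid1 \<mu>0 \<kappa>1) = B + 2"
| "rank B (Mid2 \<kappa>0 \<mu>1) = B + 2"
| "rank B (Out \<kappa>0 \<kappa>1) = 2 * B + 4"

fun node_level :: "'i node \<Rightarrow> nat" where
  "node_level (Low st z l \<nu>) = l"
| "node_level (Upp st z l \<nu>) = l"
| "node_level _ = 0"

lemma rank_decreasing:
  assumes B: "\<And>v. v \<in> nodes t L \<Longrightarrow> node_level v \<le> B"
    and v: "v \<in> nodes t L" "(ds, w) \<in> node_terms t L v"
  shows "w \<in> case_prod Inp ` L Trial \<or> w \<in> nodes t L \<and> rank B w < rank B v"
proof -
  have low: "w \<in> nodes t L \<and> rank B w < B + 2 + (if st \<in> {S1, S3} then 0 else B + 2)"
    if "\<exists>l \<nu>. w = Low st z l \<nu> \<and> w \<in> low_nodes t L" for st z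
    using that B[of w] by (auto simp: nodes_def)
  have upp: "w \<in> nodes t L \<and> rank B w < B + 2 + (if st \<in> {S1, S3} then 0 else B + 2)"
    if "\<exists>l \<nu>. w = Upp st z l \<nu> \<and> w \<in> upp_nodes t L" for st z
    using that by (auto simp: nodes_def)
  have src: "rank B (source st z \<mu>) \<le> (if st \<in> {S1, S3} then 0 else B + 2)" for st z \<mu>
    by (cases st) auto
  show ?thesis
  proof (cases v)
    case (Inp \<mu>0 \<mu>1)
    then show ?thesis using v by simp
  next
    case (Low st z l \<nu>)
    then have node: "Low st z l \<nu> \<in> low_nodes t L" using v(1) by (auto simp: nodes_def upp_nodes_def)
    have "(ds, w) \<in> node_terms t L (Low st z l \<nu>)" using v(2) Low by simp
    from low_node[OF node this] consider \<nu>2 where "1 \<le> l" "w = Low st z (l - 1) \<nu>2" "w \<in> low_nodes t L"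
      | \<mu> where "w = source st z \<mu>" "w \<in> case_prod Inp ` L Trial \<union> nodes t L"
      by blast
    then show ?thesis
    proof cases
      case 1
      then show ?thesis using Low by (auto simp: nodes_def)
    next
      case 2
      then show ?thesis using Low src[of st z \<mu>] by (auto split: if_splits)
    qed
  next
    case (Upp st z l \<nu>)
    then have node: "Upp st z l \<nu> \<in> upp_nodes t L" using v(1) by (auto simp: nodes_def low_nodes_def)
    have "(ds, w) \<in> node_terms t L (Upp st z l \<nu>)" using v(2) Upp by simp
    from upp_node[OF node this] consider \<nu>2 where "w = Upp st z (Suc l) \<nu>2" "w \<in> upp_nodes t L"
      | \<mu> where "w = source st z \<mu>" "w \<in> case_prod Inp ` L Trial \<union> nodes t L"
      by blast
    then show ?thesis
    proof cases
      case 1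
      then have "w \<in> nodes t L" by (auto simp: nodes_def)
      \<comment> \<open>This rules out truncation, so that B - Suc l < B - l.\<close>
      then have "Suc l \<le> B" using B[of w] 1 by simp
      then show ?thesis using Upp 1 \<open>w \<in> nodes t L\<close> by auto
    next
      case 2
      then show ?thesis using Upp src[of st z \<mu>] by (auto split: if_splits)
    qed
  next
    case (Mid1 \<mu>0 \<kappa>1)
    then have "(\<mu>0, \<kappa>1) \<in> low_pairs t L S1" using v(1) by (auto simp: nodes_def low_nodes_def upp_nodes_def)
    then show ?thesis using v(2) Mid1 low_o_node[of \<mu>0 \<kappa>1 S1 ds w] upp_o_node[of ds w S1 \<mu>0 \<kappa>1]
        low[of S1 \<mu>0] upp[of S1 \<mu>0] by auto
  next
    case (Mid2 \<kappa>0 \<mu>1)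
    then show ?thesis using v(2) upp_o_node[of ds w S3 \<mu>1 \<kappa>0] upp[of S3 \<mu>1] by auto
  next
    case (Out \<kappa>0 \<kappa>1)
    then have "(\<kappa>0, \<kappa>1) \<in> L Test" using v(1) by (auto simp: nodes_def low_nodes_def upp_nodes_def)
    then show ?thesis using v(2) Out low_o_node[of \<kappa>1 \<kappa>0 S2 ds w] low_o_node[of \<kappa>0 \<kappa>1 S4 ds w]
        upp_o_node[of ds w S4 \<kappa>0 \<kappa>1] low[of S2 \<kappa>1] low[of S4 \<kappa>0] upp[of S4 \<kappa>0] by auto
  qed
qed

lemma terms_length: "(ds, w) \<in> node_terms t L v \<Longrightarrow> length ds \<le> 3"
  by (cases v) (auto simp: low_p_terms_def low_q_terms_def upp_p_terms_def upp_q_terms_def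
      low_o_terms_def upp_o_terms_def q_data_def Let_def)

text \<open>Per unit of \<open>pairs_bound\<close> there are one input, 3 + 8 * K nodes, and 22 * K
  * K terms of at most 7 operations each; 1 + 3 is rounded up to 5.\<close>

lemma exec_tensor_circuit:
  "\<exists>n \<le> (5 + 8 * K + 154 * (K * K)) * pairs_bound. exec E [] (tensor_circuit t L)
     (\<lambda>\<kappa>. if \<kappa> \<in> L Test then val (case_prod Out \<kappa>) else 0) n"
proof -
  have fin: "finite (nodes t L)" using sized_nodes by (simp add: sized_def)
  define B where "B = Max (insert 0 (node_level ` nodes t L))"
  have B: "node_level v \<le> B" if "v \<in> nodes t L" for v
    unfolding B_def using that fin by (intro Max_ge) auto
  have "\<exists>n \<le> card (case_prod Inp ` L Trial) + card (nodes t L) +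
        7 * (\<Sum>v\<in>nodes t L. card (node_terms t L v)).
     exec E [] (tensor_circuit t L) (\<lambda>\<kappa>. if \<kappa> \<in> out_idx E then val (case_prod Out \<kappa>) else 0) n"
    unfolding tensor_circuit_def
  proof (rule exec_circuit[where rank = "rank B"])
    show "finite (case_prod Inp ` L Trial)" using finite_L by simp
    show "finite (nodes t L)" by (rule fin)
    show "finite (node_terms t L v)" if "v \<in> nodes t L" for v by (rule finite_terms[OF that])
    show "w \<in> case_prod Inp ` L Trial \<or> w \<in> nodes t L \<and> rank B w < rank B v"
      if "v \<in> nodes t L" "(ds, w) \<in> node_terms t L v" for v ds w
      using rank_decreasing[OF B that] .
    show "val v = datum_val E (node_datum v)" if "v \<in> case_prod Inp ` L Trial" for v using that by auto
    show "val v = term_sum (node_terms t L v)" if "v \<in> nodes t L" for v by (rule val_eq[OF that])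
    show "length ds \<le> 3" if "(ds, w) \<in> node_terms t L v" for v ds w using terms_length that .
    show "case_prod Out \<kappa> \<in> case_prod Inp ` L Trial \<union> nodes t L" if "\<kappa> \<in> out_idx E" for \<kappa>
      using that by (auto simp: out_idx nodes_def)
  qed
  moreover have "card (case_prod Inp ` L Trial) \<le> pairs_bound"
    using sized_image[OF sized_L'] by (auto simp: sized_def)
  moreover have "card (nodes t L) \<le> (3 + 8 * K) * pairs_bound"
    using sized_nodes by (simp add: sized_def algebra_simps)
  moreover have "(\<Sum>v\<in>nodes t L. card (node_terms t L v)) \<le> 22 * (K * K) * pairs_bound"
    using sized_edges fin finite_terms by (simp add: sized_def)
  ultimately have "\<exists>n \<le> pairs_bound + (3 + 8 * K) * pairs_bound + 7 * (22 * (K * K) * pairs_bound). exec E [] (tensor_circuit t L)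
     (\<lambda>\<kappa>. if \<kappa> \<in> L Test then val (case_prod Out \<kappa>) else 0) n"
    unfolding out_idx by (meson add_mono mult_le_mono2 order_trans)
  moreover have "pairs_bound + (3 + 8 * K) * pairs_bound + 7 * (22 * (K * K) * pairs_bound) \<le>
      (5 + 8 * K + 154 * (K * K)) * pairs_bound" by (simp add: algebra_simps)
  ultimately show ?thesis by (meson order_trans)
qed

end

section \<open>The program\<close>

definition projection_lookups :: "'i lookup set"
  where "projection_lookups = {Projection s i | s i. True}"

definition fibre_lookups :: "(side \<Rightarrow> axis \<Rightarrow> 'i set) \<Rightarrow> 'i lookup set"
  where "fibre_lookups P = {Fibre s Ax1 \<mu> | s \<mu>. \<mu> \<in> P s Ax0}"

definition overlap_lookups :: "(side \<Rightarrow> axis \<Rightarrow> 'i set) \<Rightarrow> 'i lookup set"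
  where "overlap_lookups P = {Overlapping i s Wavelet_Nbhd \<kappa> s' r | i s \<kappa> s' r.
    \<kappa> \<in> P s i \<and> r \<in> {Wavelet_Supp, Scaling_Supp}}"

definition level_lookups ::
  "(side \<Rightarrow> axis \<Rightarrow> 'i set) \<Rightarrow> ('i lookup \<Rightarrow> 'i set) \<Rightarrow> (axis \<times> side \<times> family \<times> 'i) set"
  where "level_lookups P f = {(i, s, Wavelets, \<kappa>) | i s \<kappa>. \<kappa> \<in> P s i} \<union>
    {(i, s', Scalings, \<nu>) | i s' \<nu>. \<exists>s \<kappa>. \<kappa> \<in> P s i \<and>
      \<nu> \<in> f (Overlapping i s Wavelet_Nbhd \<kappa> s' Scaling_Supp)}"

text \<open>Wavelets are filtered by membership in the projections, as levels are asked for these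
  only and no other wavelet occurs in the index sets. The level of a scaling function is asked once
  it has turned up as a neighbour.\<close>

definition tables_of ::
  "(side \<Rightarrow> axis \<Rightarrow> 'i set) \<Rightarrow> ('i lookup \<Rightarrow> 'i set) \<Rightarrow> (axis \<times> side \<times> family \<times> 'i \<Rightarrow> nat) \<Rightarrow>
   axis \<Rightarrow> 'i tables"
  where "tables_of P f lev i =
    \<lparr> near_scl = \<lambda>s \<kappa> s' l. {\<nu> \<in> f (Overlapping i s Wavelet_Nbhd \<kappa> s' Scaling_Supp).
        lev (i, s', Scalings, \<nu>) = l},
      near_wvl = \<lambda>s \<kappa> l. {\<mu> \<in> f (Overlapping i s Wavelet_Nbhd \<kappa> (opposite s) Wavelet_Supp).
        \<mu> \<in> P (opposite s) i \<and> lev (i, opposite s, Wavelets, \<mu>) = l},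
      wvl_level = \<lambda>s \<kappa>. lev (i, s, Wavelets, \<kappa>) \<rparr>"

text \<open>No problem instance appears here: the index sets are rebuilt from their fibres over the
  first direction, and all further combinatorial data come from lookups around the projected
  indices.\<close>

definition tensor_prog :: "'i prog"
  where "tensor_prog =
    ask projection_lookups (\<lambda>f. let P = \<lambda>s i. f (Projection s i) in
    ask (fibre_lookups P) (\<lambda>g.
    ask (overlap_lookups P) (\<lambda>h.
    ask_level (level_lookups P h) (\<lambda>lev.
    tensor_circuit (tables_of P h lev) (\<lambda>s. {(\<mu>, \<nu>). \<mu> \<in> P s Ax0 \<and> \<nu> \<in> g (Fibre s Ax1 \<mu>)})))))"

lemma sized_axis: "sized (UNIV :: axis set) 2"
proof -
  have *: "(UNIV :: axis set) = {Ax0, Ax1}" using axis.exhaust by auto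
  show ?thesis unfolding * by (simp add: sized_def)
qed

lemma sized_side: "sized (UNIV :: side set) 2"
proof -
  have *: "(UNIV :: side set) = {Trial, Test}" using side.exhaust by auto
  show ?thesis unfolding * by (simp add: sized_def)
qed

lemma sized_Sigma:
  assumes "sized X m" "\<And>x. x \<in> X \<Longrightarrow> sized (f x) k"
  shows "sized (Sigma X f) (m * k)"
proof -
  have "Sigma X f = (\<Union>x\<in>X. Pair x ` f x)" by auto
  then show ?thesis using assms by (auto intro!: sized_UN sized_image)
qed

lemma exec_ask_sized:
  assumes "sized qs m" "sized (Sigma qs (answer E)) m'"
    and "exec E rs (k (\<lambda>q. if q \<in> qs then answer E q else {})) y n"
  shows "\<exists>n'. exec E rs (ask qs k) y n' \<and> n' \<le> n + (m + m')"
proof -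
  have fin: "finite qs" using assms(1) by (simp add: sized_def)
  have fin': "finite (answer E q)" if "q \<in> qs" for q
  proof -
    have "Pair q ` answer E q \<subseteq> Sigma qs (answer E)" using that by auto
    then have "finite (Pair q ` answer E q)" using assms(2) finite_subset by (auto simp: sized_def)
    then show ?thesis by (rule finite_imageD) (auto intro: inj_onI)
  qed
  have "(\<Sum>q\<in>qs. 1 + card (answer E q)) = card qs + card (Sigma qs (answer E))"
    using fin fin' unfolding sum.distrib by simp
  then have "(\<Sum>q\<in>qs. 1 + card (answer E q)) \<le> m + m'"
    using assms(1,2) by (simp add: sized_def add_mono)
  then show ?thesis using exec_ask[where k = k, OF fin fin' assms(3)]
    by (intro exI[of _ "n + (\<Sum>q\<in>qs. 1 + card (answer E q))"]) simp
qed

text \<open>The overhead consists of 4 + 4 N for the projections, 4 N for the fibres, 16 N + 16 K N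
  for the overlaps (two axes, two sides, two target sides, two kinds of support), and 4 N + 8 K N
  for the levels.\<close>

lemma exec_tensor_prog:
  fixes L :: "side \<Rightarrow> ('i \<times> 'i) set" and P :: "side \<Rightarrow> axis \<Rightarrow> 'i set"
  assumes P: "\<And>s i. P s i = axis_proj i ` L s" "\<And>s i. answer E (Projection s i) = P s i"
    and F: "\<And>s \<mu>. answer E (Fibre s Ax1 \<mu>) = L s `` {\<mu>}"
    and L: "\<And>s. sized (L s) N"
    and O: "\<And>i s \<kappa> s' r. \<kappa> \<in> P s i \<Longrightarrow> r \<in> {Wavelet_Supp, Scaling_Supp} \<Longrightarrow>
      sized (answer E (Overlapping i s Wavelet_Nbhd \<kappa> s' r)) K"
    and h: "h = (\<lambda>q. if q \<in> overlap_lookups P then answer E q else {})"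
    and lev: "lev = (\<lambda>(i, s, f, \<kappa>). if (i, s, f, \<kappa>) \<in> level_lookups P h then level_of E i s f \<kappa> else 0)"
    and circ: "exec E [] (tensor_circuit (tables_of P h lev) L) y n"
  shows "\<exists>n'. exec E [] tensor_prog y n' \<and> n' \<le> n + (4 + 28 * N + 24 * (K * N))"
proof -
  let ?g = "\<lambda>q. if q \<in> fibre_lookups P then answer E q else {}"
  have PN: "sized (P s i) N" for s i unfolding P(1) by (rule sized_image[OF L])
  have hO: "sized (h (Overlapping i s Wavelet_Nbhd \<kappa> s' r)) K"
    if "\<kappa> \<in> P s i" "r \<in> {Wavelet_Supp, Scaling_Supp}" for i s \<kappa> s' r
    using O[OF that, of s'] that by (auto simp: h sized_def)
  have L_eq: "(\<lambda>s. {(\<mu>, \<nu>). \<mu> \<in> P s Ax0 \<and> \<nu> \<in> ?g (Fibre s Ax1 \<mu>)}) = L"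
  proof
    fix s
    have "Fibre s Ax1 \<mu> \<in> fibre_lookups P" if "\<mu> \<in> P s Ax0" for \<mu>
      using that by (auto simp: fibre_lookups_def)
    then have "{(\<mu>, \<nu>). \<mu> \<in> P s Ax0 \<and> \<nu> \<in> ?g (Fibre s Ax1 \<mu>)} =
        {(\<mu>, \<nu>). \<mu> \<in> P s Ax0 \<and> (\<mu>, \<nu>) \<in> L s}" by (auto simp: F)
    also have "\<dots> = L s" by (force simp: P(1))
    finally show "{(\<mu>, \<nu>). \<mu> \<in> P s Ax0 \<and> \<nu> \<in> ?g (Fibre s Ax1 \<mu>)} = L s" .
  qed

  have "level_lookups P h \<subseteq> (\<Union>i. \<Union>s. (\<lambda>\<kappa>. (i, s, Wavelets, \<kappa>)) ` P s i) \<union>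
      (\<Union>i. \<Union>s. \<Union>\<kappa>\<in>P s i. \<Union>s'.
        (\<lambda>\<nu>. (i, s', Scalings, \<nu>)) ` h (Overlapping i s Wavelet_Nbhd \<kappa> s' Scaling_Supp))"
    unfolding level_lookups_def
  proof (rule Un_mono)
    show "{(i, s', Scalings, \<nu>) | i s' \<nu>. \<exists>s \<kappa>. \<kappa> \<in> P s i \<and>
        \<nu> \<in> h (Overlapping i s Wavelet_Nbhd \<kappa> s' Scaling_Supp)} \<subseteq> (\<Union>i. \<Union>s. \<Union>\<kappa>\<in>P s i. \<Union>s'.
        (\<lambda>\<nu>. (i, s', Scalings, \<nu>)) ` h (Overlapping i s Wavelet_Nbhd \<kappa> s' Scaling_Supp))"
    proof clarify
      fix i s' \<nu> s \<kappa>
      assume "\<kappa> \<in> P s i" "\<nu> \<in> h (Overlapping i s Wavelet_Nbhd \<kappa> s' Scaling_Supp)"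
      then show "(i, s', Scalings, \<nu>) \<in> (\<Union>i. \<Union>s. \<Union>\<kappa>\<in>P s i. \<Union>s'.
        (\<lambda>\<nu>. (i, s', Scalings, \<nu>)) ` h (Overlapping i s Wavelet_Nbhd \<kappa> s' Scaling_Supp))"
        by (intro UN_I[of i] UN_I[of s] UN_I[of \<kappa>] UN_I[of s'] imageI) auto
    qed
  qed auto
  moreover have "sized \<dots> (2 * (2 * N) + 2 * (2 * (N * (2 * K))))"
    by (intro sized_Un sized_UN[OF sized_axis] sized_UN[OF sized_side] sized_UN[OF PN] sized_image PN hO) auto
  ultimately have lq: "sized (level_lookups P h) (2 * (2 * N) + 2 * (2 * (N * (2 * K))))"
    by (rule sized_subset[rotated])
  then have "exec E [] (ask_level (level_lookups P h) (\<lambda>lev. tensor_circuit (tables_of P h lev) L)) y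
      (n + card (level_lookups P h))"
    using circ unfolding lev by (intro exec_ask_level) (auto simp: sized_def)
  then obtain n1 where n1: "exec E [] (ask_level (level_lookups P h) (\<lambda>lev. tensor_circuit (tables_of P h lev) L)) y n1"
    "n1 \<le> n + (2 * (2 * N) + 2 * (2 * (N * (2 * K))))"
    using lq by (auto simp: sized_def)

  have "overlap_lookups P \<subseteq> (\<Union>i. \<Union>s. (\<lambda>(\<kappa>, s', r). Overlapping i s Wavelet_Nbhd \<kappa> s' r) `
      (P s i \<times> (UNIV \<times> {Wavelet_Supp, Scaling_Supp})))"
  proof
    fix x assume "x \<in> overlap_lookups P"
    then obtain i s \<kappa> s' r where "x = Overlapping i s Wavelet_Nbhd \<kappa> s' r" "\<kappa> \<in> P s i"
      "r \<in> {Wavelet_Supp, Scaling_Supp}" unfolding overlap_lookups_def by blast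
    then show "x \<in> (\<Union>i. \<Union>s. (\<lambda>(\<kappa>, s', r). Overlapping i s Wavelet_Nbhd \<kappa> s' r) `
      (P s i \<times> (UNIV \<times> {Wavelet_Supp, Scaling_Supp})))"
      by (intro UN_I[of i] UN_I[of s] image_eqI[of _ _ "(\<kappa>, s', r)"]) auto
  qed
  moreover have "sized \<dots> (2 * (2 * (N * (2 * 2))))"
    by (intro sized_UN[OF sized_axis] sized_UN[OF sized_side] sized_image sized_Times PN sized_side)
      (simp add: sized_def)
  ultimately have oq: "sized (overlap_lookups P) (2 * (2 * (N * (2 * 2))))" by (rule sized_subset[rotated])
  moreover have "sized (Sigma (overlap_lookups P) (answer E)) (2 * (2 * (N * (2 * 2))) * K)"
    by (rule sized_Sigma[OF oq]) (auto simp: overlap_lookups_def intro!: O)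
  ultimately obtain n2 where n2: "exec E [] (ask (overlap_lookups P) (\<lambda>h. ask_level (level_lookups P h)
       (\<lambda>lev. tensor_circuit (tables_of P h lev) L))) y n2"
    "n2 \<le> n1 + (2 * (2 * (N * (2 * 2))) + 2 * (2 * (N * (2 * 2))) * K)"
    using exec_ask_sized[OF oq, where k = "\<lambda>h. ask_level (level_lookups P h)
       (\<lambda>lev. tensor_circuit (tables_of P h lev) L)" and rs = "[]" and y = y and n = n1] n1(1)
    unfolding h by blast

  have fq1: "sized (fibre_lookups P) (2 * N)"
  proof -
    have "fibre_lookups P = (\<Union>s. Fibre s Ax1 ` P s Ax0)" by (auto simp: fibre_lookups_def)
    moreover have "sized \<dots> (2 * N)" by (intro sized_UN[OF sized_side] sized_image PN)
    ultimately show ?thesis by simp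
  qed
  have fq2: "sized (Sigma (fibre_lookups P) (answer E)) (2 * N)"
  proof (rule sized_subset)
    show "sized (\<Union>s. (\<lambda>(\<mu>, \<nu>). (Fibre s Ax1 \<mu>, \<nu>)) ` L s) (2 * N)"
      by (intro sized_UN[OF sized_side] sized_image L)
    show "Sigma (fibre_lookups P) (answer E) \<subseteq> (\<Union>s. (\<lambda>(\<mu>, \<nu>). (Fibre s Ax1 \<mu>, \<nu>)) ` L s)"
      by (force simp: fibre_lookups_def F)
  qed
  obtain n3 where n3: "exec E [] (ask (fibre_lookups P) (\<lambda>g. ask (overlap_lookups P) (\<lambda>h.
      ask_level (level_lookups P h) (\<lambda>lev. tensor_circuit (tables_of P h lev)
        (\<lambda>s. {(\<mu>, \<nu>). \<mu> \<in> P s Ax0 \<and> \<nu> \<in> g (Fibre s Ax1 \<mu>)}))))) y n3"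
    "n3 \<le> n2 + (2 * N + 2 * N)"
    using exec_ask_sized[OF fq1 fq2, where k = "\<lambda>g. ask (overlap_lookups P) (\<lambda>h.
      ask_level (level_lookups P h) (\<lambda>lev. tensor_circuit (tables_of P h lev)
        (\<lambda>s. {(\<mu>, \<nu>). \<mu> \<in> P s Ax0 \<and> \<nu> \<in> g (Fibre s Ax1 \<mu>)})))" and rs = "[]" and y = y and n = n2]
      n2(1) unfolding L_eq by blast

  have pq: "sized (projection_lookups :: 'i lookup set) (2 * 2)"
  proof -
    have eq: "(projection_lookups :: 'i lookup set) = (\<lambda>(s, i). Projection s i) ` (UNIV \<times> UNIV)"
      by (auto simp: projection_lookups_def)
    show ?thesis unfolding eq by (intro sized_image sized_Times sized_side sized_axis)
  qed
  have pS: "sized (Sigma projection_lookups (answer E)) (2 * 2 * N)"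
    by (rule sized_Sigma[OF pq]) (auto simp: projection_lookups_def P(2) PN)
  have P_eq: "(\<lambda>s i. if Projection s i \<in> projection_lookups then answer E (Projection s i) else {}) = P"
    by (auto simp: projection_lookups_def P(2) fun_eq_iff)
  obtain n4 where "exec E [] tensor_prog y n4" "n4 \<le> n3 + (2 * 2 + 2 * 2 * N)"
    using exec_ask_sized[OF pq pS, where k = "\<lambda>f. let P = \<lambda>s i. f (Projection s i) in
      ask (fibre_lookups P) (\<lambda>g. ask (overlap_lookups P) (\<lambda>h.
      ask_level (level_lookups P h) (\<lambda>lev. tensor_circuit (tables_of P h lev)
        (\<lambda>s. {(\<mu>, \<nu>). \<mu> \<in> P s Ax0 \<and> \<nu> \<in> g (Fibre s Ax1 \<mu>)}))))" and rs = "[]" and y = y and n = n3]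
      n3(1) unfolding tensor_prog_def Let_def P_eq by blast
  then show ?thesis using n1(2) n2(2) n3(2) by (intro exI[of _ n4]) (simp add: algebra_simps)
qed

section \<open>Application to multilevel systems\<close>

lemma overlapping_bound_sides:
  fixes N :: "side \<Rightarrow> ('a::euclidean_space, 'i) multilevel"
  assumes "\<And>s. multilevel_system Q (N s)"
  shows "\<exists>K. \<forall>s s'. \<forall>\<kappa>\<in>wvl_idx (N s). \<forall>r\<in>{Wavelet_Supp, Scaling_Supp}.
    sized (overlapping Q (N s) Wavelet_Nbhd \<kappa> (N s') r) K"
proof -
  have "\<forall>s s' r. \<exists>K. r \<in> {Wavelet_Supp, Scaling_Supp} \<longrightarrow> (\<forall>\<kappa>\<in>wvl_idx (N s).
      sized (overlapping Q (N s) Wavelet_Nbhd \<kappa> (N s') r) K)"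
    using overlapping_bound[OF assms assms] unfolding sized_def by meson
  then obtain K where K: "\<And>s s' r \<kappa>. r \<in> {Wavelet_Supp, Scaling_Supp} \<Longrightarrow> \<kappa> \<in> wvl_idx (N s) \<Longrightarrow>
      sized (overlapping Q (N s) Wavelet_Nbhd \<kappa> (N s') r) (K s s' r)" by metis
  let ?K = "\<Sum>s\<in>{Trial, Test}. \<Sum>s'\<in>{Trial, Test}. \<Sum>r\<in>{Wavelet_Supp, Scaling_Supp}. K s s' r"
  have "K s s' r \<le> ?K" if "r \<in> {Wavelet_Supp, Scaling_Supp}" for s s' r
    using that by (cases s; cases s') auto
  then have "\<forall>s s'. \<forall>\<kappa>\<in>wvl_idx (N s). \<forall>r\<in>{Wavelet_Supp, Scaling_Supp}.
    sized (overlapping Q (N s) Wavelet_Nbhd \<kappa> (N s') r) ?K"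
    using K sized_mono by blast
  then show ?thesis by blast
qed

lemma local_axis_tables_of:
  fixes N :: "side \<Rightarrow> ('a::euclidean_space, 'i) multilevel"
  assumes sys: "\<And>s. multilevel_system Q (N s)" and A: "local_operator Q (N Trial) (N Test) A"
    and W: "\<And>s. finite (P s i)" "\<And>s. P s i \<subseteq> wvl_idx (N s)"
    and h: "\<And>s \<kappa> s' r. \<kappa> \<in> P s i \<Longrightarrow> r \<in> {Wavelet_Supp, Scaling_Supp} \<Longrightarrow>
      h (Overlapping i s Wavelet_Nbhd \<kappa> s' r) = overlapping Q (N s) Wavelet_Nbhd \<kappa> (N s') r"
    and lw: "\<And>s \<kappa>. \<kappa> \<in> P s i \<Longrightarrow> lev (i, s, Wavelets, \<kappa>) = lvl (N s) \<kappa>"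
    and ls: "\<And>s \<kappa> s' \<nu>. \<kappa> \<in> P s i \<Longrightarrow> \<nu> \<in> overlapping Q (N s) Wavelet_Nbhd \<kappa> (N s') Scaling_Supp \<Longrightarrow>
      lev (i, s', Scalings, \<nu>) = family_level (N s') Scalings \<nu>"
    and K: "\<And>s s' \<kappa> r. \<kappa> \<in> wvl_idx (N s) \<Longrightarrow> r \<in> {Wavelet_Supp, Scaling_Supp} \<Longrightarrow>
      sized (overlapping Q (N s) Wavelet_Nbhd \<kappa> (N s') r) K"
  shows "local_axis Q N A (tables_of P h lev i) (\<lambda>s. P s i) K"
proof (rule local_axis.intro, goal_cases)
  case 1 show ?case by (rule sys)
next
  case 2 show ?case by (rule A)
next
  case 3 show ?case by (rule W)
next
  case 4 show ?case by (rule W)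
next
  case (5 \<kappa> s \<nu> s' l)
  interpret multilevel_system Q "N s'" by (rule sys)
  have \<kappa>: "\<kappa> \<in> wvl_idx (N s)" using 5 W(2) by blast
  have hs: "h (Overlapping i s Wavelet_Nbhd \<kappa> s' Scaling_Supp) =
      overlapping Q (N s) Wavelet_Nbhd \<kappa> (N s') Scaling_Supp" using h[OF 5] by simp
  \<comment> \<open>As the index sets of the levels are disjoint, the looked-up level decides to
    which of them \<nu> belongs.\<close>
  have mem: "\<nu> \<in> scl_idx (N s') k \<longleftrightarrow> \<nu> \<in> scl_all (N s') \<and> family_level (N s') Scalings \<nu> = k" for k
    using family_level_scl by (auto simp: scl_all_def simp del: family_level.simps)
  have "\<nu> \<in> near_scl (tables_of P h lev i) s \<kappa> s' l \<longleftrightarrow>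
      \<nu> \<in> overlapping Q (N s) Wavelet_Nbhd \<kappa> (N s') Scaling_Supp \<and> family_level (N s') Scalings \<nu> = l"
    using ls[OF 5, of \<nu> s'] by (auto simp: tables_of_def hs simp del: family_level.simps)
  also have "\<dots> \<longleftrightarrow> \<nu> \<in> scl_idx (N s') l \<and> \<bar>int l - int (lvl (N s) \<kappa>)\<bar> \<le> 1 \<and>
      region_set Q (N s) Wavelet_Nbhd \<kappa> \<inter> supp Q (scl (N s') \<nu>) \<noteq> {}"
    unfolding mem overlapping_def using \<kappa> by (auto simp: region_set.simps(3) simp del: family_level.simps(2))
  finally show ?case .
next
  case (6 \<kappa> s \<mu> l)
  have \<kappa>: "\<kappa> \<in> wvl_idx (N s)" using 6 W(2) by blast
  have hs: "h (Overlapping i s Wavelet_Nbhd \<kappa> (opposite s) Wavelet_Supp) =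
      overlapping Q (N s) Wavelet_Nbhd \<kappa> (N (opposite s)) Wavelet_Supp" using h[OF 6] by simp
  have "\<mu> \<in> near_wvl (tables_of P h lev i) s \<kappa> l \<longleftrightarrow>
      \<mu> \<in> overlapping Q (N s) Wavelet_Nbhd \<kappa> (N (opposite s)) Wavelet_Supp \<and>
      \<mu> \<in> P (opposite s) i \<and> lvl (N (opposite s)) \<mu> = l"
    using lw[of \<mu> "opposite s"] by (auto simp: tables_of_def hs)
  also have "\<dots> \<longleftrightarrow> \<mu> \<in> P (opposite s) i \<and> lvl (N (opposite s)) \<mu> = l \<and>
      \<bar>int l - int (lvl (N s) \<kappa>)\<bar> \<le> 1 \<and>
      region_set Q (N s) Wavelet_Nbhd \<kappa> \<inter> supp Q (wvl (N (opposite s)) \<mu>) \<noteq> {}"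
    unfolding overlapping_def using \<kappa> W(2)[of "opposite s"] by (auto simp: region_set.simps(1))
  finally show ?case .
next
  case (7 \<kappa> s)
  then show ?case using lw by (simp add: tables_of_def)
next
  case (8 \<kappa> s s' l)
  have "near_scl (tables_of P h lev i) s \<kappa> s' l \<subseteq> overlapping Q (N s) Wavelet_Nbhd \<kappa> (N s') Scaling_Supp"
    using h[OF 8] by (auto simp: tables_of_def)
  moreover have "sized (overlapping Q (N s) Wavelet_Nbhd \<kappa> (N s') Scaling_Supp) K"
    using 8 W(2) by (intro K) auto
  ultimately show ?case using sized_subset unfolding sized_def by metis
next
  case (9 \<kappa> s l)
  have "near_wvl (tables_of P h lev i) s \<kappa> l \<subseteq> overlapping Q (N s) Wavelet_Nbhd \<kappa> (N (opposite s)) Wavelet_Supp"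
    using h[OF 9] by (auto simp: tables_of_def)
  moreover have "sized (overlapping Q (N s) Wavelet_Nbhd \<kappa> (N (opposite s)) Wavelet_Supp) K"
    using 9 W(2) by (intro K) auto
  ultimately show ?case using sized_subset unfolding sized_def by metis
qed

text \<open>The definition speaks of fibres over projected indices; all other fibres are empty, and
  the empty set is a tree.\<close>

lemma double_tree_fibres:
  assumes "double_tree M0 M1 L"
  shows "tree M0 (L\<inverse> `` {z})" "tree M1 (L `` {z})"
proof -
  have f: "fibre L Ax0 z = L\<inverse> `` {z}" "fibre L Ax1 z = L `` {z}" by (force simp: fibre_def)+
  have "tree M0 (fibre L Ax0 z)"
  proof (cases "z \<in> axis_proj Ax1 ` L")
    case True
    then show ?thesis using assms by (auto simp: double_tree_def)
  next
    case False
    then have "fibre L Ax0 z = {}" by (force simp: fibre_def)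
    then show ?thesis by (simp add: tree_def)
  qed
  then show "tree M0 (L\<inverse> `` {z})" by (simp only: f)
  have "tree M1 (fibre L Ax1 z)"
  proof (cases "z \<in> axis_proj Ax0 ` L")
    case True
    then show ?thesis using assms by (auto simp: double_tree_def)
  next
    case False
    then have "fibre L Ax1 z = {}" by (force simp: fibre_def)
    then show ?thesis by (simp add: tree_def)
  qed
  then show "tree M1 (L `` {z})" by (simp only: f)
qed

lemma tensor_prog_correct:
  fixes N0 :: "side \<Rightarrow> ('a::euclidean_space, 'i) multilevel"
    and N1 :: "side \<Rightarrow> ('b::euclidean_space, 'i) multilevel"
    and L :: "side \<Rightarrow> ('i \<times> 'i) set"
  assumes sys: "\<And>s. multilevel_system Q0 (N0 s)" "\<And>s. multilevel_system Q1 (N1 s)"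
    and A: "local_operator Q0 (N0 Trial) (N0 Test) A0" "local_operator Q1 (N1 Trial) (N1 Test) A1"
    and L: "\<And>s. finite (L s)" "\<And>s. double_tree (N0 s) (N1 s) (L s)"
    and K: "\<And>s s' \<kappa> r. \<kappa> \<in> wvl_idx (N0 s) \<Longrightarrow> r \<in> {Wavelet_Supp, Scaling_Supp} \<Longrightarrow>
        sized (overlapping Q0 (N0 s) Wavelet_Nbhd \<kappa> (N0 s') r) K"
      "\<And>s s' \<kappa> r. \<kappa> \<in> wvl_idx (N1 s) \<Longrightarrow> r \<in> {Wavelet_Supp, Scaling_Supp} \<Longrightarrow>
        sized (overlapping Q1 (N1 s) Wavelet_Nbhd \<kappa> (N1 s') r) K"
    and E: "E = \<lparr> answer = problem_answer Q0 N0 Q1 N1 L, level_of = problem_level N0 N1,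
      datum_val = problem_datum N0 A0 N1 A1 (L Trial) c, out_idx = L Test \<rparr>"
  shows "\<exists>n. exec E [] tensor_prog (tensor_apply (N0 Trial) (N0 Test) A0 (N1 Trial) (N1 Test) A1 (L Trial) (L Test) c) n \<and>
    n \<le> 4 + (28 + 24 * K + (5 + 8 * K + 154 * (K * K)) * (K + 1)) * (card (L Test) + card (L Trial))"
proof -
  define P where "P s i = axis_proj i ` L s" for s i
  define h where "h = (\<lambda>q. if q \<in> overlap_lookups P then answer E q else {})"
  define lev where "lev = (\<lambda>(i, s, f, \<kappa>). if (i, s, f, \<kappa>) \<in> level_lookups P h then level_of E i s f \<kappa> else 0)"
  let ?t = "tables_of P h lev"
  let ?N = "card (L Test) + card (L Trial)"
  have P_fin: "finite (P s i)" for s i using L(1) by (simp add: P_def)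
  have P_idx: "P s Ax0 \<subseteq> wvl_idx (N0 s)" "P s Ax1 \<subseteq> wvl_idx (N1 s)" for s
    using L(2)[of s] by (auto simp: P_def double_tree_def)
  have hO: "h (Overlapping i s Wavelet_Nbhd \<kappa> s' r) = answer E (Overlapping i s Wavelet_Nbhd \<kappa> s' r)"
    if "\<kappa> \<in> P s i" "r \<in> {Wavelet_Supp, Scaling_Supp}" for i s \<kappa> s' r
  proof -
    have "Overlapping i s Wavelet_Nbhd \<kappa> s' r \<in> overlap_lookups P" using that by (auto simp: overlap_lookups_def)
    then show ?thesis by (simp add: h_def)
  qed
  have lw: "lev (i, s, Wavelets, \<kappa>) = level_of E i s Wavelets \<kappa>" if "\<kappa> \<in> P s i" for i s \<kappa>
  proof -
    have "(i, s, Wavelets, \<kappa>) \<in> level_lookups P h" using that by (simp add: level_lookups_def)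
    then show ?thesis by (simp add: lev_def)
  qed
  have ls: "lev (i, s', Scalings, \<nu>) = level_of E i s' Scalings \<nu>"
    if "\<kappa> \<in> P s i" "\<nu> \<in> answer E (Overlapping i s Wavelet_Nbhd \<kappa> s' Scaling_Supp)" for i s s' \<kappa> \<nu>
  proof -
    have "\<nu> \<in> h (Overlapping i s Wavelet_Nbhd \<kappa> s' Scaling_Supp)" using that hO[of \<kappa> s i] by simp
    then have "(i, s', Scalings, \<nu>) \<in> level_lookups P h" using that(1) by (auto simp: level_lookups_def)
    then show ?thesis by (simp add: lev_def)
  qed
  have ax0: "local_axis Q0 N0 A0 (?t Ax0) (\<lambda>s. P s Ax0) K"
    by (rule local_axis_tables_of[where P = P and i = Ax0, OF sys(1) A(1) P_fin P_idx(1)])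
      (use hO[where i = Ax0] lw[where i = Ax0] ls[where i = Ax0] K(1) in \<open>simp_all add: E del: family_level.simps(2)\<close>)
  have ax1: "local_axis Q1 N1 A1 (?t Ax1) (\<lambda>s. P s Ax1) K"
    by (rule local_axis_tables_of[where P = P and i = Ax1, OF sys(2) A(2) P_fin P_idx(2)])
      (use hO[where i = Ax1] lw[where i = Ax1] ls[where i = Ax1] K(2) in \<open>simp_all add: E del: family_level.simps(2)\<close>)
  let ?tr = "\<lambda>i s. case i of Ax0 \<Rightarrow> tree (N0 s) | Ax1 \<Rightarrow> tree (N1 s)"
  let ?p = "\<lambda>i s. case i of Ax0 \<Rightarrow> mask_p (N0 s) | Ax1 \<Rightarrow> mask_p (N1 s)"
  let ?q = "\<lambda>i s. case i of Ax0 \<Rightarrow> mask_q (N0 s) | Ax1 \<Rightarrow> mask_q (N1 s)"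
  let ?a = "\<lambda>i. case i of Ax0 \<Rightarrow> scl_entry N0 A0 | Ax1 \<Rightarrow> scl_entry N1 A1"
  let ?mat = "\<lambda>i. case i of Ax0 \<Rightarrow> op_matrix (N0 Trial) (N0 Test) A0 | Ax1 \<Rightarrow> op_matrix (N1 Trial) (N1 Test) A1"
  let ?low = "\<lambda>i. case i of Ax0 \<Rightarrow> local_axis.low N0 | Ax1 \<Rightarrow> local_axis.low N1"
  let ?upp = "\<lambda>i. case i of Ax0 \<Rightarrow> local_axis.upp N0 A0 | Ax1 \<Rightarrow> local_axis.upp N1 A1"
  interpret two_axes ?t L ?tr ?p ?q ?a ?mat ?low ?upp K E
  proof (rule two_axes.intro, goal_cases)
    case (1 i)
    show ?case using local_axis.axis[OF ax0] local_axis.axis[OF ax1] by (cases i) (simp_all add: P_def)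
  next
    case 2 show ?case by (rule L)
  next
    case 3 show ?case using double_tree_fibres[OF L(2)] by simp
  next
    case 4 show ?case using double_tree_fibres[OF L(2)] by simp
  next
    case (5 i) show ?case by (cases i) (simp_all add: E)
  next
    case (6 i) show ?case by (cases i) (simp_all add: E)
  next
    case (7 i) show ?case by (cases i) (simp_all add: E)
  next
    case 8 show ?case by (simp add: E)
  qed
  let ?y = "\<lambda>\<kappa>. if \<kappa> \<in> L Test then val (case_prod Out \<kappa>) else 0"
  have y: "?y = tensor_apply (N0 Trial) (N0 Test) A0 (N1 Trial) (N1 Test) A1 (L Trial) (L Test) c"
  proof -
    have "val (Out \<kappa>0 \<kappa>1) = (\<Sum>(\<mu>0, \<mu>1)\<in>L Trial. op_matrix (N0 Trial) (N0 Test) A0 \<kappa>0 \<mu>0 *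
        op_matrix (N1 Trial) (N1 Test) A1 \<kappa>1 \<mu>1 * c (\<mu>0, \<mu>1))" for \<kappa>0 \<kappa>1
      unfolding val.simps by (rule sum.cong) (auto simp: E)
    then show ?thesis by (auto simp: tensor_apply_def fun_eq_iff)
  qed
  obtain n where n: "n \<le> (5 + 8 * K + 154 * (K * K)) * pairs_bound" "exec E [] (tensor_circuit ?t L) ?y n"
    using exec_tensor_circuit by auto
  have "\<exists>n'. exec E [] tensor_prog ?y n' \<and> n' \<le> n + (4 + 28 * ?N + 24 * (K * ?N))"
  proof (rule exec_tensor_prog[OF P_def _ _ sized_L _ h_def lev_def n(2)])
    show "answer E (Projection s i) = P s i" for s i by (simp add: E P_def)
    show "answer E (Fibre s Ax1 \<mu>) = L s `` {\<mu>}" for s \<mu> by (force simp: E fibre_def)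
    show "sized (answer E (Overlapping i s Wavelet_Nbhd \<kappa> s' r)) K"
      if "\<kappa> \<in> P s i" "r \<in> {Wavelet_Supp, Scaling_Supp}" for i s \<kappa> s' r
      using that K(1)[of \<kappa> s r s'] K(2)[of \<kappa> s r s'] P_idx[of s] by (cases i) (auto simp: E)
  qed
  then obtain n' where n': "exec E [] tensor_prog ?y n'" "n' \<le> n + (4 + 28 * ?N + 24 * (K * ?N))" by blast
  have "n' \<le> (5 + 8 * K + 154 * (K * K)) * ((K + 1) * ?N) + (4 + 28 * ?N + 24 * (K * ?N))"
    using n(1) n'(2) by (simp add: pairs_bound_def)
  also have "\<dots> = 4 + (28 + 24 * K + (5 + 8 * K + 154 * (K * K)) * (K + 1)) * ?N"
    by (simp add: algebra_simps)
  finally show ?thesis using n'(1) y by auto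
qed

theorem corollary3p14:
  "\<exists>prog :: 'i prog.
     \<forall>(Q0 :: 'a::euclidean_space set) (M0 :: ('a, 'i) multilevel) M0'
      (Q1 :: 'b::euclidean_space set) (M1 :: ('b, 'i) multilevel) M1'.
       multilevel_system Q0 M0 \<and> multilevel_system Q0 M0' \<and>
       multilevel_system Q1 M1 \<and> multilevel_system Q1 M1' \<longrightarrow>
       (\<exists>C :: nat. \<forall>A0 A1 L L' c.
          local_operator Q0 M0 M0' A0 \<and> local_operator Q1 M1 M1' A1 \<and>
          finite L \<and> double_tree M0 M1 L \<and> finite L' \<and> double_tree M0' M1' L' \<longrightarrow>
          (\<exists>n. exec (problem_env Q0 M0 M0' A0 Q1 M1 M1' A1 L L' c) [] prog
                 (tensor_apply M0 M0' A0 M1 M1' A1 L L' c) n \<and>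
               n \<le> C * max 1 (card L' + card L)))"
\<comment> \<open>One program serves all systems, which it meets only through its environment. The
  constant is chosen after the systems but before operators, index sets and vector.\<close>
proof (rule exI[of _ tensor_prog], intro allI impI, elim conjE)
  fix Q0 :: "'a set" and M0 M0' :: "('a, 'i) multilevel"
    and Q1 :: "'b set" and M1 M1' :: "('b, 'i) multilevel"
  assume sys: "multilevel_system Q0 M0" "multilevel_system Q0 M0'"
    "multilevel_system Q1 M1" "multilevel_system Q1 M1'"
  have s0: "multilevel_system Q0 (pick M0 M0' s)" for s using sys by (cases s) auto
  have s1: "multilevel_system Q1 (pick M1 M1' s)" for s using sys by (cases s) auto
  obtain K0 where K0: "\<And>s s' \<kappa> r. \<kappa> \<in> wvl_idx (pick M0 M0' s) \<Longrightarrow> r \<in> {Wavelet_Supp, Scaling_Supp} \<Longrightarrow>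
      sized (overlapping Q0 (pick M0 M0' s) Wavelet_Nbhd \<kappa> (pick M0 M0' s') r) K0"
    using overlapping_bound_sides[of Q0 "pick M0 M0'", OF s0] that by blast
  obtain K1 where K1: "\<And>s s' \<kappa> r. \<kappa> \<in> wvl_idx (pick M1 M1' s) \<Longrightarrow> r \<in> {Wavelet_Supp, Scaling_Supp} \<Longrightarrow>
      sized (overlapping Q1 (pick M1 M1' s) Wavelet_Nbhd \<kappa> (pick M1 M1' s') r) K1"
    using overlapping_bound_sides[of Q1 "pick M1 M1'", OF s1] that by blast
  define K where "K = K0 + K1"
  let ?C = "28 + 24 * K + (5 + 8 * K + 154 * (K * K)) * (K + 1)"
  show "\<exists>C :: nat. \<forall>A0 A1 L L' c.
          local_operator Q0 M0 M0' A0 \<and> local_operator Q1 M1 M1' A1 \<and>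
          finite L \<and> double_tree M0 M1 L \<and> finite L' \<and> double_tree M0' M1' L' \<longrightarrow>
          (\<exists>n. exec (problem_env Q0 M0 M0' A0 Q1 M1 M1' A1 L L' c) [] tensor_prog
                 (tensor_apply M0 M0' A0 M1 M1' A1 L L' c) n \<and>
               n \<le> C * max 1 (card L' + card L))"
  \<comment> \<open>The 4 pays for the projection lookups, which are made even if both index sets
    are empty; this is what \<open>max 1\<close> accommodates.\<close>
  proof (rule exI[of _ "4 + ?C"], intro allI impI, elim conjE)
    fix A0 A1 L L' c
    assume *: "local_operator Q0 M0 M0' A0" "local_operator Q1 M1 M1' A1"
      "finite L" "double_tree M0 M1 L" "finite L'" "double_tree M0' M1' L'"
    let ?m = "max 1 (card L' + card L)"
    let ?E = "problem_env Q0 M0 M0' A0 Q1 M1 M1' A1 L L' c"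
    have "\<exists>n. exec ?E [] tensor_prog (tensor_apply (pick M0 M0' Trial) (pick M0 M0' Test) A0
        (pick M1 M1' Trial) (pick M1 M1' Test) A1 (pick L L' Trial) (pick L L' Test) c) n \<and>
      n \<le> 4 + ?C * (card (pick L L' Test) + card (pick L L' Trial))"
    proof (rule tensor_prog_correct[OF s0 s1])
      show "local_operator Q0 (pick M0 M0' Trial) (pick M0 M0' Test) A0"
        "local_operator Q1 (pick M1 M1' Trial) (pick M1 M1' Test) A1" using * by auto
      show "finite (pick L L' s)" "double_tree (pick M0 M0' s) (pick M1 M1' s) (pick L L' s)" for s
        using * by (cases s; simp)+
      show "sized (overlapping Q0 (pick M0 M0' s) Wavelet_Nbhd \<kappa> (pick M0 M0' s') r) K"
        if "\<kappa> \<in> wvl_idx (pick M0 M0' s)" "r \<in> {Wavelet_Supp, Scaling_Supp}" for s s' \<kappa> r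
        by (rule sized_mono[OF K0[OF that]]) (simp add: K_def)
      show "sized (overlapping Q1 (pick M1 M1' s) Wavelet_Nbhd \<kappa> (pick M1 M1' s') r) K"
        if "\<kappa> \<in> wvl_idx (pick M1 M1' s)" "r \<in> {Wavelet_Supp, Scaling_Supp}" for s s' \<kappa> r
        by (rule sized_mono[OF K1[OF that]]) (simp add: K_def)
    qed (simp add: problem_env_def)
    then obtain n where n: "exec ?E [] tensor_prog (tensor_apply M0 M0' A0 M1 M1' A1 L L' c) n"
      "n \<le> 4 + ?C * (card L' + card L)" by auto
    have "4 + ?C * (card L' + card L) \<le> 4 * ?m + ?C * ?m"
      by (intro add_mono mult_le_mono) auto
    then have "n \<le> (4 + ?C) * ?m" using n(2) by (simp only: add_mult_distrib)
    then show "\<exists>n. exec ?E [] tensor_prog (tensor_apply M0 M0' A0 M1 M1' A1 L L' c) n \<and>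
        n \<le> (4 + ?C) * ?m" using n(1) by blast
  qed
qed

end
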